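(* Let $X$ be a differentiable manifold, $G$ a finite dimensional connected Lie group, $K$ a compact subgroup of $G$, $Y:=G/K$ and $\pi:G\to G/K$ the canonical projection. Let $(x_t,y_t)_{t\ge0}$ be a diffusion process with values in $X\times Y$, with law $\mathbb P_{(x,y)}$ when started from $(x,y)$. Suppose that there exists a $K$-right equivariant diffusion $(x_t,g_t)_{t\ge0}$ in $X\times G$ satisfying the Dévissage, Convergence, Equivariance and Regularity conditions (stated in the context) such that, for every $(x,y)\in X\times Y$ and every $g\in\pi^{-1}(\{y\})$, the process $(x_t,y_t)_{t\ge0}$ under $\mathbb P_{(x,y)}$ has the same law as $(x_t,\pi(g_t))_{t\ge0}$ under $\mathbb P_{(x,g)}$. In particular $y_t$ converges $\mathbb P_{(x,y)}$-almost surely, as $t\to+\infty$, to a random element $y_\infty$ of $Y$. Then, for every starting point $(x,y)\in X\times Y$, the two sigma fields $$\mathrm{Inv}((x_t,y_t)_{t\ge0})\quad\text{and}\quad \mathrm{Inv}((x_t)_{t\ge0})\vee\sigma(y_\infty)$$ coincide up to $\mathbb P_{(x,y)}$-negligible sets.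
   Context: Setting. Processes are realized as coordinate processes on the path spaces $C(\mathbb R^+,X\times Y)$ and $\Omega=C(\mathbb R^+,X\times G)$ with their Borel sigma fields; $\mathbb P_{(x,g)}$ is the law of $(x_t,g_t)_{t\ge 0}$ started from $(x,g)$ and $\mathbb E_{(x,g)}$ the expectation. All diffusions have infinite lifetime. As usual, a diffusion with generator $\mathcal L$ (acting on smooth functions) means that its laws form a strong Markov family on continuous paths, the law from each point being the unique solution of the martingale problem for $\mathcal L$ (with smooth compactly supported test functions) started there. Invariant sigma field. Let $\theta_s\omega=(\omega_{t+s})_{t\ge0}$ be the shift operators. For a process $(z_t)_{t\ge0}$ with tail sigma field $\mathcal F^\infty=\bigcap_{t\ge0}\sigma(z_s,\,s\ge t)$, $\mathrm{Inv}((z_t)_{t\ge0})$ is the sigma field of all $A\in\mathcal F^\infty$ with $\theta_s^{-1}A=A$ for all $s>0$. A sigma field is trivial for $\mathbb P$ if all its events have $\mathbb P$-probability $0$ or $1$. $K$-right equivariance: for all $k\in K$ and $(x,g)$, the law of $(x_t,g_tk)_{t\ge0}$ under $\mathbb P_{(x,g)}$ is the law of $(x_t,g_t)_{t\ge0}$ under $\mathbb P_{(x,gk)}$. Action of $G$. For $g\in G$ and $f\in C^\infty(X\times G,\mathbb R)$, $(g\cdot f)(x,h):=f(x,gh)$. Harmonic functions. A bounded measurable $H:X\times G\to\mathbb R$ is $\mathcal L$-harmonic if $H(x,g)=\mathbb E_{(x,g)}[H(x_t,g_t)]$ for all $t\ge0$ and all $(x,g)$. Conditions on the diffusion $(x_t,g_t)_{t\ge0}$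 with generator $\mathcal L$. - Dévissage condition: $(x_t)_{t\ge0}$ is itself a diffusion on $X$. Its own invariant sigma field $\mathrm{Inv}((x_t)_{t\ge0})$ is either trivial, or generated (up to negligible sets) by a random variable $\ell_\infty$ with values in a separable (i.e. countably generated) measure space $(S,\mathcal G,\lambda)$, with $\lambda$ a probability measure, and the law of $\ell_\infty$ (under each starting point) is absolutely continuous with respect to $\lambda$. - Convergence condition: for every $(x,g)\in X\times G$, $g_t$ converges $\mathbb P_{(x,g)}$-almost surely as $t\to\infty$ to a random variable $g_\infty$ in $G$. - Equivariance condition: $\mathcal L(g\cdot f)=g\cdot(\mathcal Lf)$ for all $g\in G$ and $f\in C^\infty(X\times G,\mathbb R)$. - Regularity condition: (bounded) $\mathcal L$-harmonic functions are continuous on $X\times G$. *)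

theory Defs
  imports "HOL-Probability.Probability" "HOL-Algebra.Coset"
begin

section \<open>Smooth manifolds\<close>

text \<open>
  Coordinates live in the library's \<open>Euclidean_space n\<close>, the space of all \<open>x :: nat \<Rightarrow> real\<close> with
  \<open>x i = 0\<close> for \<open>i \<ge> n\<close>.  Dimension \<open>0\<close> is therefore allowed.
\<close>

definition pderivative :: "nat \<Rightarrow> ((nat \<Rightarrow> real) \<Rightarrow> real) \<Rightarrow> (nat \<Rightarrow> real) \<Rightarrow> real" where
  "pderivative i F x = deriv (\<lambda>t. F (x(i := t))) (x i)"

text \<open>\<open>C\<^sup>\<infinity>\<close> on an open set \<open>V\<close>: all iterated partial derivatives exist and are continuous on \<open>V\<close>.\<close>

definition smooth_real :: "nat \<Rightarrow> (nat \<Rightarrow> real) set \<Rightarrow> ((nat \<Rightarrow> real) \<Rightarrow> real) \<Rightarrow> bool" where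
  "smooth_real n V F \<longleftrightarrow>
     (\<forall>js. set js \<subseteq> {..<n} \<longrightarrow>
        continuous_map (subtopology (Euclidean_space n) V) euclideanreal (foldr pderivative js F) \<and>
        (\<forall>i<n. \<forall>x\<in>V. (\<lambda>t. foldr pderivative js F (x(i := t))) differentiable (at (x i))))"

definition smooth_vec ::
    "nat \<Rightarrow> nat \<Rightarrow> (nat \<Rightarrow> real) set \<Rightarrow> ((nat \<Rightarrow> real) \<Rightarrow> nat \<Rightarrow> real) \<Rightarrow> bool" where
  "smooth_vec n m V F \<longleftrightarrow> (\<forall>i<m. smooth_real n V (\<lambda>x. F x i))"

record 'a manifold =
  mtop :: "'a topology"
  mdim :: nat
  atlas :: "('a set \<times> ('a \<Rightarrow> nat \<Rightarrow> real)) set"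

abbreviation points :: "'a manifold \<Rightarrow> 'a set" where
  "points M \<equiv> topspace (mtop M)"

definition smooth_manifold :: "'a manifold \<Rightarrow> bool" where
  "smooth_manifold M \<longleftrightarrow>
     Hausdorff_space (mtop M) \<and> second_countable (mtop M) \<and>
     (\<Union>(U, \<phi>)\<in>atlas M. U) = points M \<and>
     (\<forall>(U, \<phi>)\<in>atlas M. openin (mtop M) U \<and>
        openin (Euclidean_space (mdim M)) (\<phi> ` U) \<and>
        homeomorphic_map (subtopology (mtop M) U)
          (subtopology (Euclidean_space (mdim M)) (\<phi> ` U)) \<phi>) \<and>
     (\<forall>(U, \<phi>)\<in>atlas M. \<forall>(V, \<psi>)\<in>atlas M.
        smooth_vec (mdim M) (mdim M) (\<phi> ` (U \<inter> V)) (\<psi> \<circ> inv_into U \<phi>))"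

text \<open>
  Functions on a manifold are total functions vanishing off its points, so that pointwise operations
  and equality of functions are the mathematical ones.
\<close>

definition C_inf :: "'a manifold \<Rightarrow> ('a \<Rightarrow> real) set" where
  "C_inf M = {f. (\<forall>z. z \<notin> points M \<longrightarrow> f z = 0) \<and>
     (\<forall>(U, \<phi>)\<in>atlas M. smooth_real (mdim M) (\<phi> ` U) (f \<circ> inv_into U \<phi>))}"

definition C_inf_compact :: "'a manifold \<Rightarrow> ('a \<Rightarrow> real) set" where
  "C_inf_compact M = {f \<in> C_inf M. \<exists>C. compactin (mtop M) C \<and> (\<forall>z. z \<notin> C \<longrightarrow> f z = 0)}"

definition smooth_map :: "'a manifold \<Rightarrow> 'b manifold \<Rightarrow> ('a \<Rightarrow> 'b) \<Rightarrow> bool" where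
  "smooth_map M N f \<longleftrightarrow> continuous_map (mtop M) (mtop N) f \<and>
     (\<forall>(U, \<phi>)\<in>atlas M. \<forall>(V, \<psi>)\<in>atlas N.
        smooth_vec (mdim M) (mdim N) (\<phi> ` {z \<in> U. f z \<in> V}) (\<psi> \<circ> f \<circ> inv_into U \<phi>))"

text \<open>A smooth map whose Jacobian matrix in charts is surjective at every point.\<close>

definition submersion :: "'a manifold \<Rightarrow> 'b manifold \<Rightarrow> ('a \<Rightarrow> 'b) \<Rightarrow> bool" where
  "submersion M N f \<longleftrightarrow> smooth_map M N f \<and>
     (\<forall>(U, \<phi>)\<in>atlas M. \<forall>(V, \<psi>)\<in>atlas N. \<forall>z\<in>U. f z \<in> V \<longrightarrow>
        (\<forall>w :: nat \<Rightarrow> real. \<exists>v :: nat \<Rightarrow> real. \<forall>i<mdim N.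
           (\<Sum>j<mdim M. pderivative j (\<lambda>u. \<psi> (f (inv_into U \<phi> u)) i) (\<phi> z) * v j) = w i))"

definition concat_coords :: "nat \<Rightarrow> (nat \<Rightarrow> real) \<Rightarrow> (nat \<Rightarrow> real) \<Rightarrow> nat \<Rightarrow> real" where
  "concat_coords n u v = (\<lambda>i. if i < n then u i else v (i - n))"

definition mprod :: "'a manifold \<Rightarrow> 'b manifold \<Rightarrow> ('a \<times> 'b) manifold" where
  "mprod M N =
     \<lparr> mtop = prod_topology (mtop M) (mtop N),
       mdim = mdim M + mdim N,
       atlas = (\<lambda>((U, \<phi>), (V, \<psi>)). (U \<times> V, \<lambda>(x, y). concat_coords (mdim M) (\<phi> x) (\<psi> y)))
                 ` (atlas M \<times> atlas N) \<rparr>"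

section \<open>Lie groups and homogeneous spaces\<close>

definition lie_group :: "('g, 'b) monoid_scheme \<Rightarrow> 'g manifold \<Rightarrow> bool" where
  "lie_group G MG \<longleftrightarrow> group G \<and> smooth_manifold MG \<and> points MG = carrier G \<and>
     smooth_map (mprod MG MG) MG (\<lambda>(g, h). g \<otimes>\<^bsub>G\<^esub> h) \<and>
     smooth_map MG MG (\<lambda>g. inv\<^bsub>G\<^esub> g)"

definition coset_proj :: "('g, 'b) monoid_scheme \<Rightarrow> 'g set \<Rightarrow> 'g \<Rightarrow> 'g set" where
  "coset_proj G K g = g <#\<^bsub>G\<^esub> K"

text \<open>
  The manifold \<open>G/K\<close> of left cosets: its topology is the quotient topology and its smooth structure
  is the unique one for which the projection is a submersion.
\<close>

definition homogeneous_space ::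
    "('g, 'b) monoid_scheme \<Rightarrow> 'g manifold \<Rightarrow> 'g set \<Rightarrow> 'g set manifold \<Rightarrow> bool" where
  "homogeneous_space G MG K MY \<longleftrightarrow> smooth_manifold MY \<and>
     points MY = coset_proj G K ` carrier G \<and>
     quotient_map (mtop MG) (mtop MY) (coset_proj G K) \<and>
     submersion MG MY (coset_proj G K)"

section \<open>Path spaces and sigma fields\<close>

definition borel_of :: "'a topology \<Rightarrow> 'a measure" where
  "borel_of T = sigma (topspace T) {U. openin T U}"

text \<open>Paths are indexed by \<open>{0..}\<close> and equal \<open>undefined\<close> at negative times.\<close>

definition paths :: "'a topology \<Rightarrow> (real \<Rightarrow> 'a) set" where
  "paths T = {\<omega> \<in> extensional {0..}. continuous_map (top_of_set {0..}) T \<omega>}"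

definition compact_open :: "'a topology \<Rightarrow> (real \<Rightarrow> 'a) topology" where
  "compact_open T = topology_generated_by
     {{\<omega> \<in> paths T. \<omega> ` C \<subseteq> U} | C U. compact C \<and> C \<subseteq> {0..} \<and> openin T U}"

definition path_borel :: "'a topology \<Rightarrow> (real \<Rightarrow> 'a) measure" where
  "path_borel T = borel_of (compact_open T)"

definition map_path :: "('a \<Rightarrow> 'b) \<Rightarrow> (real \<Rightarrow> 'a) \<Rightarrow> real \<Rightarrow> 'b" where
  "map_path h \<omega> = (\<lambda>t\<in>{0..}. h (\<omega> t))"

definition path_shift :: "real \<Rightarrow> (real \<Rightarrow> 'a) \<Rightarrow> real \<Rightarrow> 'a" where
  "path_shift s \<omega> = (\<lambda>t\<in>{0..}. \<omega> (t + s))"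

text \<open>The sigma field on \<open>\<Omega>\<close> generated by \<open>Z s\<close>, \<open>s \<in> I\<close>, where each \<open>Z s\<close> takes values in \<open>N\<close>.\<close>

definition process_sigma ::
    "'w set \<Rightarrow> 'b measure \<Rightarrow> (real \<Rightarrow> 'w \<Rightarrow> 'b) \<Rightarrow> real set \<Rightarrow> 'w measure" where
  "process_sigma \<Omega> N Z I = sigma \<Omega> {Z s -` B \<inter> \<Omega> | s B. s \<in> I \<and> B \<in> sets N}"

definition Inv :: "'a topology \<Rightarrow> 'b measure \<Rightarrow> (real \<Rightarrow> (real \<Rightarrow> 'a) \<Rightarrow> 'b) \<Rightarrow> (real \<Rightarrow> 'a) set set" where
  "Inv T N Z = {A \<in> (\<Inter>t\<in>{0..}. sets (process_sigma (paths T) N Z {t..})).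
     \<forall>s>0. path_shift s -` A \<inter> paths T = A}"

definition coincide_mod_null :: "'w measure \<Rightarrow> 'w set set \<Rightarrow> 'w set set \<Rightarrow> bool" where
  "coincide_mod_null P \<A> \<B> \<longleftrightarrow>
     (\<forall>A\<in>\<A>. \<exists>B\<in>\<B>. (A - B) \<union> (B - A) \<in> null_sets P) \<and>
     (\<forall>B\<in>\<B>. \<exists>A\<in>\<A>. (A - B) \<union> (B - A) \<in> null_sets P)"

definition generated_by :: "'w set \<Rightarrow> 'b measure \<Rightarrow> ('w \<Rightarrow> 'b) \<Rightarrow> 'w set set" where
  "generated_by \<Omega> N V = {V -` B \<inter> \<Omega> | B. B \<in> sets N}"

text \<open>\<open>Zinf\<close> is a random element of \<open>T\<close> to which \<open>Z t\<close> converges almost surely as \<open>t \<rightarrow> \<infinity>\<close>.\<close>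

definition AE_limit :: "'w measure \<Rightarrow> 'b topology \<Rightarrow> (real \<Rightarrow> 'w \<Rightarrow> 'b) \<Rightarrow> ('w \<Rightarrow> 'b) \<Rightarrow> bool" where
  "AE_limit P T Z Zinf \<longleftrightarrow> Zinf \<in> P \<rightarrow>\<^sub>M borel_of T \<and>
     (AE \<omega> in P. limitin T (\<lambda>t. Z t \<omega>) (Zinf \<omega>) at_top)"

section \<open>Diffusions\<close>

text \<open>Indexing by \<open>ennreal\<close> makes the library's stopping times the \<open>[0, \<infinity>]\<close>-valued ones.\<close>

definition nat_filtration :: "'a topology \<Rightarrow> ennreal \<Rightarrow> (real \<Rightarrow> 'a) measure" where
  "nat_filtration T t =
     process_sigma (paths T) (borel_of T) (\<lambda>s \<omega>. \<omega> s) {s. 0 \<le> s \<and> ennreal s \<le> t}"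

definition strong_markov_family :: "'a topology \<Rightarrow> ('a \<Rightarrow> (real \<Rightarrow> 'a) measure) \<Rightarrow> bool" where
  "strong_markov_family T P \<longleftrightarrow>
     P \<in> borel_of T \<rightarrow>\<^sub>M prob_algebra (path_borel T) \<and>
     (\<forall>z\<in>topspace T. AE \<omega> in P z. \<omega> 0 = z) \<and>
     (\<forall>z\<in>topspace T. \<forall>\<tau>. stopping_time (nat_filtration T) \<tau> \<longrightarrow>
        (\<forall>A \<in> sets (filtration.pre_sigma (paths T) (nat_filtration T) \<tau>).
         \<forall>B \<in> sets (path_borel T).
           emeasure (P z) {\<omega>\<in>A. \<tau> \<omega> < \<infinity> \<and> path_shift (enn2real (\<tau> \<omega>)) \<omega> \<in> B} =
           (\<integral>\<^sup>+ \<omega>. indicator {\<omega>\<in>A. \<tau> \<omega> < \<infinity>} \<omega> * emeasure (P (\<omega> (enn2real (\<tau> \<omega>)))) B \<partial>P z)))"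

definition martingale ::
    "'w measure \<Rightarrow> (ennreal \<Rightarrow> 'w measure) \<Rightarrow> (real \<Rightarrow> 'w \<Rightarrow> real) \<Rightarrow> bool" where
  "martingale P F Z \<longleftrightarrow>
     (\<forall>t\<ge>0. Z t \<in> borel_measurable (F (ennreal t)) \<and> integrable P (Z t)) \<and>
     (\<forall>s\<ge>0. \<forall>t\<ge>s. AE \<omega> in P. real_cond_exp P (F (ennreal s)) (Z t) \<omega> = Z s \<omega>)"

definition solves_martingale_problem ::
    "'a manifold \<Rightarrow> (('a \<Rightarrow> real) \<Rightarrow> 'a \<Rightarrow> real) \<Rightarrow> 'a \<Rightarrow> (real \<Rightarrow> 'a) measure \<Rightarrow> bool" where
  "solves_martingale_problem M L z Q \<longleftrightarrow>
     prob_space Q \<and> sets Q = sets (path_borel (mtop M)) \<and> (AE \<omega> in Q. \<omega> 0 = z) \<and>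
     (\<forall>f\<in>C_inf_compact M. martingale Q (nat_filtration (mtop M))
        (\<lambda>t \<omega>. f (\<omega> t) - f (\<omega> 0) - integral {0..t} (\<lambda>s. L f (\<omega> s))))"

definition smooth_operator :: "'a manifold \<Rightarrow> (('a \<Rightarrow> real) \<Rightarrow> 'a \<Rightarrow> real) \<Rightarrow> bool" where
  "smooth_operator M L \<longleftrightarrow> L \<in> C_inf M \<rightarrow> C_inf M \<and>
     (\<forall>f\<in>C_inf M. \<forall>h\<in>C_inf M. \<forall>a b.
        L (\<lambda>z. a * f z + b * h z) = (\<lambda>z. a * L f z + b * L h z))"

text \<open>All paths are defined on \<open>{0..}\<close> with values in \<open>M\<close>: the lifetime is infinite.\<close>

definition diffusion_with_generator ::
    "'a manifold \<Rightarrow> (('a \<Rightarrow> real) \<Rightarrow> 'a \<Rightarrow> real) \<Rightarrow> ('a \<Rightarrow> (real \<Rightarrow> 'a) measure) \<Rightarrow> bool" where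
  "diffusion_with_generator M L P \<longleftrightarrow>
     smooth_operator M L \<and> strong_markov_family (mtop M) P \<and>
     (\<forall>z\<in>points M. solves_martingale_problem M L z (P z) \<and>
        (\<forall>Q. solves_martingale_problem M L z Q \<longrightarrow> Q = P z))"

definition diffusion :: "'a manifold \<Rightarrow> ('a \<Rightarrow> (real \<Rightarrow> 'a) measure) \<Rightarrow> bool" where
  "diffusion M P \<longleftrightarrow> (\<exists>L. diffusion_with_generator M L P)"

definition harmonic :: "'a topology \<Rightarrow> ('a \<Rightarrow> (real \<Rightarrow> 'a) measure) \<Rightarrow> ('a \<Rightarrow> real) \<Rightarrow> bool" where
  "harmonic T P H \<longleftrightarrow> H \<in> borel_measurable (borel_of T) \<and> bounded (H ` topspace T) \<and>
     (\<forall>t\<ge>0. \<forall>z\<in>topspace T. H z = (\<integral>\<omega>. H (\<omega> t) \<partial>P z))"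

section \<open>Conditions on a diffusion in \<open>X \<times> G\<close>\<close>

definition right_equivariant ::
    "'x manifold \<Rightarrow> ('g, 'b) monoid_scheme \<Rightarrow> 'g manifold \<Rightarrow> 'g set \<Rightarrow>
     ('x \<times> 'g \<Rightarrow> (real \<Rightarrow> 'x \<times> 'g) measure) \<Rightarrow> bool" where
  "right_equivariant MX G MG K P \<longleftrightarrow>
     (\<forall>k\<in>K. \<forall>x\<in>points MX. \<forall>g\<in>carrier G.
        distr (P (x, g)) (path_borel (mtop (mprod MX MG))) (map_path (\<lambda>(x, h). (x, h \<otimes>\<^bsub>G\<^esub> k)))
        = P (x, g \<otimes>\<^bsub>G\<^esub> k))"

text \<open>
  \<open>\<Lambda>\<close> is the measure space \<open>(S, \<G>, \<lambda>)\<close> and \<open>linf\<close> the random variable \<open>\<ell>_\<infinity>\<close>, defined on the path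
  space of \<open>X\<close>; both are irrelevant when the invariant sigma field is trivial.
\<close>

definition devissage_condition ::
    "'x manifold \<Rightarrow> 'g manifold \<Rightarrow> ('x \<times> 'g \<Rightarrow> (real \<Rightarrow> 'x \<times> 'g) measure) \<Rightarrow>
     's measure \<Rightarrow> ((real \<Rightarrow> 'x) \<Rightarrow> 's) \<Rightarrow> bool" where
  "devissage_condition MX MG P \<Lambda> linf \<longleftrightarrow>
     (\<exists>R. diffusion MX R \<and>
        (\<forall>x\<in>points MX. \<forall>g\<in>points MG. distr (P (x, g)) (path_borel (mtop MX)) (map_path fst) = R x) \<and>
        (let \<I> = Inv (mtop MX) (borel_of (mtop MX)) (\<lambda>t \<omega>. \<omega> t) in
          (\<forall>x\<in>points MX. \<forall>A\<in>\<I>. measure (R x) A = 0 \<or> measure (R x) A = 1) \<or>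
          (prob_space \<Lambda> \<and>
           (\<exists>\<C>. countable \<C> \<and> \<C> \<subseteq> Pow (space \<Lambda>) \<and> sets \<Lambda> = sigma_sets (space \<Lambda>) \<C>) \<and>
           linf \<in> path_borel (mtop MX) \<rightarrow>\<^sub>M \<Lambda> \<and>
           (\<forall>x\<in>points MX.
              coincide_mod_null (R x) \<I> (generated_by (paths (mtop MX)) \<Lambda> linf) \<and>
              absolutely_continuous \<Lambda> (distr (R x) \<Lambda> linf)))))"

definition convergence_condition ::
    "'x manifold \<Rightarrow> 'g manifold \<Rightarrow> ('x \<times> 'g \<Rightarrow> (real \<Rightarrow> 'x \<times> 'g) measure) \<Rightarrow> bool" where
  "convergence_condition MX MG P \<longleftrightarrow>
     (\<forall>x\<in>points MX. \<forall>g\<in>points MG. \<exists>ginf. AE_limit (P (x, g)) (mtop MG) (\<lambda>t \<omega>. snd (\<omega> t)) ginf)"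

definition left_action ::
    "'x manifold \<Rightarrow> ('g, 'b) monoid_scheme \<Rightarrow> 'g \<Rightarrow> ('x \<times> 'g \<Rightarrow> real) \<Rightarrow> 'x \<times> 'g \<Rightarrow> real" where
  "left_action MX G g f =
     (\<lambda>(x, h). if x \<in> points MX \<and> h \<in> carrier G then f (x, g \<otimes>\<^bsub>G\<^esub> h) else 0)"

definition equivariance_condition ::
    "'x manifold \<Rightarrow> ('g, 'b) monoid_scheme \<Rightarrow> 'g manifold \<Rightarrow>
     (('x \<times> 'g \<Rightarrow> real) \<Rightarrow> 'x \<times> 'g \<Rightarrow> real) \<Rightarrow> bool" where
  "equivariance_condition MX G MG L \<longleftrightarrow>
     (\<forall>g\<in>carrier G. \<forall>f\<in>C_inf (mprod MX MG). L (left_action MX G g f) = left_action MX G g (L f))"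

definition regularity_condition ::
    "'x manifold \<Rightarrow> 'g manifold \<Rightarrow> ('x \<times> 'g \<Rightarrow> (real \<Rightarrow> 'x \<times> 'g) measure) \<Rightarrow> bool" where
  "regularity_condition MX MG P \<longleftrightarrow>
     (\<forall>H. harmonic (mtop (mprod MX MG)) P H \<longrightarrow>
        continuous_map (mtop (mprod MX MG)) euclideanreal H)"

end

theory Submission
  imports Defs
begin

text \<open>
  Let \<open>A\<close> be an invariant event of \<open>(x\<^sub>t, y\<^sub>t)\<close>. It lifts to an invariant event of \<open>(x\<^sub>t, g\<^sub>t)\<close>, again called
  \<open>A\<close>, and \<open>H(x, g) = P\<^sub>(\<^sub>x\<^sub>,\<^sub>g\<^sub>)(A)\<close> is a bounded harmonic function, hence continuous. It depends on \<open>g\<close> only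
  through the projection \<open>\<pi>(g)\<close> to \<open>Y\<close>, being also the probability of the event under the law of the
  process in \<open>X \<times> Y\<close>. By the zero-one law \<open>H(x\<^sub>t, g\<^sub>t)\<close> converges to the indicator of \<open>A\<close>
  (\<open>levy_zero_one\<close>), and \<open>g\<^sub>t\<close> converges to \<open>g\<^sub>\<infinity>\<close>. If \<open>H\<close> were equicontinuous in \<open>g\<close>, uniformly in \<open>x\<close>, then
  \<open>g\<^sub>t\<close> could be replaced by \<open>g\<^sub>\<infinity>\<close> and the limit would be a function of \<open>\<pi>(g\<^sub>\<infinity>) = y\<^sub>\<infinity>\<close> and of the end
  behaviour of \<open>x\<^sub>t\<close>, as desired. But \<open>X\<close> need not be compact, and \<open>H\<close> is merely continuous.

  Equicontinuity is gained by averaging over left translations,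
  \<open>H\<^sub>c(x, g) = \<integral> c(\<gamma>) H(x, \<gamma> g) d\<mu>(\<gamma>)\<close>. The laws are equivariant under left translations because \<open>L\<close> is and
  the martingale problem is well posed (\<open>left_equivariant_law\<close>), so \<open>H\<^sub>c(x\<^sub>t, g\<^sub>t)\<close> still converges, to the
  same average of the indicators of the translates of \<open>A\<close>. The function \<open>H\<^sub>c\<close> is equicontinuous in \<open>g\<close> as
  soon as the right translates of \<open>\<mu>\<close> depend continuously on the group element in total variation. A
  measure with this property comes from the diffusion itself: the law of the inverse of \<open>g\<^sub>\<infinity>\<close>
  (\<open>smoothing_measure\<close>). Its translates are the laws for translated starting points, hence continuous
  against each bounded test function by the regularity condition, and a Baire category argument in a
  separable \<open>L\<^sup>1\<close> space improves this to total variation (\<open>translation_continuity_in_variation\<close>).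

  Consequently the averages of the translates of \<open>A\<close>, with any continuous weight \<open>c\<close>, are measurable up to
  null sets for the sigma field \<open>N\<close> of the end behaviour of \<open>x\<^sub>t\<close> and of \<open>y\<^sub>\<infinity>\<close> (\<open>smooth_indicator_event\<close>). The
  averaging is undone by duality: with \<open>W = 1\<^sub>A - E[1\<^sub>A | N]\<close> and the weight \<open>c(\<gamma>) = E[1\<^sub>A(\<gamma> \<omega>) W(\<omega>)]\<close>, the
  average is orthogonal to \<open>W\<close> and the inner product of the two equals \<open>\<integral> c\<^sup>2 d\<mu>\<close>. So \<open>c\<close> vanishes at the
  unit, which says \<open>E[W\<^sup>2] = 0\<close> (\<open>invariant_event_determined_by_limits\<close>).

  For the other inclusion, the limit of a path is invariant under shifts and can be read off from the
  closed sets in which the path eventually stays (\<open>eventually_closed_Inv\<close>, \<open>end_limit_measurable\<close>).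
\<close>

section \<open>Calculus in coordinates\<close>

lemma openin_Euclidean_box:
  assumes "openin (Euclidean_space n) V" "x \<in> V"
  obtains e where "e > 0" "\<And>y. y \<in> topspace (Euclidean_space n) \<Longrightarrow> (\<And>i. i < n \<Longrightarrow> \<bar>y i - x i\<bar> < e) \<Longrightarrow> y \<in> V"
proof -
  obtain W where W: "openin (powertop_real UNIV) W" "V = W \<inter> {x. \<forall>i\<ge>n. x i = 0}"
    using assms(1) unfolding Euclidean_space_def openin_subtopology by blast
  have "x \<in> W" using W assms by auto
  then obtain U where U: "finite {i. U i \<noteq> UNIV}" "\<And>i. openin euclideanreal (U i)"
      "x \<in> Pi\<^sub>E UNIV U" "Pi\<^sub>E UNIV U \<subseteq> W"
    using W(1) unfolding openin_product_topology_alt by (auto simp: )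
  have "\<forall>i. \<exists>e>0. \<forall>y. \<bar>y - x i\<bar> < e \<longrightarrow> y \<in> U i"
  proof
    fix i have "open (U i)" "x i \<in> U i" using U by auto
    then show "\<exists>e>0. \<forall>y. \<bar>y - x i\<bar> < e \<longrightarrow> y \<in> U i"
      by (auto simp: open_dist dist_real_def)
  qed
  then obtain d where d: "\<And>i. d i > 0" "\<And>i y. \<bar>y - x i\<bar> < d i \<Longrightarrow> y \<in> U i" by metis
  define e where "e = Min (insert 1 (d ` {..<n}))"
  have e: "e > 0" unfolding e_def using d by (subst Min_gr_iff) auto
  have le: "e \<le> d i" if "i < n" for i unfolding e_def using that by (intro Min_le) auto
  show ?thesis
  proof (rule that[OF e])
    fix y assume y: "y \<in> topspace (Euclidean_space n)" "\<And>i. i < n \<Longrightarrow> \<bar>y i - x i\<bar> < e"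
    have x0: "\<forall>i\<ge>n. x i = 0" using W assms by auto
    have y0: "\<forall>i\<ge>n. y i = 0" using y by (simp add: topspace_Euclidean_space)
    have "y i \<in> U i" for i
      using d(2)[of "y i" i] y(2)[of i] le[of i] x0 y0 d(1)[of i] by (cases "i < n") auto
    then show "y \<in> V" using U(4) y0 W by auto
  qed
qed

lemma continuous_on_Euclidean_box:
  assumes V: "openin (Euclidean_space n) V" and F: "continuous_on V (F :: (nat \<Rightarrow> real) \<Rightarrow> real)"
    and x: "x \<in> V" and e: "e > 0"
  obtains d where "d > 0" "\<And>y. y \<in> topspace (Euclidean_space n) \<Longrightarrow> (\<And>i. i < n \<Longrightarrow> \<bar>y i - x i\<bar> < d) \<Longrightarrow> y \<in> V \<and> \<bar>F y - F x\<bar> < e"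
proof -
  obtain W where W: "open W" "W \<inter> V = F -` ball (F x) e \<inter> V"
    using F unfolding continuous_on_open_invariant by (metis open_ball)
  have "openin (Euclidean_space n) (W \<inter> V)"
  proof -
    have "openin (powertop_real UNIV) W" using W(1) by (simp add: euclidean_product_topology)
    then have "openin (Euclidean_space n) (W \<inter> topspace (Euclidean_space n))"
      unfolding Euclidean_space_def by (auto simp: openin_subtopology)
    moreover have "W \<inter> V = (W \<inter> topspace (Euclidean_space n)) \<inter> V" using openin_subset[OF V] by auto
    ultimately show ?thesis using V by auto
  qed
  moreover have "x \<in> W \<inter> V" using W x e by auto
  ultimately obtain d where d: "d > 0" "\<And>y. y \<in> topspace (Euclidean_space n) \<Longrightarrow> (\<And>i. i < n \<Longrightarrow> \<bar>y i - x i\<bar> < d) \<Longrightarrow> y \<in> W \<inter> V"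
    by (rule openin_Euclidean_box) blast
  show ?thesis
    apply (rule that[OF d(1)])
    using d(2) W(2) by (auto simp: dist_real_def abs_minus_commute set_eq_iff)
qed

definition partially_differentiable :: "nat \<Rightarrow> (nat \<Rightarrow> real) set \<Rightarrow> ((nat \<Rightarrow> real) \<Rightarrow> real) \<Rightarrow> bool" where
  "partially_differentiable n V F \<longleftrightarrow> (\<forall>i<n. \<forall>x\<in>V. (\<lambda>t. F (x(i := t))) differentiable (at (x i)))"

text \<open>
  Functions of class \<open>C\<^sup>k\<close> on \<open>V\<close>. The iterated partial derivatives in \<^const>\<open>smooth_real\<close> are
  built by adding a derivative on the outside; the product and the chain rule apply to the innermost
  derivative, and this recursion peels off that one.
\<close>

primrec Ck :: "nat \<Rightarrow> (nat \<Rightarrow> real) set \<Rightarrow> nat \<Rightarrow> ((nat \<Rightarrow> real) \<Rightarrow> real) \<Rightarrow> bool" where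
  "Ck n V 0 F \<longleftrightarrow> continuous_on V F"
| "Ck n V (Suc k) F \<longleftrightarrow> continuous_on V F \<and> partially_differentiable n V F \<and>
     (\<forall>i<n. Ck n V k (pderivative i F))"

lemma partial_has_derivative:
  assumes "partially_differentiable n V F" "x \<in> V" "i < n"
  shows "((\<lambda>t. F (x(i := t))) has_real_derivative pderivative i F x) (at (x i))"
  using assms unfolding partially_differentiable_def pderivative_def
  by (metis DERIV_deriv_iff_real_differentiable)

lemma continuous_map_Euclidean_subtopology:
  assumes "V \<subseteq> topspace (Euclidean_space n)"
  shows "continuous_map (subtopology (Euclidean_space n) V) euclideanreal F \<longleftrightarrow> continuous_on V F"
proof -
  have "subtopology (Euclidean_space n) V = top_of_set V"
    unfolding Euclidean_space_def subtopology_subtopology euclidean_product_topology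
    using assms by (metis inf.absorb2 topspace_Euclidean_space)
  then show ?thesis by simp
qed

lemma smooth_real_Suc:
  assumes "V \<subseteq> topspace (Euclidean_space n)"
  shows "smooth_real n V F \<longleftrightarrow> continuous_on V F \<and> partially_differentiable n V F \<and>
     (\<forall>i<n. smooth_real n V (pderivative i F))"
proof -
  let ?P = "\<lambda>G. continuous_on V G \<and> partially_differentiable n V G"
  have eq: "smooth_real n V F = (\<forall>js. set js \<subseteq> {..<n} \<longrightarrow> ?P (foldr pderivative js F))" for F
    unfolding smooth_real_def partially_differentiable_def continuous_map_Euclidean_subtopology[OF assms] by simp
  have "(\<forall>js. set js \<subseteq> {..<n} \<longrightarrow> ?P (foldr pderivative js F)) \<longleftrightarrow>
     ?P F \<and> (\<forall>i<n. \<forall>js. set js \<subseteq> {..<n} \<longrightarrow> ?P (foldr pderivative js (pderivative i F)))" (is "?L = ?R")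
  proof
    assume L: ?L
    have "?P (foldr pderivative js (pderivative i F))" if "i < n" "set js \<subseteq> {..<n}" for i js
      using L[rule_format, of "js @ [i]"] that by simp
    moreover have "?P F" using L[rule_format, of "[]"] by simp
    ultimately show ?R by blast
  next
    assume R: ?R
    have "?P (foldr pderivative js F)" if "set js \<subseteq> {..<n}" for js
    proof (cases js rule: rev_cases)
      case Nil then show ?thesis using R by simp
    next
      case (snoc ks i) then show ?thesis using R that by simp
    qed
    then show ?L by blast
  qed
  then show ?thesis unfolding eq by blast
qed

lemma smooth_real_iff_Ck:
  assumes "V \<subseteq> topspace (Euclidean_space n)"
  shows "smooth_real n V F \<longleftrightarrow> (\<forall>k. Ck n V k F)"
proof
  assume "smooth_real n V F"
  then have "Ck n V k F" for k
  proof (induction k arbitrary: F)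
    case 0 then show ?case using smooth_real_Suc[OF assms, THEN iffD1, OF 0] by auto
  next
    case (Suc k) then show ?case using smooth_real_Suc[OF assms, THEN iffD1, OF Suc.prems] by auto
  qed
  then show "\<forall>k. Ck n V k F" by blast
next
  assume R: "\<forall>k. Ck n V k F"
  have "\<And>F. \<forall>k. Ck n V k F \<Longrightarrow> set js \<subseteq> {..<n} \<Longrightarrow> \<forall>k. Ck n V k (foldr pderivative js F)" for js
  proof (induction js)
    case (Cons a js)
    have "Ck n V (Suc k) (foldr pderivative js F)" for k
      using Cons.IH[OF Cons.prems(1)] Cons.prems(2) by (simp del: Ck.simps)
    then show ?case using Cons.prems(2) by auto
  qed auto
  then have "\<forall>k. Ck n V k (foldr pderivative js F)" if "set js \<subseteq> {..<n}" for js using R that by blast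
  then have "continuous_on V (foldr pderivative js F) \<and> partially_differentiable n V (foldr pderivative js F)"
    if "set js \<subseteq> {..<n}" for js
    using that Ck.simps(2)[of n V 0] by blast
  then show "smooth_real n V F"
    unfolding smooth_real_def continuous_map_Euclidean_subtopology[OF assms] partially_differentiable_def by blast
qed

lemma Ck_mono: "Ck n V (Suc k) F \<Longrightarrow> Ck n V k F"
  by (induction k arbitrary: F) auto

lemma Ck_continuous: "Ck n V k F \<Longrightarrow> continuous_on V F" by (cases k) auto

lemma eventually_coordinate_line:
  assumes V: "openin (Euclidean_space n) V" and x: "x \<in> V" and i: "i < n"
  shows "\<forall>\<^sub>F t in nhds (x i). x(i := t) \<in> V"
proof -
  obtain e where e: "e > 0" "\<And>y. y \<in> topspace (Euclidean_space n) \<Longrightarrow> (\<And>i. i < n \<Longrightarrow> \<bar>y i - x i\<bar> < e) \<Longrightarrow> y \<in> V"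
    using openin_Euclidean_box[OF V x] by metis
  have x0: "\<forall>i\<ge>n. x i = 0" using openin_subset[OF V] x by (auto simp: topspace_Euclidean_space)
  have "x(i := t) \<in> V" if "dist t (x i) < e" for t
    using x0 i that e(1) by (intro e(2)) (auto simp: topspace_Euclidean_space dist_real_def)
  then show ?thesis using e(1) by (auto simp: eventually_nhds_metric)
qed

lemma pderivative_cong:
  assumes V: "openin (Euclidean_space n) V" and i: "i < n" and eq: "\<And>y. y \<in> V \<Longrightarrow> F y = F' y" and x: "x \<in> V"
  shows "pderivative i F x = pderivative i F' x"
  unfolding pderivative_def
  using eventually_coordinate_line[OF V x i]
  by (intro deriv_cong_ev) (auto elim!: eventually_mono simp: eq)

lemma partially_differentiable_cong:
  assumes V: "openin (Euclidean_space n) V" and eq: "\<And>y. y \<in> V \<Longrightarrow> F y = F' y"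
    and F: "partially_differentiable n V F"
  shows "partially_differentiable n V F'"
  unfolding partially_differentiable_def
proof (intro allI impI ballI)
  fix i x assume i: "i < n" and x: "x \<in> V"
  have "((\<lambda>t. F' (x(i := t))) has_real_derivative pderivative i F x) (at (x i))"
    using partial_has_derivative[OF F x i] eventually_coordinate_line[OF V x i]
    by (subst DERIV_cong_ev[OF refl _ refl, where g = "\<lambda>t. F (x(i := t))"]) (auto elim!: eventually_mono simp: eq)
  then show "(\<lambda>t. F' (x(i := t))) differentiable at (x i)"
    by (auto simp: real_differentiable_def)
qed

lemma Ck_cong:
  assumes V: "openin (Euclidean_space n) V"
  shows "(\<And>y. y \<in> V \<Longrightarrow> F y = F' y) \<Longrightarrow> Ck n V k F \<Longrightarrow> Ck n V k F'"
proof (induction k arbitrary: F F')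
  case 0 then show ?case by (simp add: continuous_on_cong[of V V F F'])
next
  case (Suc k)
  have "continuous_on V F'" using Suc.prems by (simp add: continuous_on_cong[of V V F F'])
  moreover have "partially_differentiable n V F'"
    using partially_differentiable_cong[OF V Suc.prems(1)] Suc.prems(2) by auto
  moreover have "Ck n V k (pderivative i F')" if "i < n" for i
    using Suc.IH[of "pderivative i F" "pderivative i F'"] pderivative_cong[OF V that Suc.prems(1)] Suc.prems(2) that by auto
  ultimately show ?case by auto
qed

lemma
  assumes V: "openin (Euclidean_space n) V"
    and F: "partially_differentiable n V F" and F': "partially_differentiable n V F'"
  shows partially_differentiable_add: "partially_differentiable n V (\<lambda>x. F x + F' x)"
    and pderivative_add: "\<And>i x. i < n \<Longrightarrow> x \<in> V \<Longrightarrow> pderivative i (\<lambda>x. F x + F' x) x = pderivative i F x + pderivative i F' x"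
    and partially_differentiable_mult: "partially_differentiable n V (\<lambda>x. F x * F' x)"
    and pderivative_mult: "\<And>i x. i < n \<Longrightarrow> x \<in> V \<Longrightarrow> pderivative i (\<lambda>x. F x * F' x) x = pderivative i F x * F' x + F x * pderivative i F' x"
proof -
  have *: "((\<lambda>t. F (x(i := t)) + F' (x(i := t))) has_real_derivative pderivative i F x + pderivative i F' x) (at (x i))"
    if "i < n" "x \<in> V" for i x
    using partial_has_derivative[OF F that(2,1)] partial_has_derivative[OF F' that(2,1)] by (rule DERIV_add)
  have **: "((\<lambda>t. F (x(i := t)) * F' (x(i := t))) has_real_derivative pderivative i F x * F' x + F x * pderivative i F' x) (at (x i))"
    if "i < n" "x \<in> V" for i x
    using DERIV_mult[OF partial_has_derivative[OF F that(2,1)] partial_has_derivative[OF F' that(2,1)]] by (simp add: mult.commute add.commute)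
  show "partially_differentiable n V (\<lambda>x. F x + F' x)" "partially_differentiable n V (\<lambda>x. F x * F' x)"
    using * ** unfolding partially_differentiable_def real_differentiable_def by blast+
  show "pderivative i (\<lambda>x. F x + F' x) x = pderivative i F x + pderivative i F' x"
    "pderivative i (\<lambda>x. F x * F' x) x = pderivative i F x * F' x + F x * pderivative i F' x" if "i < n" "x \<in> V" for i x
    using *[OF that] **[OF that] unfolding pderivative_def by (auto intro: DERIV_imp_deriv)
qed

lemma Ck_add:
  assumes V: "openin (Euclidean_space n) V"
  shows "Ck n V k F \<Longrightarrow> Ck n V k F' \<Longrightarrow> Ck n V k (\<lambda>x. F x + F' x)"
proof (induction k arbitrary: F F')
  case 0 then show ?case by (auto intro: continuous_intros)
next
  case (Suc k)
  have "Ck n V k (pderivative i (\<lambda>x. F x + F' x))" if "i < n" for i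
    by (rule Ck_cong[OF V _ Suc.IH[of "pderivative i F" "pderivative i F'"]])
      (use Suc.prems that in \<open>auto simp: pderivative_add[OF V]\<close>)
  then show ?case using Suc.prems partially_differentiable_add[OF V, of F F'] by (auto intro: continuous_intros)
qed

lemma Ck_mult:
  assumes V: "openin (Euclidean_space n) V"
  shows "Ck n V k F \<Longrightarrow> Ck n V k F' \<Longrightarrow> Ck n V k (\<lambda>x. F x * F' x)"
proof (induction k arbitrary: F F')
  case 0 then show ?case by (auto intro: continuous_intros)
next
  case (Suc k)
  have "Ck n V k (pderivative i (\<lambda>x. F x * F' x))" if "i < n" for i
    by (rule Ck_cong[OF V _ Ck_add[OF V Suc.IH[of "pderivative i F" F'] Suc.IH[of F "pderivative i F'"]]])
      (use Suc.prems that Ck_mono[of n V k F] Ck_mono[of n V k F'] in \<open>auto simp: pderivative_mult[OF V]\<close>)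
  then show ?case using Suc.prems partially_differentiable_mult[OF V, of F F'] by (auto intro: continuous_intros)
qed

lemma pderivative_const: "pderivative i (\<lambda>x. c) = (\<lambda>x. 0)"
  unfolding pderivative_def by simp

lemma Ck_const: "Ck n V k (\<lambda>x. c)"
  by (induction k arbitrary: c) (auto simp: pderivative_const partially_differentiable_def)

lemma Ck_sum:
  assumes V: "openin (Euclidean_space n) V"
  shows "finite I \<Longrightarrow> (\<And>i. i \<in> I \<Longrightarrow> Ck n V k (F i)) \<Longrightarrow> Ck n V k (\<lambda>x. \<Sum>i\<in>I. F i x)"
  by (induction rule: finite_induct) (auto intro!: Ck_const Ck_add[OF V])

text \<open>
  Existence and continuity of the partial derivatives suffice: the increment of \<open>F\<close> from \<open>c t0\<close> to
  \<open>c t\<close> is cut into \<open>n\<close> increments in one coordinate each, and the mean value theorem applies to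
  every one of them.
\<close>

lemma chain_rule_along_curve:
  assumes V: "openin (Euclidean_space n) V" and F: "partially_differentiable n V F"
    and cont: "\<And>i. i < n \<Longrightarrow> continuous_on V (pderivative i F)"
    and c0: "c t0 \<in> V" and cE: "\<forall>\<^sub>F t in nhds t0. c t \<in> topspace (Euclidean_space n)"
    and c: "\<And>i. i < n \<Longrightarrow> ((\<lambda>t. c t i) has_real_derivative c' i) (at t0)"
  shows "((\<lambda>t. F (c t)) has_real_derivative (\<Sum>i<n. pderivative i F (c t0) * c' i)) (at t0)"
proof -
  (* p k t has already moved in its first k coordinates *)
  define p where "p k t = (\<lambda>i. if i < k then c t i else c t0 i)" for k t
  have zero: "c t0 i = 0" if "i \<ge> n" for i
    using openin_subset[OF V] c0 that by (auto simp: topspace_Euclidean_space)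
  have "((\<lambda>t. F (p k t)) has_real_derivative (\<Sum>i<k. pderivative i F (c t0) * c' i)) (at t0)" if "k \<le> n" for k
    using that
  proof (induction k)
    case 0
    have "p 0 t = c t0" for t by (simp add: p_def)
    then show ?case by simp
  next
    case (Suc k)
    then have k: "k < n" by simp
    define x where "x = c t0"
    (* the difference quotient in coordinate k, extended by its limit *)
    define g where "g t = (if c t k = x k then pderivative k F x else (F (p (Suc k) t) - F (p k t)) / (c t k - x k))" for t
    have pS: "p (Suc k) t = (p k t)(k := c t k)" "(p k t)(k := x k) = p k t" for t
      by (auto simp: p_def x_def fun_eq_iff)
    have diff: "F (p (Suc k) t) = F (p k t) + g t * (c t k - x k)" for t
      using pS[of t] by (cases "c t k = x k") (auto simp: g_def)
    have "(g \<longlongrightarrow> pderivative k F x) (at t0)"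
    proof (rule tendstoI)
      fix e :: real assume e: "e > 0"
      obtain d where d: "d > 0" "\<And>y. y \<in> topspace (Euclidean_space n) \<Longrightarrow> (\<And>i. i < n \<Longrightarrow> \<bar>y i - x i\<bar> < d) \<Longrightarrow>
           y \<in> V \<and> \<bar>pderivative k F y - pderivative k F x\<bar> < e"
        using continuous_on_Euclidean_box[OF V cont[OF k] c0 e] unfolding x_def by metis
      have "\<forall>\<^sub>F t in at t0. \<forall>i<n. \<bar>c t i - x i\<bar> < d"
      proof -
        have "\<forall>\<^sub>F t in at t0. \<bar>c t i - x i\<bar> < d" if "i < n" for i
          using DERIV_isCont[OF c[OF that]] d(1) unfolding isCont_def tendsto_iff dist_real_def x_def by blast
        then have "\<forall>\<^sub>F t in at t0. \<forall>i\<in>{..<n}. \<bar>c t i - x i\<bar> < d"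
          by (intro eventually_ball_finite) auto
        then show ?thesis by (auto elim!: eventually_mono)
      qed
      then show "\<forall>\<^sub>F t in at t0. dist (g t) (pderivative k F x) < e"
      proof (rule eventually_mono)
        fix t assume near: "\<forall>i<n. \<bar>c t i - x i\<bar> < d"
        show "dist (g t) (pderivative k F x) < e"
        proof (cases "c t k = x k")
          case True then show ?thesis using e by (simp add: g_def)
        next
          case False
          let ?\<psi> = "\<lambda>s. F ((p k t)(k := s))"
          have inV: "(p k t)(k := s) \<in> V \<and> \<bar>pderivative k F ((p k t)(k := s)) - pderivative k F x\<bar> < e"
            if "\<bar>s - x k\<bar> \<le> \<bar>c t k - x k\<bar>" for s
            using near k that d(1) zero
            by (intro d(2)) (auto simp: topspace_Euclidean_space p_def x_def intro: order.strict_trans1)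
          have der: "(?\<psi> has_real_derivative pderivative k F ((p k t)(k := s))) (at s)"
            if "\<bar>s - x k\<bar> \<le> \<bar>c t k - x k\<bar>" for s
            using partial_has_derivative[OF F conjunct1[OF inV[OF that]] k] by simp
          have "\<exists>s. \<bar>s - x k\<bar> \<le> \<bar>c t k - x k\<bar> \<and> ?\<psi> (c t k) - ?\<psi> (x k) = (c t k - x k) * pderivative k F ((p k t)(k := s))"
          proof (cases "x k < c t k")
            case True
            have "\<exists>z>x k. z < c t k \<and> ?\<psi> (c t k) - ?\<psi> (x k) = (c t k - x k) * pderivative k F ((p k t)(k := z))"
              by (rule MVT2[OF True], rule der) (use True in auto)
            then obtain z where z: "z > x k" "z < c t k" "?\<psi> (c t k) - ?\<psi> (x k) = (c t k - x k) * pderivative k F ((p k t)(k := z))"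
              by blast
            moreover have "\<bar>z - x k\<bar> \<le> \<bar>c t k - x k\<bar>" using z(1,2) by simp
            ultimately show ?thesis by blast
          next
            case neg: False
            then have True: "c t k < x k" using False by simp
            have "\<exists>z>c t k. z < x k \<and> ?\<psi> (x k) - ?\<psi> (c t k) = (x k - c t k) * pderivative k F ((p k t)(k := z))"
              by (rule MVT2[OF True], rule der) (use True in auto)
            then obtain z where z: "z > c t k" "z < x k" "?\<psi> (x k) - ?\<psi> (c t k) = (x k - c t k) * pderivative k F ((p k t)(k := z))"
              by blast
            then have "?\<psi> (c t k) - ?\<psi> (x k) = (c t k - x k) * pderivative k F ((p k t)(k := z))"
              by (simp add: algebra_simps)
            moreover have "\<bar>z - x k\<bar> \<le> \<bar>c t k - x k\<bar>" using z(1,2) by simp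
            ultimately show ?thesis by blast
          qed
          then obtain s where s: "\<bar>s - x k\<bar> \<le> \<bar>c t k - x k\<bar>"
             "?\<psi> (c t k) - ?\<psi> (x k) = (c t k - x k) * pderivative k F ((p k t)(k := s))" by blast
          then have "g t = pderivative k F ((p k t)(k := s))"
            unfolding g_def pS(1) using False pS(2)[of t] by simp
          then show ?thesis using inV[OF s(1)] by (simp add: dist_real_def)
        qed
      qed
    qed
    moreover have "g t0 = pderivative k F x" by (simp add: g_def x_def)
    ultimately have "isCont g t0" by (simp add: isCont_def)
    then have g: "((\<lambda>t. g t * (c t k - x k)) has_real_derivative pderivative k F x * c' k) (at t0)"
    proof -
      have "((\<lambda>t. (c t k - x k) / (t - t0)) \<longlongrightarrow> c' k) (at t0)"
        using c[OF k] unfolding has_field_derivative_iff x_def .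
      then have "((\<lambda>t. g t * ((c t k - x k) / (t - t0))) \<longlongrightarrow> pderivative k F x * c' k) (at t0)"
        using \<open>(g \<longlongrightarrow> pderivative k F x) (at t0)\<close> by (rule tendsto_mult[rotated])
      then show ?thesis unfolding has_field_derivative_iff by (simp add: x_def)
    qed
    have "((\<lambda>t. F (p k t) + g t * (c t k - x k)) has_real_derivative
        (\<Sum>i<k. pderivative i F (c t0) * c' i) + pderivative k F x * c' k) (at t0)"
      using Suc g by (intro DERIV_add) auto
    then show ?case unfolding diff[symmetric] by (simp add: x_def)
  qed
  from this[of n] have "((\<lambda>t. F (p n t)) has_real_derivative (\<Sum>i<n. pderivative i F (c t0) * c' i)) (at t0)" by simp
  moreover have "\<forall>\<^sub>F t in nhds t0. F (c t) = F (p n t)"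
    using cE by (rule eventually_mono) (auto simp: p_def topspace_Euclidean_space zero fun_eq_iff intro!: arg_cong[of _ _ F])
  ultimately show ?thesis by (subst DERIV_cong_ev[OF refl _ refl])
qed

lemma
  assumes V: "openin (Euclidean_space n) V" and F: "partially_differentiable n V F"
    and cont: "\<And>i. i < n \<Longrightarrow> continuous_on V (pderivative i F)"
    and V': "openin (Euclidean_space m) V'" and \<Psi>: "\<And>v. v \<in> V' \<Longrightarrow> \<Psi> v \<in> V"
    and d\<Psi>: "\<And>i. i < n \<Longrightarrow> partially_differentiable m V' (\<lambda>v. \<Psi> v i)"
  shows partially_differentiable_compose: "partially_differentiable m V' (\<lambda>v. F (\<Psi> v))"
    and pderivative_compose: "\<And>j v. j < m \<Longrightarrow> v \<in> V' \<Longrightarrow>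
      pderivative j (\<lambda>v. F (\<Psi> v)) v = (\<Sum>i<n. pderivative i F (\<Psi> v) * pderivative j (\<lambda>v. \<Psi> v i) v)"
proof -
  have *: "((\<lambda>t. F (\<Psi> (v(j := t)))) has_real_derivative
      (\<Sum>i<n. pderivative i F (\<Psi> v) * pderivative j (\<lambda>v. \<Psi> v i) v)) (at (v j))"
    if j: "j < m" and v: "v \<in> V'" for j v
  proof -
    have "\<forall>\<^sub>F t in nhds (v j). \<Psi> (v(j := t)) \<in> topspace (Euclidean_space n)"
      using eventually_coordinate_line[OF V' v j] by (rule eventually_mono) (use \<Psi> openin_subset[OF V] in auto)
    from chain_rule_along_curve[OF V F cont _ this partial_has_derivative[OF d\<Psi> v j]] \<Psi>[OF v]
    show ?thesis by simp
  qed
  then show "partially_differentiable m V' (\<lambda>v. F (\<Psi> v))"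
    unfolding partially_differentiable_def real_differentiable_def by blast
  show "pderivative j (\<lambda>v. F (\<Psi> v)) v = (\<Sum>i<n. pderivative i F (\<Psi> v) * pderivative j (\<lambda>v. \<Psi> v i) v)"
    if "j < m" "v \<in> V'" for j v
    using *[OF that] unfolding pderivative_def[of j "\<lambda>v. F (\<Psi> v)"] by (rule DERIV_imp_deriv)
qed

text \<open>
  The partial derivatives of the composite are sums of products of functions of class \<open>C\<^sup>k\<close>; for the
  factors coming from \<open>F\<close> this is the induction hypothesis.
\<close>

lemma Ck_compose:
  assumes V: "openin (Euclidean_space n) V" and V': "openin (Euclidean_space m) V'"
    and \<Psi>: "\<And>v. v \<in> V' \<Longrightarrow> \<Psi> v \<in> V"
  shows "Ck n V k F \<Longrightarrow> (\<And>i. i < n \<Longrightarrow> Ck m V' k (\<lambda>v. \<Psi> v i)) \<Longrightarrow> Ck m V' k (\<lambda>v. F (\<Psi> v))"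
proof (induction k arbitrary: F)
  have cont: "continuous_on V' (\<lambda>v. F (\<Psi> v))" if F: "continuous_on V F" and c: "\<And>i. i < n \<Longrightarrow> continuous_on V' (\<lambda>v. \<Psi> v i)"
    for F :: "(nat \<Rightarrow> real) \<Rightarrow> real"
  proof -
    have "continuous_on V' (\<lambda>v. \<Psi> v i)" for i
    proof (cases "i < n")
      case False
      then have "\<Psi> v i = 0" if "v \<in> V'" for v
        using \<Psi>[OF that] openin_subset[OF V] by (auto simp: topspace_Euclidean_space)
      then show ?thesis by (simp cong: continuous_on_cong)
    qed (rule c)
    then have "continuous_on V' \<Psi>" by (intro continuous_on_coordinatewise_then_product) auto
    then show ?thesis using F \<Psi> by (auto intro!: continuous_on_compose2[of V F])
  qed
  {
    case 0
    then show ?case using cont by auto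
  next
    case (Suc k)
    have F: "partially_differentiable n V F" "\<And>i. i < n \<Longrightarrow> continuous_on V (pderivative i F)"
      using Suc.prems(1) by (auto intro: Ck_continuous)
    have d: "\<And>i. i < n \<Longrightarrow> partially_differentiable m V' (\<lambda>v. \<Psi> v i)" using Suc.prems(2) by auto
    have "Ck m V' k (pderivative j (\<lambda>v. F (\<Psi> v)))" if j: "j < m" for j
    proof (rule Ck_cong[OF V'])
      show "Ck m V' k (\<lambda>v. \<Sum>i<n. pderivative i F (\<Psi> v) * pderivative j (\<lambda>v. \<Psi> v i) v)"
      proof (rule Ck_sum[OF V'])
        fix i assume "i \<in> {..<n}"
        then have i: "i < n" by simp
        show "Ck m V' k (\<lambda>v. pderivative i F (\<Psi> v) * pderivative j (\<lambda>v. \<Psi> v i) v)"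
        proof (rule Ck_mult[OF V'])
          show "Ck m V' k (\<lambda>v. pderivative i F (\<Psi> v))"
          proof (rule Suc.IH)
            show "Ck n V k (pderivative i F)" using Suc.prems(1) i by simp
            show "Ck m V' k (\<lambda>v. \<Psi> v i)" if "i < n" for i using Ck_mono[OF Suc.prems(2)[OF that]] .
          qed
          show "Ck m V' k (pderivative j (\<lambda>v. \<Psi> v i))"
            using Suc.prems(2)[OF i] j by simp
        qed
      qed simp
    qed (simp add: pderivative_compose[OF V F V' \<Psi> d j])
    moreover have "continuous_on V' (\<lambda>v. F (\<Psi> v))"
      by (rule cont) (use Suc.prems in auto)
    ultimately show ?case
      unfolding Ck.simps using partially_differentiable_compose[OF V F V' \<Psi> d] by blast
  }
qed

section \<open>Charts and left translations\<close>

lemma Ck_coordinate: "Ck n V k (\<lambda>w. w i)"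
proof -
  have p: "pderivative j (\<lambda>w. w i) = (\<lambda>w. if i = j then 1 else 0)" for j
  proof
    fix w :: "nat \<Rightarrow> real"
    show "pderivative j (\<lambda>w. w i) w = (if i = j then 1 else 0)"
      unfolding pderivative_def by (cases "i = j") auto
  qed
  have d: "(\<lambda>t. (x(j := t)) i) differentiable (at (x j))" for j and x :: "nat \<Rightarrow> real"
    by (cases "i = j") auto
  have c: "continuous_on V (\<lambda>w. w i)"
    by (rule continuous_on_subset[OF continuous_on_product_coordinates]) simp
  show ?thesis
  proof (cases k)
    case 0 then show ?thesis using c by simp
  next
    case (Suc l)
    then show ?thesis using c d by (simp add: p Ck_const partially_differentiable_def)
  qed
qed

lemma Ck_local:
  assumes "\<And>v. v \<in> V \<Longrightarrow> \<exists>W. openin (Euclidean_space n) W \<and> v \<in> W \<and> W \<subseteq> V \<and> Ck n W k F"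
  shows "Ck n V k F"
  using assms
proof (induction k arbitrary: F)
  have cont: "continuous_on V F" if *: "\<And>v. v \<in> V \<Longrightarrow> \<exists>W. openin (Euclidean_space n) W \<and> v \<in> W \<and> W \<subseteq> V \<and> continuous_on W F"
    for F :: "(nat \<Rightarrow> real) \<Rightarrow> real"
    unfolding continuous_on_eq_continuous_within
  proof
    fix v assume "v \<in> V"
    then obtain W where W: "openin (Euclidean_space n) W" "v \<in> W" "W \<subseteq> V" "continuous_on W F" using * by blast
    obtain O' where O': "open O'" "W = O' \<inter> topspace (Euclidean_space n)"
      using W(1) unfolding Euclidean_space_def openin_subtopology euclidean_product_topology by auto
    have "V \<subseteq> topspace (Euclidean_space n)" using * openin_subset by blast
    then have "at v within V = at v within W"
      using O' W by (intro at_within_nhd[of v O']) auto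
    then show "continuous (at v within V) F"
      using W(2,4) by (simp add: continuous_on_eq_continuous_within)
  qed
  {
    case 0 then show ?case using cont by simp
  next
    case (Suc k)
    have "continuous_on V F" using Suc.prems by (intro cont) (metis Ck_continuous)
    moreover have "partially_differentiable n V F"
      unfolding partially_differentiable_def
    proof (intro allI impI ballI)
      fix i x assume "i < n" "x \<in> V"
      then show "(\<lambda>t. F (x(i := t))) differentiable at (x i)"
        using Suc.prems[of x] unfolding Ck.simps partially_differentiable_def by blast
    qed
    moreover have "Ck n V k (pderivative i F)" if "i < n" for i
      using Suc.prems that by (intro Suc.IH) (metis Ck.simps(2))
    ultimately show ?case unfolding Ck.simps by blast
  }
qed

lemma chart_homeomorphism:
  assumes M: "smooth_manifold M" and U: "(U, \<phi>) \<in> atlas M"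
  shows "openin (mtop M) U" "openin (Euclidean_space (mdim M)) (\<phi> ` U)" "inj_on \<phi> U"
    "continuous_map (subtopology (mtop M) U) (subtopology (Euclidean_space (mdim M)) (\<phi> ` U)) \<phi>"
    "continuous_map (subtopology (Euclidean_space (mdim M)) (\<phi> ` U)) (subtopology (mtop M) U) (inv_into U \<phi>)"
proof -
  show U': "openin (mtop M) U" and E: "openin (Euclidean_space (mdim M)) (\<phi> ` U)"
    using M U unfolding smooth_manifold_def by blast+
  have h: "homeomorphic_map (subtopology (mtop M) U) (subtopology (Euclidean_space (mdim M)) (\<phi> ` U)) \<phi>"
    using M U unfolding smooth_manifold_def by blast
  have t: "topspace (subtopology (mtop M) U) = U" "topspace (subtopology (Euclidean_space (mdim M)) (\<phi> ` U)) = \<phi> ` U"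
    using openin_subset[OF U'] openin_subset[OF E] by auto
  show inj: "inj_on \<phi> U" using homeomorphic_imp_injective_map[OF h] t by simp
  obtain g where g: "homeomorphic_maps (subtopology (mtop M) U) (subtopology (Euclidean_space (mdim M)) (\<phi> ` U)) \<phi> g"
    using h by (auto simp: homeomorphic_map_maps)
  then show "continuous_map (subtopology (mtop M) U) (subtopology (Euclidean_space (mdim M)) (\<phi> ` U)) \<phi>"
    by (simp add: homeomorphic_maps_def)
  have geq: "g y = inv_into U \<phi> y" if "y \<in> \<phi> ` U" for y
    using g inj that t unfolding homeomorphic_maps_def by auto
  have "continuous_map (subtopology (Euclidean_space (mdim M)) (\<phi> ` U)) (subtopology (mtop M) U) g"
    using g by (simp add: homeomorphic_maps_def)
  then show "continuous_map (subtopology (Euclidean_space (mdim M)) (\<phi> ` U)) (subtopology (mtop M) U) (inv_into U \<phi>)"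
    by (rule continuous_map_eq) (use t geq in simp)
qed

definition prod_chart :: "nat \<Rightarrow> ('a \<Rightarrow> nat \<Rightarrow> real) \<Rightarrow> ('b \<Rightarrow> nat \<Rightarrow> real) \<Rightarrow> 'a \<times> 'b \<Rightarrow> nat \<Rightarrow> real" where
  "prod_chart n \<phi> \<psi> = (\<lambda>(x, y). concat_coords n (\<phi> x) (\<psi> y))"

definition first_coords :: "nat \<Rightarrow> (nat \<Rightarrow> real) \<Rightarrow> nat \<Rightarrow> real" where
  "first_coords n w = (\<lambda>i. if i < n then w i else 0)"

definition last_coords :: "nat \<Rightarrow> (nat \<Rightarrow> real) \<Rightarrow> nat \<Rightarrow> real" where
  "last_coords n w = (\<lambda>i. w (i + n))"

lemma coords_concat:
  "u \<in> topspace (Euclidean_space n) \<Longrightarrow> first_coords n (concat_coords n u v) = u"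
  "last_coords n (concat_coords n u v) = v"
  "concat_coords n (first_coords n w) (last_coords n w) = w"
  by (auto simp: first_coords_def last_coords_def concat_coords_def topspace_Euclidean_space fun_eq_iff)

lemma prod_chart_image_open:
  assumes M: "smooth_manifold M" and U: "(U, \<phi>) \<in> atlas M"
    and N: "smooth_manifold N" and V: "(V, \<psi>) \<in> atlas N"
    and O': "openin (prod_topology (mtop M) (mtop N)) O'" "O' \<subseteq> U \<times> V"
  shows "openin (Euclidean_space (mdim M + mdim N)) (prod_chart (mdim M) \<phi> \<psi> ` O')"
proof -
  let ?n = "mdim M" and ?m = "mdim N"
  let ?E = "Euclidean_space (?n + ?m)"
  note cU = chart_homeomorphism[OF M U] and cV = chart_homeomorphism[OF N V]
  have Usub: "\<phi> ` U \<subseteq> topspace (Euclidean_space ?n)" "\<psi> ` V \<subseteq> topspace (Euclidean_space ?m)"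
    using openin_subset[OF cU(2)] openin_subset[OF cV(2)] by auto
  have cm: "continuous_map ?E euclideanreal (\<lambda>w. w i)" for i
    unfolding Euclidean_space_def by (intro continuous_map_from_subtopology continuous_map_product_projection) auto
  have c1: "continuous_map ?E (Euclidean_space ?n) (first_coords ?n)"
    unfolding first_coords_def continuous_map_componentwise_Euclidean_space using cm by auto
  have lc: "last_coords ?n w = (\<lambda>i. if i < ?m then w (i + ?n) else 0)" if "w \<in> topspace ?E" for w
    using that by (auto simp: last_coords_def topspace_Euclidean_space)
  have "continuous_map ?E (Euclidean_space ?m) (\<lambda>w i. if i < ?m then w (i + ?n) else 0)"
    unfolding continuous_map_componentwise_Euclidean_space using cm by auto
  then have c2: "continuous_map ?E (Euclidean_space ?m) (last_coords ?n)"
    by (rule continuous_map_eq) (simp add: lc)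
  define D where "D = {w \<in> topspace ?E. first_coords ?n w \<in> \<phi> ` U} \<inter> {w \<in> topspace ?E. last_coords ?n w \<in> \<psi> ` V}"
  have D: "openin ?E D" unfolding D_def
    using openin_continuous_map_preimage[OF c1 cU(2)] openin_continuous_map_preimage[OF c2 cV(2)] by auto
  have tD: "topspace (subtopology ?E D) = D" unfolding D_def by auto
  have r1: "continuous_map (subtopology ?E D) (mtop M) (\<lambda>w. inv_into U \<phi> (first_coords ?n w))"
  proof -
    have "continuous_map (subtopology ?E D) (subtopology (Euclidean_space ?n) (\<phi> ` U)) (first_coords ?n)"
      using c1 by (auto simp: continuous_map_in_subtopology continuous_map_from_subtopology D_def)
    from continuous_map_compose[OF this cU(5)] show ?thesis
      by (auto simp: continuous_map_in_subtopology o_def)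
  qed
  have r2: "continuous_map (subtopology ?E D) (mtop N) (\<lambda>w. inv_into V \<psi> (last_coords ?n w))"
  proof -
    have "continuous_map (subtopology ?E D) (subtopology (Euclidean_space ?m) (\<psi> ` V)) (last_coords ?n)"
      using c2 by (auto simp: continuous_map_in_subtopology continuous_map_from_subtopology D_def)
    from continuous_map_compose[OF this cV(5)] show ?thesis
      by (auto simp: continuous_map_in_subtopology o_def)
  qed
  let ?r = "\<lambda>w. (inv_into U \<phi> (first_coords ?n w), inv_into V \<psi> (last_coords ?n w))"
  have r: "continuous_map (subtopology ?E D) (prod_topology (mtop M) (mtop N)) ?r"
    using r1 r2 by (simp add: continuous_map_pairwise o_def)
  have "prod_chart ?n \<phi> \<psi> ` O' = {w \<in> topspace (subtopology ?E D). ?r w \<in> O'}"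
  proof (intro equalityI subsetI)
    fix w assume "w \<in> prod_chart ?n \<phi> \<psi> ` O'"
    then obtain x y where xy: "(x, y) \<in> O'" "x \<in> U" "y \<in> V" "w = concat_coords ?n (\<phi> x) (\<psi> y)"
      using O'(2) by (auto simp: prod_chart_def)
    have "\<phi> x \<in> topspace (Euclidean_space ?n)" "\<psi> y \<in> topspace (Euclidean_space ?m)" using Usub xy by auto
    then have "w \<in> topspace ?E" "first_coords ?n w = \<phi> x" "last_coords ?n w = \<psi> y"
      using xy(4) by (auto simp: coords_concat) (auto simp: topspace_Euclidean_space concat_coords_def)
    then show "w \<in> {w \<in> topspace (subtopology ?E D). ?r w \<in> O'}"
      unfolding tD using xy cU(3) cV(3) by (auto simp: D_def)
  next
    fix w assume "w \<in> {w \<in> topspace (subtopology ?E D). ?r w \<in> O'}"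
    then have w: "w \<in> D" "?r w \<in> O'" unfolding tD by auto
    have "prod_chart ?n \<phi> \<psi> (?r w) = w"
      using w(1) by (auto simp: prod_chart_def D_def f_inv_into_f coords_concat)
    then show "w \<in> prod_chart ?n \<phi> \<psi> ` O'" using w(2) by (metis imageI)
  qed
  then have "openin (subtopology ?E D) (prod_chart ?n \<phi> \<psi> ` O')"
    using openin_continuous_map_preimage[OF r O'(1)] by simp
  then show ?thesis using D by (simp add: openin_open_subtopology)
qed

lemma prod_chart_inj:
  assumes M: "smooth_manifold M" and U: "(U, \<phi>) \<in> atlas M"
    and N: "smooth_manifold N" and V: "(V, \<psi>) \<in> atlas N"
  shows "inj_on (prod_chart (mdim M) \<phi> \<psi>) (U \<times> V)"
proof (rule inj_onI, clarify)
  note cU = chart_homeomorphism[OF M U] and cV = chart_homeomorphism[OF N V]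
  fix x y x' y' assume *: "x \<in> U" "y \<in> V" "x' \<in> U" "y' \<in> V" "prod_chart (mdim M) \<phi> \<psi> (x, y) = prod_chart (mdim M) \<phi> \<psi> (x', y')"
  have "\<phi> x \<in> topspace (Euclidean_space (mdim M))" "\<phi> x' \<in> topspace (Euclidean_space (mdim M))"
    using openin_subset[OF cU(2)] * by auto
  then have "\<phi> x = \<phi> x'" "\<psi> y = \<psi> y'"
    using *(5) unfolding prod_chart_def by (metis case_prod_conv coords_concat(1), metis case_prod_conv coords_concat(2))
  then show "x = x' \<and> y = y'" using cU(3) cV(3) * by (auto dest: inj_onD)
qed

lemma mprod_simps:
  "mtop (mprod M N) = prod_topology (mtop M) (mtop N)"
  "mdim (mprod M N) = mdim M + mdim N"
  "points (mprod M N) = points M \<times> points N"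
  by (auto simp: mprod_def)

lemma mprod_atlas:
  "atlas (mprod M N) = {(U \<times> V, prod_chart (mdim M) \<phi> \<psi>) | U \<phi> V \<psi>. (U, \<phi>) \<in> atlas M \<and> (V, \<psi>) \<in> atlas N}"
  unfolding mprod_def prod_chart_def by (auto simp: image_iff) force

lemma lie_group_mult_continuous:
  assumes "lie_group G MG"
  shows "continuous_map (prod_topology (mtop MG) (mtop MG)) (mtop MG) (\<lambda>(g, h). g \<otimes>\<^bsub>G\<^esub> h)"
  using assms unfolding lie_group_def smooth_map_def by (simp add: mprod_simps)

lemma lie_group_left_mult_continuous:
  assumes G: "lie_group G MG" and a: "a \<in> carrier G"
  shows "continuous_map (mtop MG) (mtop MG) (\<lambda>h. a \<otimes>\<^bsub>G\<^esub> h)"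
proof -
  have "continuous_map (mtop MG) (prod_topology (mtop MG) (mtop MG)) (\<lambda>h. (a, h))"
    using G a by (simp add: continuous_map_pairwise o_def lie_group_def)
  from continuous_map_compose[OF this lie_group_mult_continuous[OF G]]
  show ?thesis by (simp add: o_def)
qed

lemma point_in_chart:
  assumes "smooth_manifold M" "p \<in> points M"
  obtains U \<phi> where "(U, \<phi>) \<in> atlas M" "p \<in> U"
  using assms unfolding smooth_manifold_def by blast

text \<open>
  Left multiplication by \<open>a\<close> is the multiplication of the group on the slice \<open>{a} \<times> G\<close>. In a product
  chart around \<open>(a, h)\<close> the slice is obtained by freezing the first half of the coordinates, which is
  a smooth substitution.
\<close>

lemma left_mult_smooth_in_charts:
  assumes G: "lie_group G MG" and a: "a \<in> carrier G"
    and V: "(V, \<psi>) \<in> atlas MG" and V': "(V', \<psi>') \<in> atlas MG" and j: "j < mdim MG"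
  defines "N \<equiv> {h \<in> V. a \<otimes>\<^bsub>G\<^esub> h \<in> V'}"
  shows "openin (mtop MG) N" and "openin (Euclidean_space (mdim MG)) (\<psi> ` N)"
    and "Ck (mdim MG) (\<psi> ` N) k (\<lambda>v. \<psi>' (a \<otimes>\<^bsub>G\<^esub> inv_into V \<psi> v) j)"
proof -
  let ?m = "mdim MG"
  have MG: "smooth_manifold MG" and car: "points MG = carrier G" using G by (auto simp: lie_group_def)
  note cV = chart_homeomorphism[OF MG V] and cV' = chart_homeomorphism[OF MG V']
  have Vsub: "V \<subseteq> carrier G" using openin_subset[OF cV(1)] car by simp
  have "openin (mtop MG) {h \<in> topspace (mtop MG). a \<otimes>\<^bsub>G\<^esub> h \<in> V'}"
    using openin_continuous_map_preimage[OF lie_group_left_mult_continuous[OF G a] cV'(1)] .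
  moreover have "N = V \<inter> {h \<in> topspace (mtop MG). a \<otimes>\<^bsub>G\<^esub> h \<in> V'}"
    using Vsub car by (auto simp: N_def)
  ultimately show N: "openin (mtop MG) N" using cV(1) by auto
  have "\<psi> ` N = {v \<in> topspace (subtopology (Euclidean_space ?m) (\<psi> ` V)). inv_into V \<psi> v \<in> N}"
    using cV(3) openin_subset[OF cV(2)] by (auto simp: N_def inv_into_f_f)
  moreover have "openin (subtopology (mtop MG) V) N"
    using N by (auto simp: openin_subtopology N_def)
  ultimately have "openin (subtopology (Euclidean_space ?m) (\<psi> ` V)) (\<psi> ` N)"
    using openin_continuous_map_preimage[OF cV(5)] by simp
  then show \<psi>N: "openin (Euclidean_space ?m) (\<psi> ` N)"
    using cV(2) by (simp add: openin_open_subtopology)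
  obtain Va \<psi>a where Va: "(Va, \<psi>a) \<in> atlas MG" "a \<in> Va"
    using point_in_chart[OF MG] a car by metis
  note cVa = chart_homeomorphism[OF MG Va(1)]
  let ?\<chi> = "prod_chart ?m \<psi>a \<psi>"
  let ?O = "{z \<in> Va \<times> V. (\<lambda>(g, h). g \<otimes>\<^bsub>G\<^esub> h) z \<in> V'}"
  have Oop: "openin (prod_topology (mtop MG) (mtop MG)) ?O"
  proof -
    have "openin (prod_topology (mtop MG) (mtop MG)) (Va \<times> V)"
      using cVa(1) cV(1) by (simp add: openin_prod_Times_iff)
    moreover have "?O = (Va \<times> V) \<inter> {z \<in> topspace (prod_topology (mtop MG) (mtop MG)). (\<lambda>(g, h). g \<otimes>\<^bsub>G\<^esub> h) z \<in> V'}"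
      using openin_subset[OF cVa(1)] openin_subset[OF cV(1)] by auto
    ultimately show ?thesis
      using openin_continuous_map_preimage[OF lie_group_mult_continuous[OF G] cV'(1)] by auto
  qed
  have Xop: "openin (Euclidean_space (?m + ?m)) (?\<chi> ` ?O)"
    by (rule prod_chart_image_open[OF MG Va(1) MG V Oop]) auto
  have "smooth_vec (?m + ?m) ?m (?\<chi> ` ?O) (\<psi>' \<circ> (\<lambda>(g, h). g \<otimes>\<^bsub>G\<^esub> h) \<circ> inv_into (Va \<times> V) ?\<chi>)"
  proof -
    have "(Va \<times> V, ?\<chi>) \<in> atlas (mprod MG MG)" using Va V by (auto simp: mprod_atlas)
    then show ?thesis using G V' unfolding lie_group_def smooth_map_def mprod_simps by blast
  qed
  then have \<Gamma>: "Ck (?m + ?m) (?\<chi> ` ?O) k (\<lambda>w. \<psi>' ((\<lambda>(g, h). g \<otimes>\<^bsub>G\<^esub> h) (inv_into (Va \<times> V) ?\<chi> w)) j)"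
    using j smooth_real_iff_Ck[OF openin_subset[OF Xop]] unfolding smooth_vec_def o_def by blast
  have slice: "concat_coords ?m (\<psi>a a) v \<in> ?\<chi> ` ?O \<and>
      inv_into (Va \<times> V) ?\<chi> (concat_coords ?m (\<psi>a a) v) = (a, inv_into V \<psi> v)" if "v \<in> \<psi> ` N" for v
  proof -
    obtain h where h: "h \<in> N" "v = \<psi> h" using \<open>v \<in> \<psi> ` N\<close> by blast
    have eq: "concat_coords ?m (\<psi>a a) v = ?\<chi> (a, h)" by (simp add: prod_chart_def h)
    have ah: "(a, h) \<in> ?O" "(a, h) \<in> Va \<times> V" using h Va by (auto simp: N_def)
    show ?thesis unfolding eq
      using inv_into_f_f[OF prod_chart_inj[OF MG Va(1) MG V] ah(2)] ah(1) cV(3) h by (auto simp: N_def)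
  qed
  have "Ck ?m (\<psi> ` N) k (\<lambda>v. \<psi>' ((\<lambda>(g, h). g \<otimes>\<^bsub>G\<^esub> h) (inv_into (Va \<times> V) ?\<chi> (concat_coords ?m (\<psi>a a) v))) j)"
  proof (rule Ck_compose[OF Xop \<psi>N _ \<Gamma>])
    show "concat_coords ?m (\<psi>a a) v \<in> ?\<chi> ` ?O" if "v \<in> \<psi> ` N" for v using slice[OF that] by blast
    show "Ck ?m (\<psi> ` N) k (\<lambda>v. concat_coords ?m (\<psi>a a) v i)" for i
      by (cases "i < ?m") (simp_all add: concat_coords_def Ck_const Ck_coordinate)
  qed
  then show "Ck ?m (\<psi> ` N) k (\<lambda>v. \<psi>' (a \<otimes>\<^bsub>G\<^esub> inv_into V \<psi> v) j)"
    by (rule Ck_cong[OF \<psi>N, rotated]) (use slice in simp)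
qed

text \<open>
  Smoothness is local. Near a given point, \<open>a\<close> maps the group component into a single chart, and in
  charts the translated function is \<open>f\<close> after the identity in the coordinates of \<open>X\<close> and left
  multiplication by \<open>a\<close> in those of \<open>G\<close>.
\<close>

lemma left_action_C_inf:
  assumes MX: "smooth_manifold MX" and G: "lie_group G MG" and a: "a \<in> carrier G"
    and f: "f \<in> C_inf (mprod MX MG)"
  shows "left_action MX G a f \<in> C_inf (mprod MX MG)"
proof -
  let ?n = "mdim MX" and ?m = "mdim MG"
  have MG: "smooth_manifold MG" and car: "points MG = carrier G" and grp: "group G" using G by (auto simp: lie_group_def)
  have "smooth_real (?n + ?m) (prod_chart ?n \<phi> \<psi> ` (U \<times> V)) (left_action MX G a f \<circ> inv_into (U \<times> V) (prod_chart ?n \<phi> \<psi>))"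
    if U: "(U, \<phi>) \<in> atlas MX" and V: "(V, \<psi>) \<in> atlas MG" for U \<phi> V \<psi>
  proof -
    let ?\<chi> = "prod_chart ?n \<phi> \<psi>"
    note cU = chart_homeomorphism[OF MX U] and cV = chart_homeomorphism[OF MG V]
    have UV: "openin (prod_topology (mtop MX) (mtop MG)) (U \<times> V)" using cU(1) cV(1) by (simp add: openin_prod_Times_iff)
    have op: "openin (Euclidean_space (?n + ?m)) (?\<chi> ` (U \<times> V))"
      by (rule prod_chart_image_open[OF MX U MG V UV]) auto
    have "Ck (?n + ?m) (?\<chi> ` (U \<times> V)) k (left_action MX G a f \<circ> inv_into (U \<times> V) ?\<chi>)" for k
    proof (rule Ck_local)
      fix w assume "w \<in> ?\<chi> ` (U \<times> V)"
      then obtain x h where xh: "x \<in> U" "h \<in> V" "w = ?\<chi> (x, h)" by auto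
      have "a \<otimes>\<^bsub>G\<^esub> h \<in> points MG"
        using openin_subset[OF cV(1)] xh(2) a car group.is_monoid[OF grp] by (auto intro: monoid.m_closed)
      then obtain V' \<psi>' where V': "(V', \<psi>') \<in> atlas MG" "a \<otimes>\<^bsub>G\<^esub> h \<in> V'" by (rule point_in_chart[OF MG])
      note cV' = chart_homeomorphism[OF MG V'(1)]
      define N where "N = {h \<in> V. a \<otimes>\<^bsub>G\<^esub> h \<in> V'}"
      have N: "openin (mtop MG) N"
      proof -
        have "openin (mtop MG) {h \<in> topspace (mtop MG). a \<otimes>\<^bsub>G\<^esub> h \<in> V'}"
          using openin_continuous_map_preimage[OF lie_group_left_mult_continuous[OF G a] cV'(1)] .
        moreover have "N = V \<inter> {h \<in> topspace (mtop MG). a \<otimes>\<^bsub>G\<^esub> h \<in> V'}"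
          using openin_subset[OF cV(1)] by (auto simp: N_def)
        ultimately show ?thesis using cV(1) by auto
      qed
      have UN: "openin (prod_topology (mtop MX) (mtop MG)) (U \<times> N)" using cU(1) N by (simp add: openin_prod_Times_iff)
      let ?W = "?\<chi> ` (U \<times> N)"
      have W: "openin (Euclidean_space (?n + ?m)) ?W"
        by (rule prod_chart_image_open[OF MX U MG V UN]) (auto simp: N_def)
      have UV': "openin (prod_topology (mtop MX) (mtop MG)) (U \<times> V')" using cU(1) cV'(1) by (simp add: openin_prod_Times_iff)
      let ?\<chi>' = "prod_chart ?n \<phi> \<psi>'"
      have op': "openin (Euclidean_space (?n + ?m)) (?\<chi>' ` (U \<times> V'))"
        by (rule prod_chart_image_open[OF MX U MG V'(1) UV']) auto
      have "smooth_real (?n + ?m) (?\<chi>' ` (U \<times> V')) (f \<circ> inv_into (U \<times> V') ?\<chi>')"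
      proof -
        have "(U \<times> V', ?\<chi>') \<in> atlas (mprod MX MG)" using U V' by (auto simp: mprod_atlas)
        then show ?thesis using f unfolding C_inf_def mprod_simps by blast
      qed
      then have Ckf: "Ck (?n + ?m) (?\<chi>' ` (U \<times> V')) k (f \<circ> inv_into (U \<times> V') ?\<chi>')"
        using smooth_real_iff_Ck[OF openin_subset[OF op']] by blast
      let ?\<Psi> = "\<lambda>w. concat_coords ?n (first_coords ?n w) (\<lambda>j. \<psi>' (a \<otimes>\<^bsub>G\<^esub> inv_into V \<psi> (last_coords ?n w)) j)"
      have chi: "?\<Psi> (?\<chi> (y, g)) = ?\<chi>' (y, a \<otimes>\<^bsub>G\<^esub> g) \<and> last_coords ?n (?\<chi> (y, g)) = \<psi> g" if "y \<in> U" "g \<in> V" for y g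
      proof -
        have "\<phi> y \<in> topspace (Euclidean_space ?n)" using openin_subset[OF cU(2)] that by auto
        then show ?thesis using cV(3) that by (simp add: prod_chart_def coords_concat)
      qed
      have "Ck (?n + ?m) ?W k (\<lambda>w. (f \<circ> inv_into (U \<times> V') ?\<chi>') (?\<Psi> w))"
      proof (rule Ck_compose[OF op' W _ Ckf])
        fix w assume "w \<in> ?W"
        then obtain y g where yg: "y \<in> U" "g \<in> N" "w = ?\<chi> (y, g)" by auto
        then show "?\<Psi> w \<in> ?\<chi>' ` (U \<times> V')"
          using chi[of y g] by (auto simp: N_def)
      next
        fix i assume i: "i < ?n + ?m"
        show "Ck (?n + ?m) ?W k (\<lambda>w. ?\<Psi> w i)"
        proof (cases "i < ?n")
          case True
          then show ?thesis by (simp add: concat_coords_def first_coords_def Ck_coordinate)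
        next
          case False
          then have j: "i - ?n < ?m" using i by simp
          note lm = left_mult_smooth_in_charts[OF G a V V'(1) j, folded N_def]
          have "Ck (?n + ?m) ?W k (\<lambda>w. \<psi>' (a \<otimes>\<^bsub>G\<^esub> inv_into V \<psi> (last_coords ?n w)) (i - ?n))"
          proof (rule Ck_compose[OF lm(2) W _ lm(3)])
            show "last_coords ?n w \<in> \<psi> ` N" if "w \<in> ?W" for w
              using that chi by (auto simp: N_def)
            show "Ck (?n + ?m) ?W k (\<lambda>w. last_coords ?n w i)" for i
              by (simp add: last_coords_def Ck_coordinate)
          qed
          then show ?thesis using False by (simp add: concat_coords_def)
        qed
      qed
      then have "Ck (?n + ?m) ?W k (left_action MX G a f \<circ> inv_into (U \<times> V) ?\<chi>)"
      proof (rule Ck_cong[OF W, rotated])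
        fix w assume "w \<in> ?W"
        then obtain y g where yg: "y \<in> U" "g \<in> N" "w = ?\<chi> (y, g)" by auto
        have 1: "inv_into (U \<times> V) ?\<chi> w = (y, g)"
          unfolding yg(3) by (rule inv_into_f_f[OF prod_chart_inj[OF MX U MG V]]) (use yg in \<open>auto simp: N_def\<close>)
        have 2: "inv_into (U \<times> V') ?\<chi>' (?\<chi>' (y, a \<otimes>\<^bsub>G\<^esub> g)) = (y, a \<otimes>\<^bsub>G\<^esub> g)"
          by (rule inv_into_f_f[OF prod_chart_inj[OF MX U MG V'(1)]]) (use yg in \<open>auto simp: N_def\<close>)
        have 3: "?\<Psi> w = ?\<chi>' (y, a \<otimes>\<^bsub>G\<^esub> g)" using chi[of y g] yg by (auto simp: N_def)
        have "y \<in> points MX" "g \<in> carrier G"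
          using openin_subset[OF cU(1)] openin_subset[OF N] yg car by auto
        then show "(f \<circ> inv_into (U \<times> V') ?\<chi>') (?\<Psi> w) = (left_action MX G a f \<circ> inv_into (U \<times> V) ?\<chi>) w"
          unfolding o_def 1 3 2 by (simp add: left_action_def)
      qed
      moreover have "w \<in> ?W" "?W \<subseteq> ?\<chi> ` (U \<times> V)" using xh V'(2) by (auto simp: N_def)
      ultimately show "\<exists>W. openin (Euclidean_space (?n + ?m)) W \<and> w \<in> W \<and> W \<subseteq> ?\<chi> ` (U \<times> V) \<and>
          Ck (?n + ?m) W k (left_action MX G a f \<circ> inv_into (U \<times> V) ?\<chi>)"
        using W by blast
    qed
    then show ?thesis using smooth_real_iff_Ck[OF openin_subset[OF op]] by blast
  qed
  then show ?thesis
    unfolding C_inf_def mprod_simps by (auto simp: mprod_atlas left_action_def car)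
qed

lemma left_action_C_inf_compact:
  assumes MX: "smooth_manifold MX" and G: "lie_group G MG" and a: "a \<in> carrier G"
    and f: "f \<in> C_inf_compact (mprod MX MG)"
  shows "left_action MX G a f \<in> C_inf_compact (mprod MX MG)"
proof -
  interpret group G using G by (simp add: lie_group_def)
  have car: "points MG = carrier G" using G by (auto simp: lie_group_def)
  let ?T = "prod_topology (mtop MX) (mtop MG)"
  obtain C where C: "compactin ?T C" "\<And>z. z \<notin> C \<Longrightarrow> f z = 0"
    using f unfolding C_inf_compact_def mprod_simps by blast
  let ?l = "\<lambda>z. (fst z, inv\<^bsub>G\<^esub> a \<otimes>\<^bsub>G\<^esub> snd z)"
  have "continuous_map ?T ?T ?l"
    using continuous_map_compose[OF continuous_map_snd lie_group_left_mult_continuous[OF G inv_closed[OF a]]]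
    by (auto simp: continuous_map_pairwise o_def continuous_map_fst)
  then have "compactin ?T (?l ` C)" by (rule image_compactin[OF C(1)])
  moreover have "\<And>z. z \<notin> ?l ` C \<Longrightarrow> left_action MX G a f z = 0"
  proof -
    fix z assume nz: "z \<notin> ?l ` C"
    obtain x h where z: "z = (x, h)" by (cases z)
    have "f (x, a \<otimes>\<^bsub>G\<^esub> h) = 0" if h: "h \<in> carrier G"
    proof (rule C(2), rule notI)
      assume inC: "(x, a \<otimes>\<^bsub>G\<^esub> h) \<in> C"
      have "z = ?l (x, a \<otimes>\<^bsub>G\<^esub> h)"
        using h a by (simp add: m_assoc[symmetric] z)
      then have "z \<in> ?l ` C" using inC by (rule image_eqI)
      with nz show False by (rule notE)
    qed
    then show "left_action MX G a f z = 0" unfolding z left_action_def by simp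
  qed
  moreover have "left_action MX G a f \<in> C_inf (mprod MX MG)"
    by (rule left_action_C_inf[OF MX G a]) (use f in \<open>simp add: C_inf_compact_def\<close>)
  ultimately show ?thesis
    unfolding C_inf_compact_def mprod_simps(1) by (intro CollectI conjI exI[of _ "?l ` C"] allI impI)
qed

section \<open>The topology of manifolds\<close>

(* closure_of is the topological closure throughout. *)
no_notation eq_closure_of ("closure'_of\<index>")

lemma smooth_manifold_topology:
  assumes M: "smooth_manifold M"
  shows "Hausdorff_space (mtop M)" "second_countable (mtop M)" "locally_compact_space (mtop M)" "regular_space (mtop M)"
proof -
  show H: "Hausdorff_space (mtop M)" and "second_countable (mtop M)" using M by (auto simp: smooth_manifold_def)
  show L: "locally_compact_space (mtop M)"
    unfolding locally_compact_space_def
  proof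
    fix p assume "p \<in> topspace (mtop M)"
    then obtain U \<phi> where U: "(U, \<phi>) \<in> atlas M" "p \<in> U" using point_in_chart[OF M] by metis
    note cU = chart_homeomorphism[OF M U(1)]
    have "homeomorphic_map (subtopology (mtop M) U) (subtopology (Euclidean_space (mdim M)) (\<phi> ` U)) \<phi>"
      using M U unfolding smooth_manifold_def by blast
    then have "subtopology (mtop M) U homeomorphic_space subtopology (Euclidean_space (mdim M)) (\<phi> ` U)"
      by (rule homeomorphic_map_imp_homeomorphic_space)
    moreover have "locally_compact_space (subtopology (Euclidean_space (mdim M)) (\<phi> ` U))"
      by (rule locally_compact_space_open_subset[OF _ locally_compact_Euclidean_space cU(2)])
        (simp add: Hausdorff_Euclidean_space)
    ultimately have "locally_compact_space (subtopology (mtop M) U)"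
      by (simp add: homeomorphic_locally_compact_space)
    moreover have "p \<in> topspace (subtopology (mtop M) U)" using U openin_subset[OF cU(1)] by auto
    ultimately obtain W C where W: "openin (subtopology (mtop M) U) W" "compactin (subtopology (mtop M) U) C" "p \<in> W" "W \<subseteq> C"
      unfolding locally_compact_space_def by blast
    then have "openin (mtop M) W" "compactin (mtop M) C"
      using cU(1) by (auto simp: openin_open_subtopology compactin_subtopology)
    then show "\<exists>U K. openin (mtop M) U \<and> compactin (mtop M) K \<and> p \<in> U \<and> U \<subseteq> K" using W by blast
  qed
  show "regular_space (mtop M)" by (rule locally_compact_Hausdorff_imp_regular_space[OF L H])
qed

definition enumerated_base :: "'a topology \<Rightarrow> (nat \<Rightarrow> 'a set) \<Rightarrow> bool" where
  "enumerated_base T B \<longleftrightarrow> (\<forall>i. openin T (B i)) \<and>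
     (\<forall>U x. openin T U \<longrightarrow> x \<in> U \<longrightarrow> (\<exists>i. x \<in> B i \<and> B i \<subseteq> U))"

lemma enumerated_baseD:
  assumes "enumerated_base T B"
  shows "openin T (B i)" "openin T U \<Longrightarrow> x \<in> U \<Longrightarrow> \<exists>i. x \<in> B i \<and> B i \<subseteq> U"
  using assms unfolding enumerated_base_def by blast+

lemma second_countable_enumeration:
  assumes "second_countable T"
  obtains B where "enumerated_base T B"
proof -
  obtain \<B> where \<B>: "countable \<B>" "\<forall>V\<in>\<B>. openin T V"
    "\<forall>U x. openin T U \<and> x \<in> U \<longrightarrow> (\<exists>V\<in>\<B>. x \<in> V \<and> V \<subseteq> U)"
    using assms unfolding second_countable_def by auto
  define B where "B = from_nat_into (insert {} \<B>)"
  have r: "range B = insert {} \<B>" unfolding B_def using \<B>(1) by (intro range_from_nat_into) auto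
  have "openin T (B i)" for i
  proof -
    have "B i \<in> insert {} \<B>" using r by blast
    then show ?thesis using \<B>(2) by auto
  qed
  moreover have "\<exists>i. x \<in> B i \<and> B i \<subseteq> U" if U: "openin T U" "x \<in> U" for U x
  proof -
    have "\<exists>V\<in>\<B>. x \<in> V \<and> V \<subseteq> U" using \<B>(3) U by simp
    then obtain V where V: "V \<in> \<B>" "x \<in> V" "V \<subseteq> U" by (elim bexE conjE)
    have "V \<in> range B" unfolding r using V(1) by simp
    then obtain i where "V = B i" by (rule rangeE)
    then show ?thesis using V(2,3) by (intro exI[of _ i]) simp
  qed
  ultimately have "enumerated_base T B" unfolding enumerated_base_def by simp
  then show ?thesis by (rule that)
qed

lemma base_closure_refinement:
  assumes B: "enumerated_base T B"
    and reg: "regular_space T" and U: "openin T U" "x \<in> U"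
  obtains i where "x \<in> B i" "T closure_of (B i) \<subseteq> U"
proof -
  obtain V C where V: "openin T V" "closedin T C" "x \<in> V" "V \<subseteq> C" "C \<subseteq> U"
    using reg U unfolding neighbourhood_base_of_closedin[symmetric] neighbourhood_base_of by metis
  obtain i where i: "x \<in> B i" "B i \<subseteq> V" using enumerated_baseD(2)[OF B, OF V(1,3)] by blast
  have "T closure_of (B i) \<subseteq> C" using i V by (intro closure_of_minimal) auto
  then show ?thesis using that i V by blast
qed

lemma second_countable_prod:
  assumes S: "second_countable S" and T: "second_countable T"
  shows "second_countable (prod_topology S T)"
proof -
  obtain A where A: "enumerated_base S A"
    using second_countable_enumeration[OF S] by metis
  obtain B where B: "enumerated_base T B"
    using second_countable_enumeration[OF T] by metis
  show ?thesis
    unfolding second_countable_def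
  proof (intro exI[of _ "(\<lambda>(i, j). A i \<times> B j) ` UNIV"] conjI ballI allI impI)
    show "countable (range (\<lambda>(i, j). A i \<times> B j))" by simp
    show "openin (prod_topology S T) V" if "V \<in> range (\<lambda>(i, j). A i \<times> B j)" for V
      using that enumerated_baseD(1)[OF A] enumerated_baseD(1)[OF B] by (auto simp: openin_prod_Times_iff)
    fix U z assume "openin (prod_topology S T) U \<and> z \<in> U"
    then obtain V W where VW: "openin S V" "openin T W" "fst z \<in> V" "snd z \<in> W" "V \<times> W \<subseteq> U"
      unfolding openin_prod_topology_alt by (metis prod.collapse)
    obtain i j where "fst z \<in> A i" "A i \<subseteq> V" "snd z \<in> B j" "B j \<subseteq> W" using enumerated_baseD(2)[OF A, OF VW(1,3)] enumerated_baseD(2)[OF B, OF VW(2,4)] by blast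
    then show "\<exists>V\<in>range (\<lambda>(i, j). A i \<times> B j). z \<in> V \<and> V \<subseteq> U"
      using VW(5) by (intro bexI[of _ "A i \<times> B j"]) (auto simp: mem_Times_iff)
  qed
qed

section \<open>Borel sigma fields\<close>

lemma space_borel_of [simp]: "space (borel_of T) = topspace T"
  unfolding borel_of_def by (simp add: space_measure_of_conv)

lemma sets_borel_of: "sets (borel_of T) = sigma_sets (topspace T) {U. openin T U}"
  unfolding borel_of_def by (rule sets_measure_of) (auto dest: openin_subset)

lemma borel_of_open: "openin T U \<Longrightarrow> U \<in> sets (borel_of T)"
  unfolding sets_borel_of by auto

lemma borel_of_closed: "closedin T C \<Longrightarrow> C \<in> sets (borel_of T)"
proof -
  assume C: "closedin T C"
  have "topspace T - (topspace T - C) \<in> sets (borel_of T)"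
    using borel_of_open[of T "topspace T - C"] C by (metis closedin_def sets.compl_sets space_borel_of)
  moreover have "topspace T - (topspace T - C) = C" using closedin_subset[OF C] by auto
  ultimately show ?thesis by simp
qed

lemma measurable_borel_ofI:
  assumes "\<And>w. w \<in> space M \<Longrightarrow> f w \<in> topspace T"
    and "\<And>U. openin T U \<Longrightarrow> {w \<in> space M. f w \<in> U} \<in> sets M"
  shows "f \<in> M \<rightarrow>\<^sub>M borel_of T"
  unfolding borel_of_def
proof (rule measurable_measure_of)
  fix U assume "U \<in> {U. openin T U}"
  then have "{w \<in> space M. f w \<in> U} \<in> sets M" using assms(2) by simp
  moreover have "f -` U \<inter> space M = {w \<in> space M. f w \<in> U}" by auto
  ultimately show "f -` U \<inter> space M \<in> sets M" by simp
qed (use assms(1) in \<open>auto dest: openin_subset\<close>)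

lemma continuous_map_measurable:
  assumes "continuous_map S T f"
  shows "f \<in> borel_of S \<rightarrow>\<^sub>M borel_of T"
  using assms openin_continuous_map_preimage[OF assms]
  by (intro measurable_borel_ofI) (auto intro!: borel_of_open simp: continuous_map_def)

lemma continuous_map_borel_measurable:
  assumes "continuous_map S euclideanreal f"
  shows "f \<in> borel_measurable (borel_of S)"
proof (rule borel_measurableI)
  fix U :: "real set" assume "open U"
  then have "{x \<in> topspace S. f x \<in> U} \<in> sets (borel_of S)"
    by (intro borel_of_open openin_continuous_map_preimage[OF assms]) simp
  moreover have "f -` U \<inter> space (borel_of S) = {x \<in> topspace S. f x \<in> U}" by auto
  ultimately show "f -` U \<inter> space (borel_of S) \<in> sets (borel_of S)" by simp
qed

text \<open>
  An open set of the product is a countable union of rectangles of basic open sets.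
\<close>

lemma sets_borel_of_prod:
  assumes S: "second_countable S" and T: "second_countable T"
  shows "sets (borel_of (prod_topology S T)) = sets (borel_of S \<Otimes>\<^sub>M borel_of T)"
proof
  obtain A where A: "enumerated_base S A"
    using second_countable_enumeration[OF S] by metis
  obtain B where B: "enumerated_base T B"
    using second_countable_enumeration[OF T] by metis
  have "U \<in> sets (borel_of S \<Otimes>\<^sub>M borel_of T)" if U: "openin (prod_topology S T) U" for U
  proof -
    have "U = (\<Union>p\<in>{p. A (fst p) \<times> B (snd p) \<subseteq> U}. A (fst p) \<times> B (snd p))"
    proof (intro equalityI subsetI)
      fix z assume "z \<in> U"
      then obtain V W where VW: "openin S V" "openin T W" "fst z \<in> V" "snd z \<in> W" "V \<times> W \<subseteq> U"
        using U unfolding openin_prod_topology_alt by (metis prod.collapse)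
      obtain i j where ij: "fst z \<in> A i" "A i \<subseteq> V" "snd z \<in> B j" "B j \<subseteq> W" using enumerated_baseD(2)[OF A, OF VW(1,3)] enumerated_baseD(2)[OF B, OF VW(2,4)] by blast
      then have "A i \<times> B j \<subseteq> U" using VW(5) by blast
      then show "z \<in> (\<Union>p\<in>{p. A (fst p) \<times> B (snd p) \<subseteq> U}. A (fst p) \<times> B (snd p))"
        using ij by (intro UN_I[of "(i, j)"]) (auto simp: mem_Times_iff)
    qed auto
    moreover have "(\<Union>p\<in>{p. A (fst p) \<times> B (snd p) \<subseteq> U}. A (fst p) \<times> B (snd p)) \<in> sets (borel_of S \<Otimes>\<^sub>M borel_of T)"
      using enumerated_baseD(1)[OF A] enumerated_baseD(1)[OF B] by (intro sets.countable_UN'') (auto intro!: pair_measureI borel_of_open)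
    ultimately show ?thesis by simp
  qed
  then show "sets (borel_of (prod_topology S T)) \<subseteq> sets (borel_of S \<Otimes>\<^sub>M borel_of T)"
    unfolding sets_borel_of[of "prod_topology S T"]
    using sets.sigma_sets_subset[of "{U. openin (prod_topology S T) U}" "borel_of S \<Otimes>\<^sub>M borel_of T"]
    by (auto simp: space_pair_measure)
  have m: "(\<lambda>z. z) \<in> borel_of (prod_topology S T) \<rightarrow>\<^sub>M borel_of S \<Otimes>\<^sub>M borel_of T"
    by (rule measurable_pair) (auto simp: o_def intro!: continuous_map_measurable continuous_map_fst continuous_map_snd)
  have "X \<in> sets (borel_of (prod_topology S T))" if "X \<in> sets (borel_of S \<Otimes>\<^sub>M borel_of T)" for X
    using measurable_sets[OF m that] sets.sets_into_space[OF that] by (simp add: space_pair_measure Int_absorb2)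
  then show "sets (borel_of S \<Otimes>\<^sub>M borel_of T) \<subseteq> sets (borel_of (prod_topology S T))" by blast
qed

section \<open>Spaces of continuous paths\<close>

lemma pathsD:
  assumes "\<omega> \<in> paths T"
  shows "t \<ge> 0 \<Longrightarrow> \<omega> t \<in> topspace T" "continuous_map (top_of_set {0..}) T \<omega>" "\<omega> \<in> extensional {0..}"
  using assms unfolding paths_def by (auto simp: continuous_map_def)

lemma openin_compact_open:
  assumes "compact C" "C \<subseteq> {0..}" "openin T U"
  shows "openin (compact_open T) {\<omega> \<in> paths T. \<omega> ` C \<subseteq> U}"
  unfolding compact_open_def using assms by (auto intro!: topology_generated_by_Basis)

lemma topspace_compact_open [simp]: "topspace (compact_open T) = paths T"
proof
  have "openin (compact_open T) {\<omega> \<in> paths T. \<omega> ` {} \<subseteq> {}}" by (rule openin_compact_open) auto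
  then show "paths T \<subseteq> topspace (compact_open T)" using openin_subset by fastforce
  show "topspace (compact_open T) \<subseteq> paths T"
    unfolding compact_open_def topology_generated_by_topspace by auto
qed

lemma space_path_borel [simp]: "space (path_borel T) = paths T"
  unfolding path_borel_def by simp

lemma coordinate_measurable:
  assumes "t \<ge> 0" shows "(\<lambda>\<omega>. \<omega> t) \<in> path_borel T \<rightarrow>\<^sub>M borel_of T"
proof (rule measurable_borel_ofI)
  show "w t \<in> topspace T" if "w \<in> space (path_borel T)" for w using that assms by (auto intro: pathsD)
  fix U assume "openin T U"
  then have "openin (compact_open T) {\<omega> \<in> paths T. \<omega> ` {t} \<subseteq> U}" using assms by (intro openin_compact_open) auto
  then show "{w \<in> space (path_borel T). w t \<in> U} \<in> sets (path_borel T)"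
    using borel_of_open by (fastforce simp: path_borel_def)
qed

lemma map_path_simps: "t \<ge> 0 \<Longrightarrow> map_path h \<omega> t = h (\<omega> t)"
  by (simp add: map_path_def)

lemma path_shift_simps: "t \<ge> 0 \<Longrightarrow> path_shift s \<omega> t = \<omega> (t + s)"
  by (simp add: path_shift_def)

lemma map_path_paths:
  assumes "continuous_map T T' h" "\<omega> \<in> paths T"
  shows "map_path h \<omega> \<in> paths T'"
proof -
  have "continuous_map (top_of_set {0..}) T' (h \<circ> \<omega>)"
    by (rule continuous_map_compose[OF pathsD(2)[OF assms(2)] assms(1)])
  then have "continuous_map (top_of_set {0..}) T' (map_path h \<omega>)"
    by (rule continuous_map_eq) (simp add: map_path_def)
  then show ?thesis by (simp add: paths_def map_path_def)
qed

lemma path_shift_paths: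
  assumes "s \<ge> 0" "\<omega> \<in> paths T"
  shows "path_shift s \<omega> \<in> paths T"
proof -
  have "continuous_map (top_of_set {0::real..}) (top_of_set {0..}) (\<lambda>t. t + s)"
    using assms(1) by (auto intro!: continuous_intros)
  from continuous_map_compose[OF this pathsD(2)[OF assms(2)]]
  have "continuous_map (top_of_set {0..}) T (path_shift s \<omega>)"
    by (rule continuous_map_eq) (simp add: path_shift_def)
  then show ?thesis by (simp add: paths_def path_shift_def)
qed

text \<open>
  Composition with a continuous map is continuous for the compact-open topologies: the preimage of
  a subbasic set is again subbasic.
\<close>

lemma map_path_measurable:
  assumes h: "continuous_map T T' h"
  shows "map_path h \<in> path_borel T \<rightarrow>\<^sub>M path_borel T'"
proof -
  have "continuous_map (compact_open T) (compact_open T') (map_path h)"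
    unfolding compact_open_def[of T']
  proof (rule continuous_on_generated_topo)
    fix X assume "X \<in> {{\<omega> \<in> paths T'. \<omega> ` C \<subseteq> U} | C U. compact C \<and> C \<subseteq> {0..} \<and> openin T' U}"
    then obtain C U where X: "X = {\<omega> \<in> paths T'. \<omega> ` C \<subseteq> U}" "compact C" "C \<subseteq> {0..}" "openin T' U" by blast
    have "map_path h -` X \<inter> topspace (compact_open T) = {\<omega> \<in> paths T. \<omega> ` C \<subseteq> {x \<in> topspace T. h x \<in> U}}"
      using X(3) map_path_paths[OF h] pathsD(1)[of _ T] by (fastforce simp: X(1) map_path_simps subset_iff image_subset_iff)
    moreover have "openin (compact_open T) \<dots>"
      using X openin_continuous_map_preimage[OF h X(4)] by (intro openin_compact_open) auto
    ultimately show "openin (compact_open T) (map_path h -` X \<inter> topspace (compact_open T))" by simp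
  next
    show "map_path h ` topspace (compact_open T) \<subseteq> \<Union> {{\<omega> \<in> paths T'. \<omega> ` C \<subseteq> U} | C U. compact C \<and> C \<subseteq> {0..} \<and> openin T' U}"
    proof (rule image_subsetI)
      fix \<omega> assume "\<omega> \<in> topspace (compact_open T)"
      then have "map_path h \<omega> \<in> topspace (compact_open T')" using map_path_paths[OF h] by simp
      then show "map_path h \<omega> \<in> \<Union> {{\<omega> \<in> paths T'. \<omega> ` C \<subseteq> U} | C U. compact C \<and> C \<subseteq> {0..} \<and> openin T' U}"
        unfolding compact_open_def topology_generated_by_topspace .
    qed
  qed
  then show ?thesis unfolding path_borel_def by (rule continuous_map_measurable)
qed

section \<open>Sigma fields generated by processes\<close>

lemma space_process_sigma [simp]: "space (process_sigma \<Omega> N Z I) = \<Omega>"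
  unfolding process_sigma_def by (simp add: space_measure_of_conv)

lemma sets_process_sigma:
  "sets (process_sigma \<Omega> N Z I) = sigma_sets \<Omega> {Z s -` B \<inter> \<Omega> | s B. s \<in> I \<and> B \<in> sets N}"
  unfolding process_sigma_def by (rule sets_measure_of) auto

lemma process_sigma_coordinate:
  assumes "s \<in> I" "\<And>\<omega>. \<omega> \<in> \<Omega> \<Longrightarrow> Z s \<omega> \<in> space N"
  shows "Z s \<in> process_sigma \<Omega> N Z I \<rightarrow>\<^sub>M N"
  using assms by (intro measurableI) (auto simp: sets_process_sigma)

lemma process_sigma_least:
  assumes "space M = \<Omega>" "\<And>s. s \<in> I \<Longrightarrow> Z s \<in> M \<rightarrow>\<^sub>M N"
  shows "sets (process_sigma \<Omega> N Z I) \<subseteq> sets M"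
  unfolding sets_process_sigma assms(1)[symmetric]
  using assms(2) by (intro sets.sigma_sets_subset) (auto intro: measurable_sets)

lemma process_sigma_mono:
  assumes "I \<subseteq> J" shows "sets (process_sigma \<Omega> N Z I) \<subseteq> sets (process_sigma \<Omega> N Z J)"
  unfolding sets_process_sigma using assms by (intro sigma_sets_mono') auto

lemma measurable_process_sigmaI:
  assumes "\<And>w. w \<in> space M \<Longrightarrow> f w \<in> \<Omega>" "\<And>s. s \<in> I \<Longrightarrow> (\<lambda>w. Z s (f w)) \<in> M \<rightarrow>\<^sub>M N"
  shows "f \<in> M \<rightarrow>\<^sub>M process_sigma \<Omega> N Z I"
  unfolding process_sigma_def
proof (rule measurable_measure_of)
  fix y assume "y \<in> {Z s -` B \<inter> \<Omega> | s B. s \<in> I \<and> B \<in> sets N}"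
  then obtain s B where y: "s \<in> I" "B \<in> sets N" "y = Z s -` B \<inter> \<Omega>" by blast
  have "f -` y \<inter> space M = (\<lambda>w. Z s (f w)) -` B \<inter> space M" using assms(1) by (auto simp: y(3))
  then show "f -` y \<inter> space M \<in> sets M" using measurable_sets[OF assms(2)[OF y(1)] y(2)] by simp
qed (use assms(1) in auto)

abbreviation coord_sigma :: "'a topology \<Rightarrow> real set \<Rightarrow> (real \<Rightarrow> 'a) measure" where
  "coord_sigma T I \<equiv> process_sigma (paths T) (borel_of T) (\<lambda>t \<omega>. \<omega> t) I"

lemma coord_sigma_path_borel:
  assumes "I \<subseteq> {0..}" shows "sets (coord_sigma T I) \<subseteq> sets (path_borel T)"
  using assms by (intro process_sigma_least) (auto intro!: coordinate_measurable)

lemma coord_sigma_coordinate: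
  assumes "s \<in> I" "s \<ge> 0" shows "(\<lambda>\<omega>. \<omega> s) \<in> coord_sigma T I \<rightarrow>\<^sub>M borel_of T"
  using assms by (intro process_sigma_coordinate[where Z = "\<lambda>t \<omega>. \<omega> t"]) (auto intro: pathsD)

section \<open>Invariant sigma fields\<close>

lemma InvD:
  assumes "A \<in> Inv T N Z"
  shows "A \<subseteq> paths T" "t \<ge> 0 \<Longrightarrow> A \<in> sets (process_sigma (paths T) N Z {t..})"
    "s \<ge> 0 \<Longrightarrow> \<omega> \<in> paths T \<Longrightarrow> path_shift s \<omega> \<in> A \<longleftrightarrow> \<omega> \<in> A"
proof -
  have "A \<in> sets (process_sigma (paths T) N Z {0..})" using assms by (auto simp: Inv_def)
  then show "A \<subseteq> paths T" using sets.sets_into_space by fastforce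
  show "t \<ge> 0 \<Longrightarrow> A \<in> sets (process_sigma (paths T) N Z {t..})" using assms by (auto simp: Inv_def)
  have "path_shift s \<omega> = \<omega>" if "s = 0" "\<omega> \<in> paths T"
    using pathsD(3)[OF that(2)] that(1) by (auto simp: path_shift_def fun_eq_iff extensional_def)
  moreover have "path_shift s -` A \<inter> paths T = A" if "s > 0"
    using assms that by (auto simp: Inv_def)
  ultimately show "path_shift s \<omega> \<in> A \<longleftrightarrow> \<omega> \<in> A" if "s \<ge> 0" "\<omega> \<in> paths T"
    using that by (cases "s = 0") auto
qed

lemma InvI:
  assumes "\<And>t. t \<ge> 0 \<Longrightarrow> A \<in> sets (process_sigma (paths T) N Z {t..})"
    and "\<And>s \<omega>. s > 0 \<Longrightarrow> \<omega> \<in> paths T \<Longrightarrow> path_shift s \<omega> \<in> A \<longleftrightarrow> \<omega> \<in> A"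
  shows "A \<in> Inv T N Z"
proof -
  have "A \<in> sets (process_sigma (paths T) N Z {0..})" using assms by auto
  then have "A \<subseteq> paths T" using sets.sets_into_space by fastforce
  then have "path_shift s -` A \<inter> paths T = A" if "s > 0" for s using assms(2)[OF that] by auto
  then show ?thesis using assms(1) by (auto simp: Inv_def)
qed

lemma Inv_sigma_algebra: "sigma_algebra (paths T) (Inv T N Z)"
  unfolding sigma_algebra_iff2
proof (intro conjI ballI allI impI)
  show "Inv T N Z \<subseteq> Pow (paths T)" using InvD(1) by fast
  show "{} \<in> Inv T N Z" by (rule InvI) auto
  show "paths T - A \<in> Inv T N Z" if "A \<in> Inv T N Z" for A
  proof (rule InvI)
    show "paths T - A \<in> sets (process_sigma (paths T) N Z {t..})" if "t \<ge> 0" for t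
      using sets.compl_sets[OF InvD(2)[OF \<open>A \<in> Inv T N Z\<close> that]] by simp
    show "path_shift s \<omega> \<in> paths T - A \<longleftrightarrow> \<omega> \<in> paths T - A" if "s > 0" "\<omega> \<in> paths T" for s \<omega>
      using path_shift_paths[of s \<omega> T] InvD(3)[OF \<open>A \<in> Inv T N Z\<close>, of s \<omega>] that by auto
  qed
  fix A :: "nat \<Rightarrow> (real \<Rightarrow> 'a) set" assume A: "range A \<subseteq> Inv T N Z"
  show "(\<Union>i. A i) \<in> Inv T N Z"
  proof (rule InvI)
    show "(\<Union>i. A i) \<in> sets (process_sigma (paths T) N Z {t..})" if "t \<ge> 0" for t
      using A that by (intro sets.countable_nat_UN) (auto intro: InvD(2))
    show "path_shift s \<omega> \<in> (\<Union>i. A i) \<longleftrightarrow> \<omega> \<in> (\<Union>i. A i)" if "s > 0" "\<omega> \<in> paths T" for s \<omega>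
      using A InvD(3)[of _ T N Z s \<omega>] that by (auto simp: subset_iff image_iff)
  qed
qed

definition inv_sigma where "inv_sigma T N Z = sigma (paths T) (Inv T N Z)"

lemma inv_sigma_simps [simp]: "space (inv_sigma T N Z) = paths T" "sets (inv_sigma T N Z) = Inv T N Z"
proof -
  show "space (inv_sigma T N Z) = paths T" by (simp add: inv_sigma_def space_measure_of_conv)
  have "Inv T N Z \<subseteq> Pow (paths T)" using InvD(1) by fast
  then show "sets (inv_sigma T N Z) = Inv T N Z"
    unfolding inv_sigma_def by (simp add: sets_measure_of sigma_algebra.sigma_sets_eq[OF Inv_sigma_algebra])
qed

lemma Inv_mono:
  assumes "\<And>t. t \<ge> 0 \<Longrightarrow> sets (process_sigma (paths T) N Z {t..}) \<subseteq> sets (process_sigma (paths T) N' Z' {t..})"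
  shows "Inv T N Z \<subseteq> Inv T N' Z'"
  using assms unfolding Inv_def by (intro Collect_mono conj_mono imp_refl impI INT_I) auto

lemma Inv_factor_mono:
  assumes p: "continuous_map T S p"
  shows "Inv T (borel_of S) (\<lambda>t \<omega>. p (\<omega> t)) \<subseteq> Inv T (borel_of T) (\<lambda>t \<omega>. \<omega> t)"
proof (rule Inv_mono, rule process_sigma_least)
  fix t s :: real assume "t \<ge> 0" "s \<in> {t..}"
  then show "(\<lambda>\<omega>. p (\<omega> s)) \<in> coord_sigma T {t..} \<rightarrow>\<^sub>M borel_of S"
    by (intro measurable_compose[OF coord_sigma_coordinate continuous_map_measurable[OF p]]) auto
qed simp

lemma continuous_path_closed_rational:
  assumes z: "continuous_map (top_of_set {0..}) S z" and C: "closedin S C"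
    and n: "(n::real) \<ge> 0" and q: "\<And>q. q \<in> \<rat> \<Longrightarrow> q \<ge> n \<Longrightarrow> z q \<in> C" and t: "t \<ge> n"
  shows "z t \<in> C"
proof -
  have "closedin (top_of_set {0..}) {t \<in> topspace (top_of_set {0..}). z t \<in> C}"
    by (rule closedin_continuous_map_preimage[OF z C])
  then have "closedin (top_of_set {0..}) {t \<in> {0..}. z t \<in> C}" by simp
  then have cl: "closed {t \<in> {0..}. z t \<in> C}" by (rule closedin_closed_trans) simp
  show ?thesis
  proof (rule ccontr)
    assume "z t \<notin> C"
    then have "t \<in> - {t \<in> {0..}. z t \<in> C}" by simp
    then obtain e where e: "e > 0" "ball t e \<subseteq> - {t \<in> {0..}. z t \<in> C}"
      by (rule openE[OF open_Compl[OF cl]])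
    obtain r where r: "r \<in> \<rat>" "t < r" "r < t + e" using Rats_dense_in_real[of t "t + e"] e(1) by auto
    then have "r \<in> ball t e" by (simp add: dist_real_def)
    then have "r \<notin> {t \<in> {0..}. z t \<in> C}" using e(2) by blast
    moreover have "r \<ge> 0" "z r \<in> C" using r t n q[of r] by auto
    ultimately show False by simp
  qed
qed

lemma path_image_continuous:
  assumes "continuous_map T S p" "\<omega> \<in> paths T"
  shows "continuous_map (top_of_set {0..}) S (\<lambda>t. p (\<omega> t))"
  using continuous_map_compose[OF pathsD(2)[OF assms(2)] assms(1)] by (simp add: o_def)

text \<open>
  All invariant events below are built from these. Whether a path stays in a closed set at late times
  is visible at rational times, hence in the tail sigma field, and is not changed by a shift.
\<close>

lemma eventually_closed_Inv:
  assumes p: "continuous_map T S p" and C: "closedin S C"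
  shows "{\<omega> \<in> paths T. \<forall>\<^sub>F t in at_top. p (\<omega> t) \<in> C} \<in> Inv T (borel_of S) (\<lambda>t \<omega>. p (\<omega> t))" (is "?E \<in> _")
proof (rule InvI)
  fix t0 :: real assume t0: "t0 \<ge> 0"
  let ?N = "process_sigma (paths T) (borel_of S) (\<lambda>t \<omega>. p (\<omega> t)) {t0..}"
  have eq: "?E = (\<Union>n. \<Inter>q\<in>\<rat> \<inter> {real n + t0..}. (\<lambda>\<omega>. p (\<omega> q)) -` C \<inter> paths T)"
  proof (intro equalityI subsetI)
    fix \<omega> assume "\<omega> \<in> ?E"
    then obtain a where \<omega>: "\<omega> \<in> paths T" "\<And>t. t \<ge> a \<Longrightarrow> p (\<omega> t) \<in> C" by (auto simp: eventually_at_top_linorder)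
    obtain n :: nat where "a \<le> real n" using real_arch_simple by blast
    then show "\<omega> \<in> (\<Union>n. \<Inter>q\<in>\<rat> \<inter> {real n + t0..}. (\<lambda>\<omega>. p (\<omega> q)) -` C \<inter> paths T)"
      using \<omega> t0 by (intro UN_I[of n]) auto
  next
    fix \<omega> assume "\<omega> \<in> (\<Union>n. \<Inter>q\<in>\<rat> \<inter> {real n + t0..}. (\<lambda>\<omega>. p (\<omega> q)) -` C \<inter> paths T)"
    then obtain n where "\<omega> \<in> (\<Inter>q\<in>\<rat> \<inter> {real n + t0..}. (\<lambda>\<omega>. p (\<omega> q)) -` C \<inter> paths T)" by (rule UN_E)
    from INT_D[OF this] have n: "\<And>q. q \<in> \<rat> \<Longrightarrow> q \<ge> real n + t0 \<Longrightarrow> p (\<omega> q) \<in> C \<and> \<omega> \<in> paths T" by auto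
    obtain q where "q \<in> \<rat>" "real n + t0 < q" using Rats_dense_in_real[of "real n + t0" "real n + t0 + 1"] by auto
    then have \<omega>: "\<omega> \<in> paths T" using n[of q] by simp
    have "p (\<omega> t) \<in> C" if "t \<ge> real n + t0" for t
      by (rule continuous_path_closed_rational[OF path_image_continuous[OF p \<omega>] C, of "real n + t0"]) (use n t0 that in auto)
    then show "\<omega> \<in> ?E" using \<omega> by (auto simp: eventually_at_top_linorder)
  qed
  have mem: "(\<Inter>q\<in>\<rat> \<inter> {real n + t0..}. (\<lambda>\<omega>. p (\<omega> q)) -` C \<inter> paths T) \<in> sets ?N" for n
  proof (rule sets.countable_INT')
    show "countable (\<rat> \<inter> {real n + t0..})" using countable_rat by blast
    show "(\<lambda>q. (\<lambda>\<omega>. p (\<omega> q)) -` C \<inter> paths T) ` (\<rat> \<inter> {real n + t0..}) \<subseteq> sets ?N"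
    proof (rule image_subsetI)
      fix q assume that: "q \<in> \<rat> \<inter> {real n + t0..}"
      show "(\<lambda>\<omega>. p (\<omega> q)) -` C \<inter> paths T \<in> sets ?N"
    proof -
      have "q \<in> {t0..}" using that by auto
      then show ?thesis unfolding sets_process_sigma using borel_of_closed[OF C] by (intro sigma_sets.Basic) blast
      qed
    qed
    obtain q where "q \<in> \<rat>" "real n + t0 < q" using Rats_dense_in_real[of "real n + t0" "real n + t0 + 1"] by auto
    then show "\<rat> \<inter> {real n + t0..} \<noteq> {}" by force
  qed
  show "?E \<in> sets ?N" unfolding eq
    by (rule sets.countable_UN, rule image_subsetI, rule mem)
next
  fix s :: real and \<omega> assume s: "s > 0" and \<omega>: "\<omega> \<in> paths T"
  have "(\<forall>\<^sub>F t in at_top. p (path_shift s \<omega> t) \<in> C) \<longleftrightarrow> (\<forall>\<^sub>F t in at_top. p (\<omega> (t + s)) \<in> C)"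
    by (rule eventually_cong) (auto intro: eventually_mono[OF eventually_ge_at_top[of 0]] simp: path_shift_simps)
  also have "\<dots> \<longleftrightarrow> (\<forall>\<^sub>F t in at_top. p (\<omega> t) \<in> C)"
  proof
    assume "\<forall>\<^sub>F t in at_top. p (\<omega> (t + s)) \<in> C"
    then obtain a where a: "\<And>t. t \<ge> a \<Longrightarrow> p (\<omega> (t + s)) \<in> C" by (auto simp: eventually_at_top_linorder)
    show "\<forall>\<^sub>F t in at_top. p (\<omega> t) \<in> C"
      unfolding eventually_at_top_linorder using a[of "_ - s"] by (intro exI[of _ "a + s"]) auto
  next
    assume "\<forall>\<^sub>F t in at_top. p (\<omega> t) \<in> C"
    then obtain a where a: "\<And>t. t \<ge> a \<Longrightarrow> p (\<omega> t) \<in> C" by (auto simp: eventually_at_top_linorder)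
    show "\<forall>\<^sub>F t in at_top. p (\<omega> (t + s)) \<in> C"
      unfolding eventually_at_top_linorder using a s by (intro exI[of _ a]) auto
  qed
  finally show "path_shift s \<omega> \<in> ?E \<longleftrightarrow> \<omega> \<in> ?E" using path_shift_paths[of s \<omega> T] s \<omega> by auto
qed

section \<open>Limits at infinity of paths\<close>

text \<open>
  Divergent paths get a fixed value. The limit is then a function on the whole path space, and the
  events that it defines are invariant exactly and not only almost surely.
\<close>

definition end_limit :: "'b topology \<Rightarrow> (real \<Rightarrow> 'b) \<Rightarrow> 'b" where
  "end_limit S z = (if \<exists>l. limitin S z l at_top then SOME l. limitin S z l at_top else SOME l. l \<in> topspace S)"

lemma end_limit_eq:
  assumes "Hausdorff_space S" "limitin S z l at_top"
  shows "end_limit S z = l"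
proof -
  have "limitin S z (end_limit S z) at_top" unfolding end_limit_def using assms(2) by (auto intro: someI)
  then show ?thesis using limitin_Hausdorff_unique[OF _ assms(2) _ assms(1)] by simp
qed

text \<open>
  A path converges iff it ends up in a compact set and has a single cluster point. The second condition
  expresses the latter: a path that returns to \<open>B j\<close> again and again must stay in the closure of any
  \<open>B k\<close> that contains the closure of \<open>B j\<close>. Only closed sets are involved, so that
  \<open>eventually_closed_Inv\<close> applies.
\<close>

lemma limit_exists_iff:
  assumes H: "Hausdorff_space S" and L: "locally_compact_space S"
    and B: "enumerated_base S B"
  shows "(\<exists>l. limitin S z l at_top) \<longleftrightarrow>
    (\<exists>i. compactin S (S closure_of B i) \<and> (\<forall>\<^sub>F t in at_top. z t \<in> S closure_of B i)) \<and>
    (\<forall>j k. S closure_of B j \<subseteq> B k \<longrightarrow> (\<forall>\<^sub>F t in at_top. z t \<in> S closure_of B k) \<or>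
       (\<forall>\<^sub>F t in (at_top :: real filter). z t \<in> topspace S - B j))" (is "?L \<longleftrightarrow> ?R1 \<and> ?R2")
proof -
  have reg: "regular_space S" by (rule locally_compact_Hausdorff_imp_regular_space[OF L H])
  have sub: "B i \<subseteq> S closure_of B i" for i using closure_of_subset[OF openin_subset[OF enumerated_baseD(1)[OF B]]] .
  note refine = base_closure_refinement[OF B reg] and Bopen = enumerated_baseD(1)[OF B]
  show ?thesis
  proof (intro iffI conjI)
    assume ?L
    then obtain l where l: "limitin S z l at_top" by blast
    then have lS: "l \<in> topspace S" and ev: "\<And>U. openin S U \<Longrightarrow> l \<in> U \<Longrightarrow> \<forall>\<^sub>F t in at_top. z t \<in> U"
      by (auto simp: limitin_def)
    obtain U K where UK: "openin S U" "compactin S K" "l \<in> U" "U \<subseteq> K" using L lS unfolding locally_compact_space_def by blast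
    obtain i where i: "l \<in> B i" "S closure_of (B i) \<subseteq> U" using refine[OF UK(1,3)] by blast
    have "compactin S (S closure_of (B i))" using closed_compactin[OF UK(2)] i UK(4) by (metis closedin_closure_of order_trans)
    moreover have "\<forall>\<^sub>F t in at_top. z t \<in> S closure_of B i"
      using ev[OF enumerated_baseD(1)[OF B] i(1)] by (rule eventually_mono) (use sub in blast)
    ultimately show ?R1 by blast
    show ?R2
    proof (intro allI impI)
      fix j k assume jk: "S closure_of B j \<subseteq> B k"
      show "(\<forall>\<^sub>F t in at_top. z t \<in> S closure_of B k) \<or> (\<forall>\<^sub>F t in at_top. z t \<in> topspace S - B j)"
      proof (cases "l \<in> B k")
        case True
        have "\<forall>\<^sub>F t in at_top. z t \<in> S closure_of B k"
          using ev[OF enumerated_baseD(1)[OF B] True] by (rule eventually_mono) (use sub in blast)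
        then show ?thesis ..
      next
        case False
        then have "l \<in> topspace S - S closure_of B j" using jk lS by blast
        then have "\<forall>\<^sub>F t in at_top. z t \<in> topspace S - S closure_of B j" by (intro ev) auto
        then have "\<forall>\<^sub>F t in at_top. z t \<in> topspace S - B j" by (rule eventually_mono) (use sub in blast)
        then show ?thesis ..
      qed
    qed
  next
    assume R: "?R1 \<and> ?R2"
    then obtain i where i: "compactin S (S closure_of B i)" "\<forall>\<^sub>F t in at_top. z t \<in> S closure_of B i" by blast
    have "\<exists>l\<in>S closure_of B i. \<forall>U. openin S U \<longrightarrow> l \<in> U \<longrightarrow> \<not> (\<forall>\<^sub>F t in at_top. z t \<notin> U)"
    proof (rule ccontr)
      assume "\<not> ?thesis"
      then have *: "\<forall>l\<in>S closure_of B i. \<exists>U. openin S U \<and> l \<in> U \<and> (\<forall>\<^sub>F t in at_top. z t \<notin> U)" by blast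
      let ?\<U> = "{U. openin S U \<and> (\<forall>\<^sub>F t in at_top. z t \<notin> U)}"
      have "S closure_of B i \<subseteq> \<Union> ?\<U>" using * by blast
      then obtain \<F> where \<F>: "finite \<F>" "\<F> \<subseteq> ?\<U>" "S closure_of B i \<subseteq> \<Union>\<F>"
        using compactinD[OF i(1), of ?\<U>] by blast
      have "\<forall>\<^sub>F t in at_top. \<forall>U\<in>\<F>. z t \<notin> U" using \<F> by (intro eventually_ball_finite) auto
      then have "\<forall>\<^sub>F t in (at_top :: real filter). False" using i(2) by eventually_elim (use \<F>(3) in blast)
      then show False by simp
    qed
    then obtain l where l: "l \<in> S closure_of B i" "\<And>U. openin S U \<Longrightarrow> l \<in> U \<Longrightarrow> \<not> (\<forall>\<^sub>F t in at_top. z t \<notin> U)" by blast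
    have "limitin S z l at_top"
      unfolding limitin_def
    proof (intro conjI allI impI)
      show "l \<in> topspace S" using l(1) by (metis closure_of_subset_topspace subsetD)
      fix U assume U: "openin S U \<and> l \<in> U"
      obtain k where k: "l \<in> B k" "S closure_of (B k) \<subseteq> U" using refine U by metis
      obtain j where j: "l \<in> B j" "S closure_of (B j) \<subseteq> B k" using refine[OF enumerated_baseD(1)[OF B] k(1)] by metis
      have "\<not> (\<forall>\<^sub>F t in at_top. z t \<in> topspace S - B j)"
        using l(2)[OF enumerated_baseD(1)[OF B] j(1)] by (metis (mono_tags, lifting) DiffD2 eventually_mono)
      then have "\<forall>\<^sub>F t in at_top. z t \<in> S closure_of B k" using R j(2) by blast
      then show "\<forall>\<^sub>F t in at_top. z t \<in> U" by (rule eventually_mono) (use k(2) in blast)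
    qed
    then show ?L by blast
  qed
qed

lemma limit_in_open_iff:
  assumes reg: "regular_space S" and l: "limitin S z l at_top"
    and B: "enumerated_base S B"
    and U: "openin S U"
  shows "l \<in> U \<longleftrightarrow> (\<exists>i. S closure_of B i \<subseteq> U \<and> (\<forall>\<^sub>F t in (at_top :: real filter). z t \<in> S closure_of B i))"
proof
  assume "l \<in> U"
  then obtain i where i: "l \<in> B i" "S closure_of (B i) \<subseteq> U" using base_closure_refinement[OF B reg U] by metis
  have "\<forall>\<^sub>F t in at_top. z t \<in> B i" using l i enumerated_baseD(1)[OF B] by (simp add: limitin_def)
  then have "\<forall>\<^sub>F t in at_top. z t \<in> S closure_of B i"
    by (rule eventually_mono) (use closure_of_subset[OF openin_subset[OF enumerated_baseD(1)[OF B]]] in blast)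
  then show "\<exists>i. S closure_of B i \<subseteq> U \<and> (\<forall>\<^sub>F t in at_top. z t \<in> S closure_of B i)" using i by blast
next
  assume "\<exists>i. S closure_of B i \<subseteq> U \<and> (\<forall>\<^sub>F t in at_top. z t \<in> S closure_of B i)"
  then obtain i where i: "S closure_of B i \<subseteq> U" "\<forall>\<^sub>F t in at_top. z t \<in> S closure_of B i" by blast
  have "l \<in> S closure_of B i"
    by (rule limitin_closedin[OF l _ i(2)]) auto
  then show "l \<in> U" using i by blast
qed

lemma limit_exists_Inv:
  assumes H: "Hausdorff_space S" and L: "locally_compact_space S" and SC: "second_countable S"
    and p: "continuous_map T S p"
  shows "{\<omega> \<in> paths T. \<exists>l. limitin S (\<lambda>t. p (\<omega> t)) l at_top} \<in> Inv T (borel_of S) (\<lambda>t \<omega>. p (\<omega> t))"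
proof -
  obtain B where B: "enumerated_base S B"
    using second_countable_enumeration[OF SC] by metis
  let ?I = "inv_sigma T (borel_of S) (\<lambda>t \<omega>. p (\<omega> t))"
  have ev: "{\<omega> \<in> space ?I. \<forall>\<^sub>F t in at_top. p (\<omega> t) \<in> C} \<in> sets ?I" if "closedin S C" for C
    using eventually_closed_Inv[OF p that] by simp
  have [measurable]: "Measurable.pred ?I (\<lambda>\<omega>. \<forall>\<^sub>F t in at_top. p (\<omega> t) \<in> S closure_of B i)"
    "Measurable.pred ?I (\<lambda>\<omega>. \<forall>\<^sub>F t in at_top. p (\<omega> t) \<in> topspace S - B i)" for i
    unfolding pred_def by (rule ev, simp) (rule ev, simp add: enumerated_baseD(1)[OF B] closedin_diff)
  have "Measurable.pred ?I (\<lambda>\<omega>. \<exists>l. limitin S (\<lambda>t. p (\<omega> t)) l at_top)"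
    unfolding limit_exists_iff[OF H L B] by measurable
  then show ?thesis by (simp add: pred_def)
qed

lemma end_limit_measurable:
  assumes H: "Hausdorff_space S" and L: "locally_compact_space S" and SC: "second_countable S"
    and ne: "topspace S \<noteq> {}" and p: "continuous_map T S p"
  shows "(\<lambda>\<omega>. end_limit S (\<lambda>t. p (\<omega> t))) \<in> inv_sigma T (borel_of S) (\<lambda>t \<omega>. p (\<omega> t)) \<rightarrow>\<^sub>M borel_of S"
    (is "?e \<in> ?I \<rightarrow>\<^sub>M _")
proof (rule measurable_borel_ofI)
  obtain B where B: "enumerated_base S B"
    using second_countable_enumeration[OF SC] by metis
  have reg: "regular_space S" by (rule locally_compact_Hausdorff_imp_regular_space[OF L H])
  let ?d = "SOME l. l \<in> topspace S"
  have d: "?d \<in> topspace S" using ne by (meson ex_in_conv someI_ex)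
  let ?ex = "\<lambda>\<omega>. \<exists>l. limitin S (\<lambda>t. p (\<omega> t)) l at_top"
  have ev: "{\<omega> \<in> space ?I. \<forall>\<^sub>F t in at_top. p (\<omega> t) \<in> C} \<in> sets ?I" if "closedin S C" for C
    using eventually_closed_Inv[OF p that] by simp
  have [measurable]: "Measurable.pred ?I (\<lambda>\<omega>. \<forall>\<^sub>F t in at_top. p (\<omega> t) \<in> S closure_of B i)" for i
    unfolding pred_def by (rule ev) simp
  have [measurable]: "Measurable.pred ?I ?ex"
    using limit_exists_Inv[OF H L SC p] by (simp add: pred_def)
  show "?e w \<in> topspace S" if "w \<in> space ?I" for w
  proof (cases "?ex w")
    case True
    then obtain l where "limitin S (\<lambda>t. p (w t)) l at_top" by blast
    then show ?thesis using end_limit_eq[OF H] by (metis limitin_topspace)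
  qed (simp add: end_limit_def d)
  fix U assume U: "openin S U"
  have "{w \<in> space ?I. ?e w \<in> U} = {w \<in> space ?I. (?ex w \<and> (\<exists>i. S closure_of B i \<subseteq> U \<and>
      (\<forall>\<^sub>F t in at_top. p (w t) \<in> S closure_of B i))) \<or> (\<not> ?ex w \<and> ?d \<in> U)}"
  proof (intro Collect_cong conj_cong refl)
    fix w
    show "?e w \<in> U \<longleftrightarrow> (?ex w \<and> (\<exists>i. S closure_of B i \<subseteq> U \<and>
      (\<forall>\<^sub>F t in at_top. p (w t) \<in> S closure_of B i))) \<or> (\<not> ?ex w \<and> ?d \<in> U)"
    proof (cases "?ex w")
      case True
      then obtain l where l: "limitin S (\<lambda>t. p (w t)) l at_top" by blast
      show ?thesis using True limit_in_open_iff[OF reg l B U] end_limit_eq[OF H l] by simp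
    qed (simp add: end_limit_def)
  qed
  also have "\<dots> \<in> sets ?I" by measurable
  finally show "{w \<in> space ?I. ?e w \<in> U} \<in> sets ?I" .
qed

section \<open>The Markov property and harmonic functions\<close>

lemma nat_filtration_eq: "t \<ge> 0 \<Longrightarrow> nat_filtration T (ennreal t) = coord_sigma T {0..t}"
  unfolding nat_filtration_def by (rule arg_cong[where f = "process_sigma _ _ _"]) auto

lemma filtration_nat_filtration: "filtration (paths T) (nat_filtration T)"
proof
  show "space (nat_filtration T i) = paths T" for i unfolding nat_filtration_def by simp
  show "sets (nat_filtration T i) \<subseteq> sets (nat_filtration T j)" if "i \<le> j" for i j
    unfolding nat_filtration_def using that by (intro process_sigma_mono) auto
qed

locale markov_family =
  fixes T :: "'a topology" and P :: "'a \<Rightarrow> (real \<Rightarrow> 'a) measure"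
  assumes strong_markov: "strong_markov_family T P"
begin

lemma kernel: "P \<in> borel_of T \<rightarrow>\<^sub>M prob_algebra (path_borel T)"
  using strong_markov unfolding strong_markov_family_def by blast

lemma
  assumes "z \<in> topspace T"
  shows prob_space_P: "prob_space (P z)"
    and sets_P: "sets (P z) = sets (path_borel T)"
    and space_P: "space (P z) = paths T"
proof -
  have "P z \<in> space (prob_algebra (path_borel T))" using measurable_space[OF kernel] assms by simp
  then show "prob_space (P z)" and s: "sets (P z) = sets (path_borel T)" by (auto simp: space_prob_algebra)
  show "space (P z) = paths T" using sets_eq_imp_space_eq[OF s] by simp
qed

lemma Inv_sets_P:
  assumes "A \<in> Inv T (borel_of T) (\<lambda>t \<omega>. \<omega> t)" "z \<in> topspace T"
  shows "A \<in> sets (P z)"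
proof -
  have "A \<in> sets (coord_sigma T {0..})" using InvD(2)[OF assms(1)] by simp
  then show ?thesis using coord_sigma_path_borel[of "{0..}" T] sets_P[OF assms(2)] by auto
qed

lemma coord_sets_P:
  assumes "A \<in> sets (coord_sigma T I)" "I \<subseteq> {0..}" "z \<in> topspace T"
  shows "A \<in> sets (P z)"
  using coord_sigma_path_borel[OF assms(2), of T] sets_P[OF assms(3)] assms(1) by auto

text \<open>
  The strong Markov property at a deterministic time. The shift does not appear because \<open>A\<close> is
  invariant.
\<close>

lemma markov_property:
  assumes z: "z \<in> topspace T" and t: "t \<ge> 0" and D: "D \<in> sets (coord_sigma T {0..t})"
    and A: "A \<in> Inv T (borel_of T) (\<lambda>t \<omega>. \<omega> t)"
  shows "emeasure (P z) (D \<inter> A) = (\<integral>\<^sup>+ \<omega>. indicator D \<omega> * emeasure (P (\<omega> t)) A \<partial>P z)"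
proof -
  interpret filtration "paths T" "nat_filtration T" by (rule filtration_nat_filtration)
  let ?\<tau> = "\<lambda>\<omega>::real \<Rightarrow> 'a. ennreal t"
  have st: "stopping_time (nat_filtration T) ?\<tau>" by (rule stopping_time_const)
  have Dp: "D \<in> sets (pre_sigma ?\<tau>)"
  proof (rule sets_pre_sigmaI[OF st])
    fix u
    show "{\<omega> \<in> D. ennreal t \<le> u} \<in> sets (nat_filtration T u)"
      using D sets_F_mono[of "ennreal t" u] by (cases "ennreal t \<le> u") (auto simp: nat_filtration_eq[OF t])
  qed
  have "A \<in> sets (path_borel T)" using Inv_sets_P[OF A z] sets_P[OF z] by simp
  then have "emeasure (P z) {\<omega>\<in>D. ?\<tau> \<omega> < \<infinity> \<and> path_shift (enn2real (?\<tau> \<omega>)) \<omega> \<in> A} =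
     (\<integral>\<^sup>+ \<omega>. indicator {\<omega>\<in>D. ?\<tau> \<omega> < \<infinity>} \<omega> * emeasure (P (\<omega> (enn2real (?\<tau> \<omega>)))) A \<partial>P z)"
    using strong_markov z st Dp unfolding strong_markov_family_def by blast
  moreover have "{\<omega>\<in>D. path_shift t \<omega> \<in> A} = D \<inter> A"
    using InvD(3)[OF A t] sets.sets_into_space[OF D] by auto
  ultimately show ?thesis using t by simp
qed

lemma measurable_prob_Inv:
  assumes A: "A \<in> Inv T (borel_of T) (\<lambda>t \<omega>. \<omega> t)"
  shows "(\<lambda>z. measure (P z) A) \<in> borel_measurable (borel_of T)"
proof (cases "topspace T = {}")
  case True then show ?thesis by (simp add: measurable_def)
next
  case False
  then obtain z where z: "z \<in> topspace T" by blast
  have "A \<in> sets (path_borel T)" using Inv_sets_P[OF A z] sets_P[OF z] by simp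
  then show ?thesis
    using measurable_compose[OF measurable_prob_algebraD[OF kernel] measurable_measure_subprob_algebra] by simp
qed

lemma coordinate_P: "z \<in> topspace T \<Longrightarrow> t \<ge> 0 \<Longrightarrow> (\<lambda>\<omega>. \<omega> t) \<in> P z \<rightarrow>\<^sub>M borel_of T"
  using coordinate_measurable[of t T] sets_P measurable_cong_sets by blast

lemma markov_property_measure:
  assumes z: "z \<in> topspace T" and t: "t \<ge> 0" and D: "D \<in> sets (coord_sigma T {0..t})"
    and A: "A \<in> Inv T (borel_of T) (\<lambda>t \<omega>. \<omega> t)"
  shows "measure (P z) (D \<inter> A) = (\<integral>\<omega>. indicator D \<omega> * measure (P (\<omega> t)) A \<partial>P z)"
proof -
  interpret prob_space "P z" by (rule prob_space_P[OF z])
  have D': "D \<in> sets (P z)" by (rule coord_sets_P[OF D _ z]) auto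
  have m: "(\<lambda>\<omega>. measure (P (\<omega> t)) A) \<in> borel_measurable (P z)"
    by (rule measurable_compose[OF coordinate_P[OF z t] measurable_prob_Inv[OF A]])
  have "ennreal (measure (P z) (D \<inter> A)) = emeasure (P z) (D \<inter> A)" by (simp add: emeasure_eq_measure)
  also have "\<dots> = (\<integral>\<^sup>+ \<omega>. indicator D \<omega> * emeasure (P (\<omega> t)) A \<partial>P z)" by (rule markov_property[OF assms])
  also have "\<dots> = (\<integral>\<^sup>+ \<omega>. ennreal (indicator D \<omega> * measure (P (\<omega> t)) A) \<partial>P z)"
  proof (rule nn_integral_cong)
    fix \<omega> assume "\<omega> \<in> space (P z)"
    then have "\<omega> t \<in> topspace T" using pathsD(1) t space_P[OF z] by auto
    then interpret Q: prob_space "P (\<omega> t)" by (rule prob_space_P)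
    show "indicator D \<omega> * emeasure (P (\<omega> t)) A = ennreal (indicator D \<omega> * measure (P (\<omega> t)) A)"
      by (simp add: Q.emeasure_eq_measure indicator_def)
  qed
  also have "\<dots> = ennreal (\<integral>\<omega>. indicator D \<omega> * measure (P (\<omega> t)) A \<partial>P z)"
  proof (rule nn_integral_eq_integral)
    show "integrable (P z) (\<lambda>\<omega>. indicator D \<omega> * measure (P (\<omega> t)) A)"
    proof (rule integrable_const_bound[where B = 1])
      show "AE \<omega> in P z. norm (indicator D \<omega> * measure (P (\<omega> t)) A) \<le> 1"
      proof (rule AE_I2)
        fix \<omega> assume "\<omega> \<in> space (P z)"
        then have "\<omega> t \<in> topspace T" using pathsD(1) t space_P[OF z] by auto
        then interpret Q: prob_space "P (\<omega> t)" by (rule prob_space_P)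
        show "norm (indicator D \<omega> * measure (P (\<omega> t)) A) \<le> 1" by (simp add: indicator_def)
      qed
    qed (use m D' in measurable)
  qed auto
  finally show ?thesis by simp
qed

lemma markov_kernel: "z \<in> topspace T \<Longrightarrow> t \<ge> 0 \<Longrightarrow> (\<lambda>\<omega>. P (\<omega> t)) \<in> P z \<rightarrow>\<^sub>M subprob_algebra (path_borel T)"
  by (rule measurable_compose[OF coordinate_P measurable_prob_algebraD[OF kernel]])

lemma subalgebra_inv_sigma:
  assumes M: "sets M = sets (path_borel T)" and ne: "topspace T \<noteq> {}"
  shows "subalgebra M (inv_sigma T (borel_of T) (\<lambda>t \<omega>. \<omega> t))"
proof -
  obtain z where z: "z \<in> topspace T" using ne by blast
  have "space M = paths T" using sets_eq_imp_space_eq[OF M] by simp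
  then show ?thesis unfolding subalgebra_def using Inv_sets_P[OF _ z] sets_P[OF z] M by auto
qed

text \<open>
  By the Markov property the law started at \<open>z\<close> and the mixture of the laws started at the position
  at time \<open>t\<close> agree on invariant events.
\<close>

lemma harmonic_invariant_expectation:
  assumes F: "F \<in> borel_measurable (inv_sigma T (borel_of T) (\<lambda>t \<omega>. \<omega> t))"
    and bd: "\<And>\<omega>. \<bar>F \<omega>\<bar> \<le> c"
  shows "harmonic T P (\<lambda>z. \<integral>\<omega>. F \<omega> \<partial>P z)"
proof (cases "topspace T = {}")
  case True then show ?thesis by (simp add: harmonic_def measurable_def)
next
  case ne: False
  let ?I = "inv_sigma T (borel_of T) (\<lambda>t \<omega>. \<omega> t)"
  have FP: "F \<in> borel_measurable (path_borel T)"
    using measurable_from_subalg[OF subalgebra_inv_sigma[OF refl ne] F] .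
  have "(\<lambda>z. \<integral>\<omega>. F \<omega> \<partial>P z) \<in> borel_measurable (borel_of T)"
    by (rule measurable_compose[OF measurable_prob_algebraD[OF kernel] integral_measurable_subprob_algebra[OF FP]])
  moreover have "bounded ((\<lambda>z. \<integral>\<omega>. F \<omega> \<partial>P z) ` topspace T)"
    unfolding bounded_iff
  proof (intro exI[of _ c] ballI, clarify)
    fix z assume z: "z \<in> topspace T"
    interpret prob_space "P z" by (rule prob_space_P[OF z])
    have FM: "F \<in> borel_measurable (P z)" using FP measurable_cong_sets[OF sets_P[OF z] refl] by blast
    have "integrable (P z) F" by (rule integrable_const_bound[where B = c]) (use bd FM in auto)
    then have "\<bar>\<integral>\<omega>. F \<omega> \<partial>P z\<bar> \<le> (\<integral>\<omega>. c \<partial>P z)"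
      by (intro order_trans[OF integral_abs_bound integral_mono]) (use bd in auto)
    then show "norm (\<integral>\<omega>. F \<omega> \<partial>P z) \<le> c" by (simp add: prob_space)
  qed
  moreover have "(\<integral>\<omega>. F \<omega> \<partial>P z) = (\<integral>\<omega>. (\<integral>\<omega>'. F \<omega>' \<partial>P (\<omega> t)) \<partial>P z)"
    if t: "t \<ge> 0" and z: "z \<in> topspace T" for t z
  proof -
    interpret prob_space "P z" by (rule prob_space_P[OF z])
    have ker: "(\<lambda>\<omega>. P (\<omega> t)) \<in> P z \<rightarrow>\<^sub>M subprob_algebra (path_borel T)" by (rule markov_kernel[OF z t])
    let ?\<nu> = "P z \<bind> (\<lambda>\<omega>. P (\<omega> t))"
    have s\<nu>: "sets ?\<nu> = sets (path_borel T)"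
      by (rule sets_bind) (use sets_P pathsD(1)[OF _ t] space_P[OF z] not_empty in auto)
    have eq: "emeasure (P z) A = emeasure ?\<nu> A" if A: "A \<in> Inv T (borel_of T) (\<lambda>t \<omega>. \<omega> t)" for A
    proof -
      have AM: "A \<in> sets (path_borel T)" using Inv_sets_P[OF A z] sets_P[OF z] by simp
      have top: "paths T \<in> sets (coord_sigma T {0..t})" using sets.top[of "coord_sigma T {0..t}"] by simp
      have "emeasure (P z) A = emeasure (P z) (paths T \<inter> A)" using InvD(1)[OF A] by (simp add: Int_absorb1)
      also have "\<dots> = (\<integral>\<^sup>+ \<omega>. emeasure (P (\<omega> t)) A \<partial>P z)"
        unfolding markov_property[OF z t top A] by (rule nn_integral_cong) (simp add: space_P[OF z])
      also have "\<dots> = emeasure ?\<nu> A" by (rule emeasure_bind[OF not_empty ker AM, symmetric])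
      finally show ?thesis .
    qed
    have sub1: "subalgebra (P z) ?I" and sub2: "subalgebra ?\<nu> ?I"
      by (rule subalgebra_inv_sigma[OF _ ne], simp add: sets_P[OF z] s\<nu>)+
    have "restr_to_subalg (P z) ?I = restr_to_subalg ?\<nu> ?I"
      by (rule measure_eqI) (simp_all add: sets_restr_to_subalg[OF sub1] sets_restr_to_subalg[OF sub2]
          emeasure_restr_to_subalg[OF sub1] emeasure_restr_to_subalg[OF sub2] eq)
    then have "(\<integral>\<omega>. F \<omega> \<partial>P z) = (\<integral>\<omega>. F \<omega> \<partial>?\<nu>)"
      using integral_subalgebra2[OF sub1 F] integral_subalgebra2[OF sub2 F] by simp
    also have "\<dots> = (\<integral>\<omega>. (\<integral>\<omega>'. F \<omega>' \<partial>P (\<omega> t)) \<partial>P z)"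
    proof (rule integral_bind[OF FP _ ker, where B = c and B' = 1])
      show "AE \<omega> in P z. emeasure (P (\<omega> t)) (space (P (\<omega> t))) \<le> ennreal 1"
      proof (rule AE_I2)
        fix \<omega> assume "\<omega> \<in> space (P z)"
        then have "\<omega> t \<in> topspace T" using pathsD(1) t space_P[OF z] by auto
        then show "emeasure (P (\<omega> t)) (space (P (\<omega> t))) \<le> ennreal 1"
          using prob_space.emeasure_space_1[OF prob_space_P] by simp
      qed
    qed (use bd not_empty finite_measure_axioms in auto)
    finally show ?thesis .
  qed
  ultimately show ?thesis unfolding harmonic_def by blast
qed

lemma harmonic_cong:
  assumes H: "harmonic T P H" and eq: "\<And>z. z \<in> topspace T \<Longrightarrow> H z = H' z"
    and meas: "H' \<in> borel_measurable (borel_of T)"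
  shows "harmonic T P H'"
proof -
  have "H ` topspace T = H' ` topspace T" using eq by (rule image_cong[OF refl])
  moreover have "(\<integral>\<omega>. H (\<omega> t) \<partial>P z) = (\<integral>\<omega>. H' (\<omega> t) \<partial>P z)" if "t \<ge> 0" "z \<in> topspace T" for t z
    by (rule Bochner_Integration.integral_cong[OF refl], rule eq, rule pathsD(1)) (use that space_P in auto)
  ultimately show ?thesis using H eq meas unfolding harmonic_def by simp
qed

lemma harmonic_invariant_event:
  assumes A: "A \<in> Inv T (borel_of T) (\<lambda>t \<omega>. \<omega> t)"
  shows "harmonic T P (\<lambda>z. measure (P z) A)"
proof -
  have "harmonic T P (\<lambda>z. \<integral>\<omega>. indicator A \<omega> \<partial>P z)"
    by (rule harmonic_invariant_expectation[where c = 1, OF borel_measurable_indicator]) (use A in \<open>auto simp: indicator_def\<close>)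
  moreover have "(\<integral>\<omega>. indicator A \<omega> \<partial>P z) = measure (P z) A" if "z \<in> topspace T" for z
    using Inv_sets_P[OF A that] by simp
  ultimately show ?thesis using measurable_prob_Inv[OF A] by (rule harmonic_cong)
qed

text \<open>
  The events that can be approximated by events of the past of some finite time form a sigma field.
\<close>

lemma coord_sigma_approximation:
  assumes z: "z \<in> topspace T" and A: "A \<in> sets (coord_sigma T {0..})" and e: "e > 0"
  shows "\<exists>n::nat. \<exists>B\<in>sets (coord_sigma T {0..real n}). measure (P z) (sym_diff A B) < e"
  using A[unfolded sets_process_sigma] e
proof (induction arbitrary: e rule: sigma_sets.induct)
  interpret prob_space "P z" by (rule prob_space_P[OF z])
  have mono: "sets (coord_sigma T {0..real n}) \<subseteq> sets (coord_sigma T {0..real m})" if "n \<le> m" for n m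
    using that by (intro process_sigma_mono) auto
  have inP: "A \<in> sets (P z)" if "A \<in> sigma_sets (paths T) {(\<lambda>\<omega>. \<omega> s) -` B \<inter> paths T | s B. s \<in> {0..} \<and> B \<in> sets (borel_of T)}" for A
    by (rule coord_sets_P[OF _ _ z, of _ "{0..}"]) (use that in \<open>auto simp: sets_process_sigma\<close>)
  {
    case (Basic a)
    then obtain s B where a: "s \<ge> 0" "B \<in> sets (borel_of T)" "a = (\<lambda>\<omega>. \<omega> s) -` B \<inter> paths T" by auto
    obtain n :: nat where n: "s \<le> real n" using real_arch_simple by blast
    have "a \<in> sets (coord_sigma T {0..real n})"
      unfolding sets_process_sigma using a n by (intro sigma_sets.Basic CollectI exI[of _ s] exI[of _ B]) auto
    then show ?case using Basic by (intro exI[of _ n] bexI[of _ a]) auto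
  next
    case Empty
    then show ?case by (intro exI[of _ 0] bexI[of _ "{}"]) auto
  next
    case (Compl a)
    then obtain n B where B: "B \<in> sets (coord_sigma T {0..real n})" "measure (P z) (sym_diff a B) < e" by blast
    have "a \<subseteq> paths T" using sigma_sets_into_sp[OF _ Compl.hyps] by auto
    moreover have "B \<subseteq> paths T" using sets.sets_into_space[OF B(1)] by simp
    ultimately have "sym_diff (paths T - a) (paths T - B) = sym_diff a B" by auto
    moreover have "paths T - B \<in> sets (coord_sigma T {0..real n})" using sets.compl_sets[OF B(1)] by simp
    ultimately show ?case using B(2) by (intro exI[of _ n] bexI[of _ "paths T - B"]) auto
  next
    case (Union a)
    have a: "a i \<in> sets (P z)" for i using inP Union.hyps by blast
    let ?U = "\<Union>i. a i"
    have "(\<lambda>N. measure (P z) (\<Union>i<N. a i)) \<longlonglongrightarrow> measure (P z) (\<Union>N. \<Union>i<N. a i)"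
      using a by (intro finite_Lim_measure_incseq monoI UN_mono) auto
    moreover have "(\<Union>N. \<Union>i<N. a i) = ?U" by blast
    ultimately have "(\<lambda>N. measure (P z) (\<Union>i<N. a i)) \<longlonglongrightarrow> measure (P z) ?U" by simp
    then have "\<forall>\<^sub>F N in sequentially. dist (measure (P z) (\<Union>i<N. a i)) (measure (P z) ?U) < e / 2"
      using Union.prems by (intro tendstoD) auto
    then obtain N where N: "dist (measure (P z) (\<Union>i<N. a i)) (measure (P z) ?U) < e / 2"
      by (auto simp: eventually_sequentially)
    define d where "d = e / (2 * (real N + 1))"
    have d: "d > 0" using Union.prems by (simp add: d_def)
    have "\<forall>i. \<exists>n::nat. \<exists>B\<in>sets (coord_sigma T {0..real n}). measure (P z) (sym_diff (a i) B) < d"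
      using Union.IH d by blast
    then obtain n B where B: "\<And>i. B i \<in> sets (coord_sigma T {0..real (n i)})" "\<And>i. measure (P z) (sym_diff (a i) (B i)) < d"
      by metis
    define m where "m = Max (insert 0 (n ` {..<N}))"
    have nm: "n i \<le> m" if "i < N" for i unfolding m_def using that by (intro Max_ge) auto
    have Bm: "(\<Union>i<N. B i) \<in> sets (coord_sigma T {0..real m})"
      using B(1) mono[OF nm] by (intro sets.finite_UN) auto
    have BP: "B i \<in> sets (P z)" for i by (rule coord_sets_P[OF B(1) _ z]) auto
    have "sym_diff ?U (\<Union>i<N. B i) \<subseteq> (?U - (\<Union>i<N. a i)) \<union> (\<Union>i<N. sym_diff (a i) (B i))" by blast
    then have "measure (P z) (sym_diff ?U (\<Union>i<N. B i)) \<le> measure (P z) ((?U - (\<Union>i<N. a i)) \<union> (\<Union>i<N. sym_diff (a i) (B i)))"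
      using a BP by (intro finite_measure_mono) auto
    also have "\<dots> \<le> measure (P z) (?U - (\<Union>i<N. a i)) + measure (P z) (\<Union>i<N. sym_diff (a i) (B i))"
      using a BP by (intro measure_Un_le) auto
    also have "measure (P z) (\<Union>i<N. sym_diff (a i) (B i)) \<le> (\<Sum>i<N. measure (P z) (sym_diff (a i) (B i)))"
      using a BP by (intro finite_measure_subadditive_finite) auto
    also have "\<dots> \<le> (\<Sum>i<N. d)" using B(2) by (intro sum_mono less_imp_le)
    also have "\<dots> < e / 2" using Union.prems by (simp add: d_def field_simps)
    also have "measure (P z) (?U - (\<Union>i<N. a i)) = measure (P z) ?U - measure (P z) (\<Union>i<N. a i)"
      using a by (intro finite_measure_Diff) auto
    also have "\<dots> < e / 2" using N unfolding dist_real_def by linarith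
    finally have "measure (P z) (sym_diff ?U (\<Union>i<N. B i)) < e" by simp
    then show ?case using Bm by blast
  }
qed

text \<open>
  By the Markov property \<open>measure (P (\<omega> t)) A\<close> is the conditional probability of \<open>A\<close> given the past of
  \<open>t\<close>. At the first time in \<open>J\<close> at which it is further than \<open>\<delta>\<close> from the indicator of \<open>B\<close>, the events
  \<open>A\<close> and \<open>B\<close> differ with conditional probability at least \<open>\<delta>\<close>.
\<close>

lemma maximal_inequality:
  assumes z: "z \<in> topspace T" and A: "A \<in> Inv T (borel_of T) (\<lambda>t \<omega>. \<omega> t)"
    and s: "s \<ge> 0" and B: "B \<in> sets (coord_sigma T {0..s})" and J: "finite J" "J \<subseteq> {s..}" and \<delta>: "\<delta> > 0"
  defines "E \<equiv> \<lambda>t. {\<omega> \<in> paths T. \<bar>measure (P (\<omega> t)) A - indicator B \<omega>\<bar> > \<delta>}"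
  shows "(\<Union>t\<in>J. E t) \<in> sets (P z)" "\<delta> * measure (P z) (\<Union>t\<in>J. E t) \<le> measure (P z) (sym_diff A B)"
proof -
  interpret prob_space "P z" by (rule prob_space_P[OF z])
  let ?H = "\<lambda>z. measure (P z) A"
  have AP: "A \<in> sets (P z)" by (rule Inv_sets_P[OF A z])
  have BP: "B \<in> sets (P z)" by (rule coord_sets_P[OF B _ z]) auto
  have Bt: "B \<in> sets (coord_sigma T {0..t})" if "t \<ge> s" for t
    using B process_sigma_mono[of "{0..s}" "{0..t}"] that by auto
  have Et: "E u \<in> sets (coord_sigma T {0..t})" if "s \<le> u" "u \<le> t" for u t
  proof -
    have "(\<lambda>\<omega>. ?H (\<omega> u)) \<in> borel_measurable (coord_sigma T {0..t})"
      by (rule measurable_compose[OF coord_sigma_coordinate measurable_prob_Inv[OF A]]) (use that s in auto)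
    moreover have "B \<in> sets (coord_sigma T {0..t})" using Bt that by simp
    ultimately have "{\<omega> \<in> space (coord_sigma T {0..t}). \<bar>?H (\<omega> u) - indicator B \<omega>\<bar> > \<delta>} \<in> sets (coord_sigma T {0..t})"
      by measurable
    then show ?thesis by (simp add: E_def)
  qed
  (* the event that the first deviation occurs at time t *)
  define D where "D t = E t - (\<Union>u\<in>{u\<in>J. u < t}. E u)" for t
  have Dt: "D t \<in> sets (coord_sigma T {0..t})" if "t \<in> J" for t
    unfolding D_def using that J by (intro sets.Diff sets.finite_UN Et) auto
  have DP: "D t \<in> sets (P z)" if "t \<in> J" for t by (rule coord_sets_P[OF Dt[OF that] _ z]) auto
  have disj: "disjoint_family_on D J"
    unfolding disjoint_family_on_def D_def by (auto simp: neq_iff)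
  have un: "(\<Union>t\<in>J. E t) = (\<Union>t\<in>J. D t)"
  proof
    show "(\<Union>t\<in>J. E t) \<subseteq> (\<Union>t\<in>J. D t)"
    proof
      fix \<omega> assume "\<omega> \<in> (\<Union>t\<in>J. E t)"
      then have ne: "{t \<in> J. \<omega> \<in> E t} \<noteq> {}" by blast
      let ?m = "Min {t \<in> J. \<omega> \<in> E t}"
      have "?m \<in> {t \<in> J. \<omega> \<in> E t}" using ne J(1) by (intro Min_in) auto
      moreover have "\<omega> \<notin> E u" if "u \<in> J" "u < ?m" for u
        using Min_le[of "{t \<in> J. \<omega> \<in> E t}" u] that J(1) by fastforce
      ultimately show "\<omega> \<in> (\<Union>t\<in>J. D t)" unfolding D_def by blast
    qed
  qed (auto simp: D_def)
  show "(\<Union>t\<in>J. E t) \<in> sets (P z)" unfolding un using J(1) DP by auto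
  have bnd: "0 \<le> ?H (\<omega> t) \<and> ?H (\<omega> t) \<le> 1" if "\<omega> \<in> paths T" "t \<ge> 0" for \<omega> t
    using prob_space.prob_le_1[OF prob_space_P] pathsD(1)[OF that] by simp
  have le: "\<delta> * measure (P z) (D t) \<le> measure (P z) (D t \<inter> sym_diff A B)" if tJ: "t \<in> J" for t
  proof -
    have t: "t \<ge> s" "t \<ge> 0" using tJ J(2) s by auto
    have m: "(\<lambda>\<omega>. ?H (\<omega> t)) \<in> borel_measurable (P z)"
      by (rule measurable_compose[OF coordinate_P[OF z t(2)] measurable_prob_Inv[OF A]])
    have int: "integrable (P z) (\<lambda>\<omega>. indicator C \<omega> * ?H (\<omega> t))" if "C \<in> sets (P z)" for C
      by (rule integrable_const_bound[where B = 1]) (use m that bnd[OF _ t(2)] in \<open>auto simp: indicator_def space_P[OF z]\<close>)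
    have ind: "integrable (P z) (\<lambda>\<omega>. c * indicator C \<omega>)" if "C \<in> sets (P z)" for c :: real and C
      using that by (intro integrable_mult_right integrable_real_indicator) (auto simp: emeasure_eq_measure)
    note mk = markov_property_measure[OF z t(2) _ A]
    let ?D1 = "D t \<inter> B" and ?D2 = "D t - B"
    have D12: "?D1 \<in> sets (coord_sigma T {0..t})" "?D2 \<in> sets (coord_sigma T {0..t})"
      using Dt[OF tJ] Bt[OF t(1)] by auto
    have D12P: "?D1 \<in> sets (P z)" "?D2 \<in> sets (P z)" using DP[OF tJ] BP by auto
    have "measure (P z) (?D1 \<inter> A) = (\<integral>\<omega>. indicator ?D1 \<omega> * ?H (\<omega> t) \<partial>P z)" by (rule mk[OF D12(1)])
    also have "\<dots> \<le> (\<integral>\<omega>. (1 - \<delta>) * indicator ?D1 \<omega> \<partial>P z)"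
    proof (rule integral_mono[OF int[OF D12P(1)]])
      show "indicator ?D1 \<omega> * ?H (\<omega> t) \<le> (1 - \<delta>) * indicator ?D1 \<omega>" if "\<omega> \<in> space (P z)" for \<omega>
        using bnd[OF _ t(2), of \<omega>] that unfolding space_P[OF z] by (auto simp: indicator_def D_def E_def)
    qed (rule ind, rule D12P)
    also have "\<dots> = (1 - \<delta>) * measure (P z) ?D1" using D12P by simp
    finally have 1: "\<delta> * measure (P z) ?D1 \<le> measure (P z) ?D1 - measure (P z) (?D1 \<inter> A)" by (simp add: algebra_simps)
    have "\<delta> * measure (P z) ?D2 = (\<integral>\<omega>. \<delta> * indicator ?D2 \<omega> \<partial>P z)" using D12P by simp
    also have "\<dots> \<le> (\<integral>\<omega>. indicator ?D2 \<omega> * ?H (\<omega> t) \<partial>P z)"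
    proof (rule integral_mono[OF _ int[OF D12P(2)]])
      show "\<delta> * indicator ?D2 \<omega> \<le> indicator ?D2 \<omega> * ?H (\<omega> t)" if "\<omega> \<in> space (P z)" for \<omega>
        using bnd[OF _ t(2), of \<omega>] that unfolding space_P[OF z] by (auto simp: indicator_def D_def E_def)
    qed (rule ind, rule D12P)
    also have "\<dots> = measure (P z) (?D2 \<inter> A)" by (rule mk[OF D12(2), symmetric])
    finally have 2: "\<delta> * measure (P z) ?D2 \<le> measure (P z) (?D2 \<inter> A)" .
    have "measure (P z) (D t) = measure (P z) ?D1 + measure (P z) ?D2"
      using DP[OF tJ] BP by (subst finite_measure_Union[symmetric]) (auto intro: arg_cong[where f = "measure (P z)"])
    moreover have "measure (P z) (D t \<inter> sym_diff A B) = measure (P z) (?D1 - A) + measure (P z) (?D2 \<inter> A)"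
      using DP[OF tJ] BP AP by (subst finite_measure_Union[symmetric]) (auto intro: arg_cong[where f = "measure (P z)"])
    moreover have "measure (P z) (?D1 - A) = measure (P z) ?D1 - measure (P z) (?D1 \<inter> A)"
      using D12P AP by (intro finite_measure_Diff') auto
    ultimately show ?thesis using 1 2 by (simp add: algebra_simps)
  qed
  have "\<delta> * measure (P z) (\<Union>t\<in>J. E t) = (\<Sum>t\<in>J. \<delta> * measure (P z) (D t))"
    unfolding un using J(1) DP disj by (subst finite_measure_finite_Union) (auto simp: sum_distrib_left)
  also have "\<dots> \<le> (\<Sum>t\<in>J. measure (P z) (D t \<inter> sym_diff A B))" by (intro sum_mono le)
  also have "\<dots> = measure (P z) (\<Union>t\<in>J. D t \<inter> sym_diff A B)"
    using J(1) DP AP BP disj by (intro finite_measure_finite_Union[symmetric]) (auto simp: disjoint_family_on_def)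
  also have "\<dots> \<le> measure (P z) (sym_diff A B)" using AP BP by (intro finite_measure_mono) auto
  finally show "\<delta> * measure (P z) (\<Union>t\<in>J. E t) \<le> measure (P z) (sym_diff A B)" .
qed

text \<open>
  Levy's zero-one law along real times. The event \<open>A\<close> is close in probability to an event \<open>B\<close> of the past
  of a time \<open>n\<close>. The maximal inequality bounds the deviations from \<open>B\<close> at rational times after \<open>n\<close>, and
  continuity extends the bound to real times.
\<close>

lemma levy_zero_one:
  assumes z: "z \<in> topspace T" and A: "A \<in> Inv T (borel_of T) (\<lambda>t \<omega>. \<omega> t)"
    and cont: "continuous_map T euclideanreal (\<lambda>z. measure (P z) A)"
  shows "AE \<omega> in P z. ((\<lambda>t. measure (P (\<omega> t)) A) \<longlongrightarrow> indicator A \<omega>) at_top"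
proof -
  interpret prob_space "P z" by (rule prob_space_P[OF z])
  let ?H = "\<lambda>z. measure (P z) A"
  have AP: "A \<in> sets (P z)" by (rule Inv_sets_P[OF A z])
  have AC: "A \<in> sets (coord_sigma T {0..})" using InvD(2)[OF A] by simp
  have bad: "\<exists>N\<in>sets (P z). measure (P z) N \<le> e \<and>
      (\<forall>\<omega>\<in>paths T - N. \<forall>\<^sub>F t in at_top. \<bar>?H (\<omega> t) - indicator A \<omega>\<bar> \<le> \<delta>)" if \<delta>: "\<delta> > 0" and e: "e > 0" for \<delta> e
  proof -
    (* chosen such that e' / \<delta> (deviations from B) and e' (A against B) add up to e *)
    define e' where "e' = e / (1 + 1 / \<delta>)"
    have pos: "1 + 1 / \<delta> > 0" using \<delta> by (simp add: add_pos_pos)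
    have e': "e' > 0" using e pos by (simp add: e'_def)
    obtain n B where B: "B \<in> sets (coord_sigma T {0..real n})" "measure (P z) (sym_diff A B) < e'"
      using coord_sigma_approximation[OF z AC e'] by blast
    have BP: "B \<in> sets (P z)" by (rule coord_sets_P[OF B(1) _ z]) auto
    define E where "E t = {\<omega> \<in> paths T. \<bar>?H (\<omega> t) - indicator B \<omega>\<bar> > \<delta>}" for t
    let ?Q = "\<rat> \<inter> {real n..}"
    have cQ: "countable ?Q" using countable_rat by blast
    obtain q where "q \<in> \<rat>" "real n < q" using Rats_dense_in_real[of "real n" "real n + 1"] by auto
    then have neQ: "?Q \<noteq> {}" by force
    define r where "r = from_nat_into ?Q"
    have rQ: "range r = ?Q" unfolding r_def by (rule range_from_nat_into[OF neQ cQ])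
    note mi = maximal_inequality[OF z A _ B(1) _ _ \<delta>, folded E_def]
    have fin: "(\<Union>i<k. E (r i)) \<in> sets (P z) \<and> \<delta> * measure (P z) (\<Union>i<k. E (r i)) \<le> e'" for k
    proof -
      have sub: "r ` {..<k} \<subseteq> {real n..}" using rQ by blast
      show ?thesis using mi[OF _ _ sub] B(2) by (simp add: image_image)
    qed
    let ?U = "\<Union>k. \<Union>i<k. E (r i)"
    have "(\<lambda>k. measure (P z) (\<Union>i<k. E (r i))) \<longlonglongrightarrow> measure (P z) ?U"
      using fin by (intro finite_Lim_measure_incseq monoI UN_mono) auto
    then have "(\<lambda>k. \<delta> * measure (P z) (\<Union>i<k. E (r i))) \<longlonglongrightarrow> \<delta> * measure (P z) ?U" by (intro tendsto_intros)
    then have U: "\<delta> * measure (P z) ?U \<le> e'" using fin by (intro LIMSEQ_le_const2) auto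
    have UP: "?U \<in> sets (P z)" using fin by blast
    let ?N = "?U \<union> sym_diff A B"
    have "measure (P z) ?N \<le> measure (P z) ?U + measure (P z) (sym_diff A B)"
      using UP AP BP by (intro measure_Un_le) auto
    also have "\<dots> \<le> e' / \<delta> + e'" using U B(2) \<delta> by (intro add_mono) (auto simp: field_simps)
    also have "\<dots> = e' * (1 + 1 / \<delta>)" by (simp add: algebra_simps)
    also have "\<dots> = e" unfolding e'_def using pos by simp
    finally have "measure (P z) ?N \<le> e" .
    moreover have "\<forall>\<^sub>F t in at_top. \<bar>?H (\<omega> t) - indicator A \<omega>\<bar> \<le> \<delta>" if \<omega>: "\<omega> \<in> paths T - ?N" for \<omega>
    proof -
      have AB: "indicator A \<omega> = (indicator B \<omega> :: real)" using \<omega> by (auto simp: indicator_def)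
      have near: "?H (\<omega> t) \<in> {indicator B \<omega> - \<delta>..indicator B \<omega> + \<delta>}" if t: "t \<ge> real n" for t
      proof (rule continuous_path_closed_rational[where n = "real n" and S = euclideanreal and z = "\<lambda>t. ?H (\<omega> t)"])
        show "continuous_map (top_of_set {0..}) euclideanreal (\<lambda>t. ?H (\<omega> t))"
          using path_image_continuous[OF cont] \<omega> by blast
        fix q assume "q \<in> \<rat>" "real n \<le> q"
        then obtain i where i: "q = r i" using rQ by (metis Int_iff atLeast_iff rangeE)
        have "\<omega> \<notin> E (r i)" using \<omega> lessI[of i] by blast
        then show "?H (\<omega> q) \<in> {indicator B \<omega> - \<delta>..indicator B \<omega> + \<delta>}"
          using \<omega> unfolding i E_def by (simp add: abs_le_iff not_less)
      qed (use t in auto)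
      have "\<bar>?H (\<omega> t) - indicator B \<omega>\<bar> \<le> \<delta>" if "t \<ge> real n" for t
        using near[OF that] by (simp add: abs_le_iff)
      then show ?thesis unfolding AB eventually_at_top_linorder by blast
    qed
    ultimately show ?thesis using UP AP BP by (intro bexI[of _ ?N]) auto
  qed
  have "AE \<omega> in P z. \<forall>\<^sub>F t in at_top. \<bar>?H (\<omega> t) - indicator A \<omega>\<bar> \<le> \<delta>" if \<delta>: "\<delta> > 0" for \<delta>
  proof -
    have "\<forall>k. \<exists>N. N \<in> sets (P z) \<and> measure (P z) N \<le> 1 / real (Suc k) \<and>
      (\<forall>\<omega>\<in>paths T - N. \<forall>\<^sub>F t in at_top. \<bar>?H (\<omega> t) - indicator A \<omega>\<bar> \<le> \<delta>)"
      using bad[OF \<delta>] by (metis of_nat_0_less_iff zero_less_Suc zero_less_divide_1_iff)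
    then obtain N where N: "\<And>k. N k \<in> sets (P z)" "\<And>k. measure (P z) (N k) \<le> 1 / real (Suc k)"
      "\<And>k \<omega>. \<omega> \<in> paths T - N k \<Longrightarrow> \<forall>\<^sub>F t in at_top. \<bar>?H (\<omega> t) - indicator A \<omega>\<bar> \<le> \<delta>" by metis
    have "measure (P z) (\<Inter>k. N k) \<le> 1 / real (Suc k)" for k
      using N by (intro order_trans[OF finite_measure_mono N(2)[of k]]) auto
    then have "measure (P z) (\<Inter>k. N k) \<le> 0"
      by (intro LIMSEQ_le_const[OF LIMSEQ_inverse_real_of_nat]) (auto simp: inverse_eq_divide)
    then have "(\<Inter>k. N k) \<in> null_sets (P z)" using N(1) by (auto simp: null_sets_def emeasure_eq_measure antisym)
    then show ?thesis
      by (rule AE_I') (use N(3) space_P[OF z] in blast)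
  qed
  then have "AE \<omega> in P z. \<forall>k. \<forall>\<^sub>F t in at_top. \<bar>?H (\<omega> t) - indicator A \<omega>\<bar> \<le> 1 / real (Suc k)"
    by (subst AE_all_countable) auto
  then show ?thesis
  proof (rule AE_mp, intro AE_I2 impI)
    fix \<omega> assume *: "\<forall>k. \<forall>\<^sub>F t in at_top. \<bar>?H (\<omega> t) - indicator A \<omega>\<bar> \<le> 1 / real (Suc k)"
    show "((\<lambda>t. ?H (\<omega> t)) \<longlongrightarrow> indicator A \<omega>) at_top"
    proof (rule tendstoI)
      fix e :: real assume "e > 0"
      then obtain k where "1 / real (Suc k) < e" using nat_approx_posE by blast
      then show "\<forall>\<^sub>F t in at_top. dist (?H (\<omega> t)) (indicator A \<omega>) < e"
        using *[rule_format, of k] by (auto simp: dist_real_def elim!: eventually_mono)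
    qed
  qed
qed

end

section \<open>Equivariance of the laws\<close>

definition left_mult_state :: "('g, 'b) monoid_scheme \<Rightarrow> 'g \<Rightarrow> 'x \<times> 'g \<Rightarrow> 'x \<times> 'g" where
  "left_mult_state G a = (\<lambda>(x, h). (x, a \<otimes>\<^bsub>G\<^esub> h))"

lemma left_mult_state_simps:
  "left_mult_state G a (x, h) = (x, a \<otimes>\<^bsub>G\<^esub> h)"
  "fst (left_mult_state G a z) = fst z" "snd (left_mult_state G a z) = a \<otimes>\<^bsub>G\<^esub> snd z"
  by (auto simp: left_mult_state_def case_prod_unfold)

lemma left_mult_state_continuous:
  assumes G: "lie_group G MG" and a: "a \<in> carrier G"
  shows "continuous_map (prod_topology TX (mtop MG)) (prod_topology TX (mtop MG)) (left_mult_state G a)"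
proof -
  have "continuous_map (prod_topology TX (mtop MG)) (mtop MG) (\<lambda>z. a \<otimes>\<^bsub>G\<^esub> snd z)"
    using continuous_map_compose[OF continuous_map_snd lie_group_left_mult_continuous[OF G a]] by (simp add: o_def)
  then show ?thesis
    by (simp add: continuous_map_pairwise o_def left_mult_state_simps continuous_map_fst)
qed

text \<open>
  Since \<open>L\<close> commutes with translations, the process attached to \<open>f\<close> along the translated path is the
  process attached to the translate of \<open>f\<close> along the original path.
\<close>

lemma left_translate_solves_martingale_problem:
  assumes MX: "smooth_manifold MX" and G: "lie_group G MG" and a: "a \<in> carrier G"
    and L: "smooth_operator (mprod MX MG) L" and equi: "equivariance_condition MX G MG L"
    and R: "solves_martingale_problem (mprod MX MG) L z R" and z: "z \<in> points (mprod MX MG)"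
    and adapted: "\<And>f t. f \<in> C_inf_compact (mprod MX MG) \<Longrightarrow> t \<ge> 0 \<Longrightarrow>
      (\<lambda>\<omega>. f (\<omega> t) - f (\<omega> 0) - integral {0..t} (\<lambda>s. L f (\<omega> s)))
         \<in> borel_measurable (nat_filtration (mtop (mprod MX MG)) (ennreal t))"
  shows "solves_martingale_problem (mprod MX MG) L (left_mult_state G a z)
    (distr R (path_borel (mtop (mprod MX MG))) (map_path (left_mult_state G a)))"
proof -
  let ?T = "mtop (mprod MX MG)"
  let ?l = "left_mult_state G a"
  let ?m = "map_path ?l"
  let ?R = "distr R (path_borel ?T) ?m"
  let ?Z = "\<lambda>f t \<omega>. f (\<omega> t) - f (\<omega> 0) - integral {0..t} (\<lambda>s. L f (\<omega> s))"
  have car: "points MG = carrier G" using G by (auto simp: lie_group_def)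
  interpret R: prob_space R using R by (simp add: solves_martingale_problem_def)
  have sR: "sets R = sets (path_borel ?T)" using R by (simp add: solves_martingale_problem_def)
  have spR: "space R = paths ?T" using sets_eq_imp_space_eq[OF sR] by simp
  have lc: "continuous_map ?T ?T ?l" unfolding mprod_simps by (rule left_mult_state_continuous[OF G a])
  have mm: "?m \<in> R \<rightarrow>\<^sub>M path_borel ?T"
    using map_path_measurable[OF lc] measurable_cong_sets[OF sR refl] by blast
  have mp: "?m \<omega> \<in> paths ?T" if "\<omega> \<in> paths ?T" for \<omega> by (rule map_path_paths[OF lc that])
  interpret R': prob_space ?R by (rule R.prob_space_distr[OF mm])
  have lz: "?l z \<in> topspace ?T" using lc z by (auto simp: continuous_map_def)
  have start: "AE \<omega> in ?R. \<omega> 0 = ?l z"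
  proof -
    have "closedin ?T {?l z}"
      using closedin_Hausdorff_singleton[OF _ lz] smooth_manifold_topology(1)[OF MX]
        smooth_manifold_topology(1)[of MG] G by (auto simp: mprod_simps Hausdorff_space_prod_topology lie_group_def)
    then have "(\<lambda>\<omega>. \<omega> 0) -` {?l z} \<inter> space (path_borel ?T) \<in> sets (path_borel ?T)"
      by (intro measurable_sets[OF coordinate_measurable] borel_of_closed) auto
    moreover have "(\<lambda>\<omega>. \<omega> 0) -` {?l z} \<inter> space (path_borel ?T) = {\<omega> \<in> space (path_borel ?T). \<omega> 0 = ?l z}" by auto
    ultimately have s: "{\<omega> \<in> space (path_borel ?T). \<omega> 0 = ?l z} \<in> sets (path_borel ?T)" by simp
    have "AE \<omega> in R. \<omega> 0 = z" using R by (simp add: solves_martingale_problem_def)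
    then have "AE \<omega> in R. ?m \<omega> 0 = ?l z" by (rule AE_mp) (simp add: map_path_simps)
    then show ?thesis using AE_distr_iff[OF mm s] by simp
  qed
  have mart: "martingale ?R (nat_filtration ?T) (?Z f)" if f: "f \<in> C_inf_compact (mprod MX MG)" for f
  proof -
    let ?af = "left_action MX G a f"
    have af: "?af \<in> C_inf_compact (mprod MX MG)" by (rule left_action_C_inf_compact[OF MX G a f])
    have fC: "f \<in> C_inf (mprod MX MG)" using f by (simp add: C_inf_compact_def)
    have Laf: "L ?af = left_action MX G a (L f)" using equi a fC by (simp add: equivariance_condition_def)
    have la: "left_action MX G a h (\<omega> t) = h (?m \<omega> t)" if "\<omega> \<in> paths ?T" "t \<ge> 0" for h \<omega> t
    proof -
      have "\<omega> t \<in> points MX \<times> carrier G" using pathsD(1)[OF that] by (simp add: mprod_simps car)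
      then show ?thesis using that(2) by (auto simp: left_action_def map_path_simps left_mult_state_def)
    qed
    have Z: "?Z ?af t \<omega> = ?Z f t (?m \<omega>)" if "\<omega> \<in> paths ?T" "t \<ge> 0" for t \<omega>
    proof -
      have "integral {0..t} (\<lambda>s. L ?af (\<omega> s)) = integral {0..t} (\<lambda>s. L f (?m \<omega> s))"
        unfolding Laf by (rule integral_cong) (use la that in auto)
      then show ?thesis using la[OF that(1)] that(2) by simp
    qed
    have maf: "martingale R (nat_filtration ?T) (?Z ?af)"
      using R af by (simp add: solves_martingale_problem_def)
    have subR: "subalgebra R (nat_filtration ?T (ennreal t))" if "t \<ge> 0" for t
      unfolding subalgebra_def using coord_sigma_path_borel[of "{0..t}" ?T] by (simp add: nat_filtration_eq[OF that] sR spR)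
    have subR': "subalgebra ?R (nat_filtration ?T (ennreal t))" if "t \<ge> 0" for t
      unfolding subalgebra_def using coord_sigma_path_borel[of "{0..t}" ?T] by (simp add: nat_filtration_eq[OF that])
    have Zm: "?Z f t \<in> borel_measurable (path_borel ?T)" if "t \<ge> 0" for t
      using measurable_from_subalg[OF subR'[OF that] adapted[OF f that]] by simp
    have int: "integrable ?R (?Z f t)" if "t \<ge> 0" for t
    proof -
      have "integrable R (?Z ?af t)" using maf that by (simp add: martingale_def)
      then have "integrable R (\<lambda>\<omega>. ?Z f t (?m \<omega>))"
        by (rule Bochner_Integration.integrable_cong[OF refl, THEN iffD1, rotated]) (use Z that spR in auto)
      then show ?thesis using integrable_distr_eq[OF mm Zm[OF that]] by simp
    qed
    show ?thesis
      unfolding martingale_def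
    proof (intro conjI allI impI)
      show "?Z f t \<in> borel_measurable (nat_filtration ?T (ennreal t))" if "t \<ge> 0" for t by (rule adapted[OF f that])
      show "integrable ?R (?Z f t)" if "t \<ge> 0" for t by (rule int[OF that])
      fix s t :: real assume s: "0 \<le> s" and st: "s \<le> t"
      then have t: "0 \<le> t" by simp
      interpret S: finite_measure_subalgebra R "nat_filtration ?T (ennreal s)"
        by standard (rule subR[OF s])
      interpret S': finite_measure_subalgebra ?R "nat_filtration ?T (ennreal s)"
        by standard (rule subR'[OF s])
      show "AE \<omega> in ?R. real_cond_exp ?R (nat_filtration ?T (ennreal s)) (?Z f t) \<omega> = ?Z f s \<omega>"
      proof (rule S'.real_cond_exp_charact)
        fix D assume D: "D \<in> sets (nat_filtration ?T (ennreal s))"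
        let ?D = "?m -` D \<inter> paths ?T"
        have Dp: "D \<in> sets (path_borel ?T)" using D subR'[OF s] by (auto simp: subalgebra_def)
        have mF: "?m \<in> coord_sigma ?T {0..s} \<rightarrow>\<^sub>M coord_sigma ?T {0..s}"
        proof (rule measurable_process_sigmaI)
          show "?m \<omega> \<in> paths ?T" if "\<omega> \<in> space (coord_sigma ?T {0..s})" for \<omega> using that mp by simp
          fix u assume u: "u \<in> {0..s}"
          have "(\<lambda>\<omega>. ?l (\<omega> u)) \<in> coord_sigma ?T {0..s} \<rightarrow>\<^sub>M borel_of ?T"
            by (rule measurable_compose[OF coord_sigma_coordinate continuous_map_measurable[OF lc]]) (use u in auto)
          then show "(\<lambda>\<omega>. ?m \<omega> u) \<in> coord_sigma ?T {0..s} \<rightarrow>\<^sub>M borel_of ?T"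
            using u by (simp add: map_path_simps)
        qed
        have D': "?D \<in> sets (nat_filtration ?T (ennreal s))"
          using measurable_sets[OF mF, of D] D by (simp add: nat_filtration_eq[OF s])
        have tr: "set_lebesgue_integral ?R D (?Z f u) = set_lebesgue_integral R ?D (?Z ?af u)" if "u \<ge> 0" for u
        proof -
          have "set_lebesgue_integral ?R D (?Z f u) = (\<integral>\<omega>. indicator D (?m \<omega>) *\<^sub>R ?Z f u (?m \<omega>) \<partial>R)"
            unfolding set_lebesgue_integral_def using Zm[OF that] Dp by (intro integral_distr[OF mm]) auto
          also have "\<dots> = set_lebesgue_integral R ?D (?Z ?af u)"
            unfolding set_lebesgue_integral_def
            by (rule Bochner_Integration.integral_cong[OF refl]) (use Z that spR in \<open>auto simp: indicator_def\<close>)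
          finally show ?thesis .
        qed
        have "set_lebesgue_integral R ?D (?Z ?af t) =
            set_lebesgue_integral R ?D (real_cond_exp R (nat_filtration ?T (ennreal s)) (?Z ?af t))"
          by (rule S.real_cond_exp_intA[OF _ D']) (use maf t in \<open>simp add: martingale_def\<close>)
        also have "\<dots> = set_lebesgue_integral R ?D (?Z ?af s)"
        proof -
          have ae: "AE \<omega> in R. real_cond_exp R (nat_filtration ?T (ennreal s)) (?Z ?af t) \<omega> = ?Z ?af s \<omega>"
            using maf s st by (simp add: martingale_def)
          have ms: "?Z ?af s \<in> borel_measurable R"
            using maf s by (auto simp: martingale_def)
          have mD: "?D \<in> sets R" using D' subR[OF s] by (auto simp: subalgebra_def)
          show ?thesis unfolding set_lebesgue_integral_def
            by (rule integral_cong_AE) (use ae ms mD in auto)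
        qed
        finally show "set_lebesgue_integral ?R D (?Z f t) = set_lebesgue_integral ?R D (?Z f s)"
          using tr[OF t] tr[OF s] by simp
      qed (use int s t adapted[OF f s] in auto)
    qed
  qed
  show ?thesis unfolding solves_martingale_problem_def
    using R'.prob_space_axioms start mart by simp
qed

text \<open>
  Both sides solve the martingale problem started at the translate of \<open>z\<close>, and the solution is unique.
\<close>

lemma left_equivariant_law:
  assumes MX: "smooth_manifold MX" and G: "lie_group G MG" and a: "a \<in> carrier G"
    and P: "diffusion_with_generator (mprod MX MG) L P" and equi: "equivariance_condition MX G MG L"
    and z: "z \<in> points (mprod MX MG)"
  shows "P (left_mult_state G a z) =
    distr (P z) (path_borel (mtop (mprod MX MG))) (map_path (left_mult_state G a))"
proof -
  let ?T = "mtop (mprod MX MG)"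
  have lc: "continuous_map ?T ?T (left_mult_state G a)" unfolding mprod_simps by (rule left_mult_state_continuous[OF G a])
  have lz: "left_mult_state G a z \<in> points (mprod MX MG)" using lc z by (auto simp: continuous_map_def)
  have sol: "solves_martingale_problem (mprod MX MG) L z (P z)" using P z by (simp add: diffusion_with_generator_def)
  have "solves_martingale_problem (mprod MX MG) L (left_mult_state G a z)
    (distr (P z) (path_borel ?T) (map_path (left_mult_state G a)))"
  proof (rule left_translate_solves_martingale_problem[OF MX G a _ equi sol z])
    show "smooth_operator (mprod MX MG) L" using P by (simp add: diffusion_with_generator_def)
    show "(\<lambda>\<omega>. f (\<omega> t) - f (\<omega> 0) - integral {0..t} (\<lambda>s. L f (\<omega> s))) \<in> borel_measurable (nat_filtration ?T (ennreal t))"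
      if "f \<in> C_inf_compact (mprod MX MG)" "t \<ge> 0" for f t
      using sol that unfolding solves_martingale_problem_def martingale_def by blast
  qed
  then show ?thesis using P lz unfolding diffusion_with_generator_def by metis
qed

section \<open>A measure with translates continuous in total variation\<close>

text \<open>
  The monotone class argument with limits in mean in place of dominated pointwise limits.
\<close>

lemma integrable_L1_induct [consumes 1, case_names indicator add limit]:
  fixes f :: "'a \<Rightarrow> real"
  assumes f: "integrable M f"
    and ind: "\<And>B c. B \<in> sets M \<Longrightarrow> Q (\<lambda>x. c * indicator B x)"
    and add: "\<And>f g. integrable M f \<Longrightarrow> integrable M g \<Longrightarrow> Q f \<Longrightarrow> Q g \<Longrightarrow> Q (\<lambda>x. f x + g x)"
    and limit: "\<And>f. integrable M f \<Longrightarrow>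
      (\<And>e. e > 0 \<Longrightarrow> \<exists>g. integrable M g \<and> Q g \<and> (\<integral>x. \<bar>f x - g x\<bar> \<partial>M) < e) \<Longrightarrow> Q f"
  shows "Q f"
  using f
proof (induction rule: integrable_induct)
  case (base A c)
  then show ?case using ind[of A c] by (simp add: mult.commute)
next
  case (add f g)
  then show ?case using assms(3) by blast
next
  case (lim f s)
  show ?case
  proof (rule limit[OF lim.hyps(4)])
    fix e :: real assume e: "e > 0"
    have "(\<lambda>i. \<integral>x. \<bar>f x - s i x\<bar> \<partial>M) \<longlonglongrightarrow> (\<integral>x. 0 \<partial>M)"
    proof (rule integral_dominated_convergence[where w = "\<lambda>x. 3 * \<bar>f x\<bar>"])
      show "AE x in M. (\<lambda>i. \<bar>f x - s i x\<bar>) \<longlonglongrightarrow> 0"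
      proof (rule AE_I2)
        fix x assume "x \<in> space M"
        then have "(\<lambda>i. f x - s i x) \<longlonglongrightarrow> f x - f x" using lim.hyps by (intro tendsto_intros) auto
        then show "(\<lambda>i. \<bar>f x - s i x\<bar>) \<longlonglongrightarrow> 0" by (simp add: tendsto_rabs_zero)
      qed
      show "AE x in M. norm \<bar>f x - s i x\<bar> \<le> 3 * \<bar>f x\<bar>" for i
      proof (rule AE_I2)
        fix x assume "x \<in> space M"
        then have "\<bar>s i x\<bar> \<le> 2 * \<bar>f x\<bar>" using lim.hyps(3)[of x i] by simp
        then show "norm \<bar>f x - s i x\<bar> \<le> 3 * \<bar>f x\<bar>" by simp
      qed
      show "integrable M (\<lambda>x. 3 * \<bar>f x\<bar>)" using lim.hyps by simp
    qed (use lim.hyps in auto)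
    then have "\<forall>\<^sub>F i in sequentially. dist (\<integral>x. \<bar>f x - s i x\<bar> \<partial>M) 0 < e" using e by (intro tendstoD) auto
    then obtain i where "dist (\<integral>x. \<bar>f x - s i x\<bar> \<partial>M) 0 < e" by (auto simp: eventually_sequentially)
    then show "\<exists>g. integrable M g \<and> Q g \<and> (\<integral>x. \<bar>f x - g x\<bar> \<partial>M) < e"
      using lim.hyps lim.IH by (auto intro!: exI[of _ "s i"])
  qed
qed

text \<open>
  The countable set of combinations exhibits the separability of \<open>L\<^sup>1\<close>. Since the generator is stable
  under intersections, indicators are reached through complements and disjoint unions alone, and for
  these it suffices that combinations can be added.
\<close>

lemma rational_combinations_dense_L1:
  fixes C :: "nat \<Rightarrow> 'a set"
  assumes M: "finite_measure M" and gen: "sets M = sigma_sets (space M) (range C)"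
    and int: "Int_stable (range C)" and top: "space M \<in> range C" and sub: "range C \<subseteq> Pow (space M)"
    and g: "integrable M (g :: 'a \<Rightarrow> real)" and e: "e > 0"
  shows "\<exists>l :: (rat \<times> nat) list. (\<integral>x. \<bar>g x - (\<Sum>(q, i)\<leftarrow>l. of_rat q * indicator (C i) x)\<bar> \<partial>M) < e"
proof -
  interpret finite_measure M by fact
  define ev :: "(rat \<times> nat) list \<Rightarrow> 'a \<Rightarrow> real" where "ev l x = (\<Sum>(q, i)\<leftarrow>l. of_rat q * indicator (C i) x)" for l x
  have ev_simps: "ev [] x = 0" "ev (p # l) x = of_rat (fst p) * indicator (C (snd p)) x + ev l x"
    "ev (l @ l') x = ev l x + ev l' x" for p l l' x
    by (auto simp: ev_def case_prod_unfold)
  have CM: "C i \<in> sets M" for i unfolding gen by auto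
  have iInd: "integrable M (\<lambda>x. c * indicator A x)" if "A \<in> sets M" for A and c :: real
    using that by (intro integrable_mult_right integrable_real_indicator) (auto simp: less_top[symmetric])
  have iev: "integrable M (ev l)" for l
  proof (induction l)
    case Nil
    have "ev [] = (\<lambda>x. 0)" by (simp add: ev_simps fun_eq_iff)
    then show ?case by simp
  next
    case (Cons p l)
    have "ev (p # l) = (\<lambda>x. of_rat (fst p) * indicator (C (snd p)) x + ev l x)" by (simp add: ev_simps fun_eq_iff)
    moreover have "integrable M (\<lambda>x. of_rat (fst p) * indicator (C (snd p)) x + ev l x)"
      by (intro Bochner_Integration.integrable_add Cons iInd[OF CM])
    ultimately show ?case by simp
  qed
  define approx where "approx f \<longleftrightarrow> integrable M f \<and> (\<forall>e>0. \<exists>l. (\<integral>x. \<bar>f x - ev l x\<bar> \<partial>M) < e)" for f :: "'a \<Rightarrow> real"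
  have approx_add: "approx (\<lambda>x. f x + h x)" if "approx f" "approx h" for f h
    unfolding approx_def
  proof (intro conjI allI impI)
    show "integrable M (\<lambda>x. f x + h x)" using that by (simp add: approx_def)
    fix e :: real assume "e > 0"
    then obtain l l' where l: "(\<integral>x. \<bar>f x - ev l x\<bar> \<partial>M) < e / 2" "(\<integral>x. \<bar>h x - ev l' x\<bar> \<partial>M) < e / 2"
    proof -
      have "e / 2 > 0" using \<open>e > 0\<close> by simp
      then have "\<exists>l. (\<integral>x. \<bar>f x - ev l x\<bar> \<partial>M) < e / 2" "\<exists>l. (\<integral>x. \<bar>h x - ev l x\<bar> \<partial>M) < e / 2"
        using \<open>approx f\<close> \<open>approx h\<close> unfolding approx_def by blast+
      then show ?thesis using that by blast
    qed
    have i: "integrable M (\<lambda>x. \<bar>f x - ev l x\<bar>)" "integrable M (\<lambda>x. \<bar>h x - ev l' x\<bar>)"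
      using that iev by (auto simp: approx_def)
    have "(\<integral>x. \<bar>f x + h x - ev (l @ l') x\<bar> \<partial>M) \<le> (\<integral>x. \<bar>f x - ev l x\<bar> + \<bar>h x - ev l' x\<bar> \<partial>M)"
      using that iev by (intro integral_mono) (auto simp: approx_def ev_simps)
    also have "\<dots> < e" using l i by simp
    finally show "\<exists>l. (\<integral>x. \<bar>f x + h x - ev l x\<bar> \<partial>M) < e" by blast
  qed
  have approx_lim: "approx f" if f: "integrable M f" and cl: "\<And>e. e > 0 \<Longrightarrow> \<exists>h. approx h \<and> (\<integral>x. \<bar>f x - h x\<bar> \<partial>M) < e" for f
    unfolding approx_def
  proof (intro conjI allI impI f)
    fix e :: real assume "e > 0"
    then obtain h where h: "approx h" "(\<integral>x. \<bar>f x - h x\<bar> \<partial>M) < e / 2" using cl[of "e / 2"] by auto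
    then obtain l where l: "(\<integral>x. \<bar>h x - ev l x\<bar> \<partial>M) < e / 2"
      using \<open>e > 0\<close> unfolding approx_def by (metis half_gt_zero)
    have ih: "integrable M h" using h by (simp add: approx_def)
    have "(\<integral>x. \<bar>f x - ev l x\<bar> \<partial>M) \<le> (\<integral>x. \<bar>f x - h x\<bar> + \<bar>h x - ev l x\<bar> \<partial>M)"
      using f ih iev by (intro integral_mono) auto
    also have "\<dots> < e" using h(2) l f ih iev by simp
    finally show "\<exists>l. (\<integral>x. \<bar>f x - ev l x\<bar> \<partial>M) < e" by blast
  qed
  have approx_exact: "approx (ev l)" for l unfolding approx_def using iev by (auto intro!: exI[of _ l])
  have approx_cmult: "approx (\<lambda>x. c * f x)" if f: "approx f" for c f
  proof -
    have q: "approx (\<lambda>x. of_rat q * f x)" for q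
      unfolding approx_def
    proof (intro conjI allI impI)
      show "integrable M (\<lambda>x. of_rat q * f x)" using f by (simp add: approx_def)
      fix e :: real assume "e > 0"
      then have "e / (\<bar>of_rat q\<bar> + 1) > 0" by (simp add: add_nonneg_pos)
      then obtain l where l: "(\<integral>x. \<bar>f x - ev l x\<bar> \<partial>M) < e / (\<bar>of_rat q\<bar> + 1)" using f unfolding approx_def by blast
      have evq: "ev (map (\<lambda>(r, i). (q * r, i)) l) x = of_rat q * ev l x" for x
        by (induction l) (auto simp: ev_simps of_rat_mult algebra_simps)
      have "(\<integral>x. \<bar>of_rat q * f x - ev (map (\<lambda>(r, i). (q * r, i)) l) x\<bar> \<partial>M) = \<bar>of_rat q\<bar> * (\<integral>x. \<bar>f x - ev l x\<bar> \<partial>M)"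
        unfolding evq by (simp add: right_diff_distrib[symmetric] abs_mult)
      also have "\<dots> \<le> (\<bar>of_rat q\<bar> + 1) * (\<integral>x. \<bar>f x - ev l x\<bar> \<partial>M)" by (intro mult_right_mono) auto
      also have "\<dots> < e" using l by (simp add: pos_less_divide_eq add_nonneg_pos mult.commute)
      finally show "\<exists>l. (\<integral>x. \<bar>of_rat q * f x - ev l x\<bar> \<partial>M) < e" by blast
    qed
    show ?thesis
    proof (rule approx_lim)
      show "integrable M (\<lambda>x. c * f x)" using f by (simp add: approx_def)
      fix e :: real assume e: "e > 0"
      define I where "I = (\<integral>x. \<bar>f x\<bar> \<partial>M)"
      have I: "I \<ge> 0" unfolding I_def by simp
      obtain r where r: "r \<in> \<rat>" "c < r" "r < c + e / (I + 1)"
        using Rats_dense_in_real[of c "c + e / (I + 1)"] e I by (auto simp: divide_pos_pos add_nonneg_pos)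
      then obtain q where q': "r = of_rat q" by (auto elim: Rats_cases)
      have "(\<integral>x. \<bar>c * f x - of_rat q * f x\<bar> \<partial>M) = \<bar>c - r\<bar> * I"
        unfolding q' I_def by (simp add: left_diff_distrib[symmetric] abs_mult)
      also have "\<dots> \<le> \<bar>c - r\<bar> * (I + 1)" by (intro mult_left_mono) auto
      also have "\<dots> < e"
      proof -
        have "r - c < e / (I + 1)" "I + 1 > 0" using r I by auto
        then have "(r - c) * (I + 1) < e" by (simp add: pos_less_divide_eq)
        then show ?thesis using r by simp
      qed
      finally show "\<exists>h. approx h \<and> (\<integral>x. \<bar>c * f x - h x\<bar> \<partial>M) < e" using q by blast
    qed
  qed
  have ind: "approx (indicator A)" if "A \<in> sets M" for A
    using int sub that[unfolded gen]
  proof (induction rule: sigma_sets_induct_disjoint)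
    case (basic A)
    then obtain i where "A = C i" by blast
    then have "indicator A = ev [(1, i)]" by (auto simp: ev_simps fun_eq_iff)
    then show ?case using approx_exact by metis
  next
    case empty
    have "indicator {} = ev []" by (auto simp: ev_simps fun_eq_iff)
    then show ?case using approx_exact by metis
  next
    case (compl A)
    obtain i where i: "space M = C i" using top by blast
    have "approx (\<lambda>x. ev [(1, i)] x + (-1) * indicator A x)"
      by (intro approx_add approx_exact approx_cmult compl)
    moreover have "(\<lambda>x. ev [(1, i)] x + (-1) * indicator A x) = indicator (space M - A)"
      using sigma_sets_into_sp[OF sub compl(1)] by (auto simp: ev_simps fun_eq_iff i indicator_def)
    ultimately show ?case by simp
  next
    case (union A)
    have A: "A i \<in> sets M" for i using union(2) gen by auto
    have fin: "approx (\<lambda>x. \<Sum>i<n. indicator (A i) x)" for n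
    proof (induction n)
      case 0
      have "(\<lambda>x. \<Sum>i<0. indicator (A i) x) = ev []" by (simp add: ev_simps fun_eq_iff)
      then show ?case using approx_exact by simp
    next
      case (Suc n)
      then show ?case using approx_add[OF Suc union(3)[of n]] by simp
    qed
    show ?case
    proof (rule approx_lim)
      show "integrable M (indicat_real (\<Union> (range A)))"
        using A by (intro integrable_real_indicator) (auto simp: less_top[symmetric])
      fix e :: real assume e: "e > 0"
      have "(\<lambda>n. measure M (\<Union>i<n. A i)) \<longlonglongrightarrow> measure M (\<Union>n. \<Union>i<n. A i)"
        using A by (intro finite_Lim_measure_incseq monoI UN_mono) auto
      moreover have "(\<Union>n. \<Union>i<n. A i) = \<Union> (range A)" by blast
      ultimately have "(\<lambda>n. measure M (\<Union>i<n. A i)) \<longlonglongrightarrow> measure M (\<Union> (range A))" by simp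
      then have "\<forall>\<^sub>F n in sequentially. dist (measure M (\<Union>i<n. A i)) (measure M (\<Union> (range A))) < e"
        using e by (intro tendstoD) auto
      then obtain n where n: "dist (measure M (\<Union>i<n. A i)) (measure M (\<Union> (range A))) < e"
        by (auto simp: eventually_sequentially)
      have "\<bar>indicator (\<Union> (range A)) x - (\<Sum>i<n. indicator (A i) x)\<bar> = (indicator (\<Union> (range A) - (\<Union>i<n. A i)) x :: real)" for x
      proof -
        have "(\<Sum>i<n. indicator (A i) x) = (indicator (\<Union>i<n. A i) x :: real)"
          using union(1) by (intro indicator_UN_disjoint[symmetric]) (auto simp: disjoint_family_on_def)
        then show ?thesis by (auto simp: indicator_def)
      qed
      then have "(\<integral>x. \<bar>indicator (\<Union> (range A)) x - (\<Sum>i<n. indicator (A i) x)\<bar> \<partial>M) = measure M (\<Union> (range A) - (\<Union>i<n. A i))"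
        using A by simp
      also have "\<dots> = measure M (\<Union> (range A)) - measure M (\<Union>i<n. A i)"
        using A by (intro finite_measure_Diff) auto
      also have "\<dots> < e" using n unfolding dist_real_def by linarith
      finally show "\<exists>h. approx h \<and> (\<integral>x. \<bar>indicat_real (\<Union> (range A)) x - h x\<bar> \<partial>M) < e" using fin by blast
    qed
  qed
  have "approx g" using g
  proof (induction rule: integrable_L1_induct)
    case (indicator A c)
    then show ?case using approx_cmult[OF ind] by blast
  next
    case (add f h)
    then show ?case by (intro approx_add)
  next
    case (limit f)
    then show ?case by (intro approx_lim) blast+
  qed
  then show ?thesis using e unfolding approx_def ev_def by blast
qed

lemma sets_borel_of_base:
  assumes B: "enumerated_base T B"
  obtains C :: "nat \<Rightarrow> 'a set" where "sets (borel_of T) = sigma_sets (topspace T) (range C)"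
    "Int_stable (range C)" "topspace T \<in> range C" "range C \<subseteq> Pow (topspace T)"
proof -
  define C where "C n = topspace T \<inter> (\<Inter>i\<in>set (from_nat n :: nat list). B i)" for n
  have Cl: "C (to_nat l) = topspace T \<inter> (\<Inter>i\<in>set l. B i)" for l by (simp add: C_def)
  have op: "openin T (C n)" for n
  proof -
    have "openin T (topspace T \<inter> (\<Inter>i\<in>set l. B i))" for l
    proof (induction l)
      case (Cons a l)
      have "topspace T \<inter> (\<Inter>i\<in>set (a # l). B i) = B a \<inter> (topspace T \<inter> (\<Inter>i\<in>set l. B i))" by auto
      then show ?case using Cons enumerated_baseD(1)[OF B] by (simp add: openin_Int)
    qed simp
    then show ?thesis by (simp add: C_def)
  qed
  have "sets (borel_of T) = sigma_sets (topspace T) (range C)"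
    unfolding sets_borel_of
  proof (rule sigma_sets_eqI)
    fix U assume "U \<in> {U. openin T U}"
    then have U: "openin T U" by simp
    have "U = (\<Union>i\<in>{i. B i \<subseteq> U}. C (to_nat [i]))"
      unfolding Cl using enumerated_baseD(2)[OF B U] openin_subset[OF U] by fastforce
    also have "\<dots> \<in> sigma_sets (topspace T) (range C)"
      by (rule sigma_algebra.countable_UN'[OF sigma_algebra_sigma_sets])
         (use openin_subset[OF op] in \<open>auto intro: sigma_sets.Basic\<close>)
    finally show "U \<in> sigma_sets (topspace T) (range C)" .
  next
    fix A assume "A \<in> range C"
    then show "A \<in> sigma_sets (topspace T) {U. openin T U}" using op by (auto intro: sigma_sets.Basic)
  qed
  moreover have "Int_stable (range C)"
  proof (rule Int_stableI)
    fix a b assume "a \<in> range C" "b \<in> range C"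
    then obtain n m where ab: "a = C n" "b = C m" by blast
    have "a \<inter> b = C (to_nat ((from_nat n :: nat list) @ from_nat m))" unfolding Cl unfolding ab C_def by auto
    then show "a \<inter> b \<in> range C" by blast
  qed
  moreover have "topspace T \<in> range C" using Cl[of "[]"] by (metis Inter_empty image_empty inf_top_right list.set(1) rangeI)
  moreover have "range C \<subseteq> Pow (topspace T)" by (auto simp: C_def)
  ultimately show ?thesis by (rule that)
qed

definition unit_ball_functions :: "'a topology \<Rightarrow> ('a \<Rightarrow> real) set" where
  "unit_ball_functions T = {f \<in> borel_measurable (borel_of T). \<forall>x. \<bar>f x\<bar> \<le> 1}"

text \<open>
  Continuity of the right translates of \<open>\<mu>\<close> against each test function improves to continuity in total
  variation. All translates have a density with respect to a mixture \<open>\<rho>\<close> of countably many of them, so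
  they lie in the separable space \<open>L\<^sup>1(\<rho>)\<close>. For each element \<open>s\<close> of a countable dense subset, the points
  \<open>k\<close> whose translate is within \<open>e / 2\<close> of \<open>s \<rho>\<close> form a closed set, being cut out by conditions that are
  continuous in \<open>k\<close>. These sets cover the group, so by Baire's theorem one of them has an interior
  point \<open>k0\<close>, and translating \<open>k0\<close> to the unit gives the claim.
\<close>

lemma translation_continuity_in_variation:
  fixes T :: "'g topology"
  assumes grp: "group G" and car: "topspace T = carrier G"
    and rm: "\<And>a. a \<in> carrier G \<Longrightarrow> continuous_map T T (\<lambda>g. g \<otimes>\<^bsub>G\<^esub> a)"
    and L: "locally_compact_space T" and reg: "regular_space T" and SC: "second_countable T"
    and \<mu>: "prob_space \<mu>" "sets \<mu> = sets (borel_of T)"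
    and cont: "\<And>f. f \<in> unit_ball_functions T \<Longrightarrow>
       continuous_map T euclideanreal (\<lambda>k. \<integral>\<gamma>. f (\<gamma> \<otimes>\<^bsub>G\<^esub> k) \<partial>\<mu>)"
    and e: "e > 0"
  shows "\<exists>V. openin T V \<and> \<one>\<^bsub>G\<^esub> \<in> V \<and>
    (\<forall>k\<in>V. \<forall>f\<in>unit_ball_functions T. \<bar>(\<integral>\<gamma>. f (\<gamma> \<otimes>\<^bsub>G\<^esub> k) \<partial>\<mu>) - (\<integral>\<gamma>. f \<gamma> \<partial>\<mu>)\<bar> \<le> e)"
proof -
  interpret group G by (rule grp)
  interpret \<mu>: prob_space \<mu> by (rule \<mu>(1))
  let ?B = "borel_of T"
  have sp\<mu>: "space \<mu> = carrier G" using sets_eq_imp_space_eq[OF \<mu>(2)] car by simp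
  obtain B where B: "enumerated_base T B" using second_countable_enumeration[OF SC] .
  obtain Dn where Dn: "countable Dn" "Dn \<subseteq> topspace T" "T closure_of Dn = topspace T"
    using second_countable_imp_separable_space[OF SC] unfolding separable_space_def by blast
  have "Dn \<noteq> {}" using Dn(3) car one_closed by auto
  define h where "h = from_nat_into Dn"
  have rh: "range h = Dn" unfolding h_def by (rule range_from_nat_into[OF \<open>Dn \<noteq> {}\<close> Dn(1)])
  have hG: "h i \<in> carrier G" for i using rh Dn(2) car by blast
  have tm: "(\<lambda>\<gamma>. \<gamma> \<otimes>\<^bsub>G\<^esub> k) \<in> \<mu> \<rightarrow>\<^sub>M ?B" if "k \<in> carrier G" for k
    using continuous_map_measurable[OF rm[OF that]] measurable_cong_sets[OF \<mu>(2) refl] by blast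
  define m where "m k = distr \<mu> ?B (\<lambda>\<gamma>. \<gamma> \<otimes>\<^bsub>G\<^esub> k)" for k
  have pm: "prob_space (m k)" if "k \<in> carrier G" for k unfolding m_def by (rule \<mu>.prob_space_distr[OF tm[OF that]])
  have sm: "sets (m k) = sets ?B" "space (m k) = topspace T" for k unfolding m_def by auto
  have intm: "(\<integral>\<gamma>. f (\<gamma> \<otimes>\<^bsub>G\<^esub> k) \<partial>\<mu>) = (\<integral>x. f x \<partial>m k)" if "k \<in> carrier G" "f \<in> borel_measurable ?B" for k and f :: "'g \<Rightarrow> real"
    unfolding m_def using integral_distr[OF tm[OF that(1)] that(2)] by simp
  (* charges every term of the dense sequence h *)
  let ?p = "measure_pmf (geometric_pmf (1/2))"
  define \<rho> where "\<rho> = ?p \<bind> (\<lambda>i. m (h i))"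
  have km: "(\<lambda>i. m (h i)) \<in> ?p \<rightarrow>\<^sub>M subprob_algebra ?B"
    using pm[OF hG] sm by (intro measurableI) (auto simp: space_subprob_algebra prob_space_imp_subprob_space)
  have s\<rho>: "sets \<rho> = sets ?B" unfolding \<rho>_def by (rule sets_bind) (use sm in auto)
  have sp\<rho>: "space \<rho> = topspace T" using sets_eq_imp_space_eq[OF s\<rho>] by simp
  have em\<rho>: "emeasure \<rho> E = (\<integral>\<^sup>+ i. emeasure (m (h i)) E \<partial>?p)" if "E \<in> sets ?B" for E
    unfolding \<rho>_def by (rule emeasure_bind[OF _ km that]) simp
  have "emeasure \<rho> (space \<rho>) = (\<integral>\<^sup>+ i. 1 \<partial>?p)"
  proof -
    have "emeasure (m (h i)) (space \<rho>) = 1" for i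
      using prob_space.emeasure_space_1[OF pm[OF hG[of i]]] by (simp add: sm sp\<rho>)
    then show ?thesis using em\<rho>[of "space \<rho>"] s\<rho> by (metis (no_types, lifting) nn_integral_cong sets.top)
  qed
  then have fin\<rho>: "finite_measure \<rho>" by (intro finite_measureI) simp
  interpret \<rho>: finite_measure \<rho> by (rule fin\<rho>)
  have ac: "absolutely_continuous \<rho> (m k)" if k: "k \<in> carrier G" for k
    unfolding absolutely_continuous_def
  proof
    fix E assume "E \<in> null_sets \<rho>"
    then have E: "E \<in> sets ?B" "emeasure \<rho> E = 0" using s\<rho> by auto
    have indE: "indicator E \<in> unit_ball_functions T" using E(1) by (auto simp: unit_ball_functions_def indicator_def intro!: borel_measurable_indicator)
    have mE: "(\<integral>\<gamma>. indicator E (\<gamma> \<otimes>\<^bsub>G\<^esub> k) \<partial>\<mu>) = measure (m k) E" if "k \<in> carrier G" for k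
      using intm[OF that, of "indicator E"] E(1) sets.sets_into_space[OF E(1)] by (simp add: sm Int_absorb2)
    have "AE i in ?p. emeasure (m (h i)) E = 0"
    proof -
      have "(\<integral>\<^sup>+ i. emeasure (m (h i)) E \<partial>?p) = 0" using E em\<rho>[OF E(1)] by simp
      then show ?thesis by (subst (asm) nn_integral_0_iff_AE) auto
    qed
    then have z: "measure (m (h i)) E = 0" for i
      by (simp add: AE_measure_pmf_iff set_pmf_geometric measure_def)
    have "closedin T {k \<in> topspace T. (\<integral>\<gamma>. indicat_real E (\<gamma> \<otimes>\<^bsub>G\<^esub> k) \<partial>\<mu>) \<in> {0}}"
      by (rule closedin_continuous_map_preimage[OF cont[OF indE]]) simp
    moreover have "Dn \<subseteq> {k \<in> topspace T. (\<integral>\<gamma>. indicat_real E (\<gamma> \<otimes>\<^bsub>G\<^esub> k) \<partial>\<mu>) \<in> {0}}"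
      using z mE hG rh car by auto
    ultimately have "T closure_of Dn \<subseteq> {k \<in> topspace T. (\<integral>\<gamma>. indicat_real E (\<gamma> \<otimes>\<^bsub>G\<^esub> k) \<partial>\<mu>) \<in> {0}}"
      by (intro closure_of_minimal)
    then have "measure (m k) E = 0" using k car Dn(3) mE[OF k] by auto
    then show "E \<in> null_sets (m k)"
      using E(1) sm finite_measure.emeasure_eq_measure[OF prob_space.finite_measure[OF pm[OF k]]] by (auto simp: null_sets_def)
  qed
  obtain C :: "nat \<Rightarrow> 'g set" where C: "sets (borel_of T) = sigma_sets (topspace T) (range C)"
    "Int_stable (range C)" "topspace T \<in> range C" "range C \<subseteq> Pow (topspace T)"
    using sets_borel_of_base[OF B] .
  define ev :: "(rat \<times> nat) list \<Rightarrow> 'g \<Rightarrow> real" where "ev l x = (\<Sum>(q, i)\<leftarrow>l. of_rat q * indicator (C i) x)" for l x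
  let ?F = "unit_ball_functions T"
  have Fm: "f \<in> borel_measurable ?B" "f \<in> borel_measurable \<rho>" "\<bar>f x\<bar> \<le> 1" if "f \<in> ?F" for f x
    using that measurable_cong_sets[OF s\<rho> refl] by (auto simp: unit_ball_functions_def)
  define K where "K l = {k \<in> topspace T. \<forall>f\<in>?F. \<bar>(\<integral>\<gamma>. f (\<gamma> \<otimes>\<^bsub>G\<^esub> k) \<partial>\<mu>) - (\<integral>x. f x * ev l x \<partial>\<rho>)\<bar> \<le> e / 2}" for l
  have CB: "C i \<in> sets ?B" for i unfolding C(1) by auto
  have ev\<rho>: "integrable \<rho> (ev l)" for l
  proof (induction l)
    case Nil
    have "ev [] = (\<lambda>x. 0)" by (simp add: ev_def fun_eq_iff)
    then show ?case by simp
  next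
    case (Cons p l)
    have "ev (p # l) = (\<lambda>x. of_rat (fst p) * indicator (C (snd p)) x + ev l x)" by (simp add: ev_def fun_eq_iff case_prod_unfold)
    moreover have "integrable \<rho> (\<lambda>x. of_rat (fst p) * indicator (C (snd p)) x + ev l x)"
      using CB s\<rho> by (intro Bochner_Integration.integrable_add Cons integrable_mult_right integrable_real_indicator)
        (auto simp: less_top[symmetric])
    ultimately show ?case by simp
  qed
  have closed: "closedin T (K l)" for l
  proof -
    have "closedin T {k \<in> topspace T. (\<integral>\<gamma>. f (\<gamma> \<otimes>\<^bsub>G\<^esub> k) \<partial>\<mu>) \<in> {v. \<bar>v - (\<integral>x. f x * ev l x \<partial>\<rho>)\<bar> \<le> e / 2}}" if "f \<in> ?F" for f
      by (rule closedin_continuous_map_preimage[OF cont[OF that]])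
        (auto intro!: closed_Collect_le continuous_intros)
    moreover have "(\<lambda>x. 0) \<in> ?F" by (simp add: unit_ball_functions_def)
    then have "?F \<noteq> {}" by blast
    ultimately have "closedin T (\<Inter>f\<in>?F. {k \<in> topspace T. (\<integral>\<gamma>. f (\<gamma> \<otimes>\<^bsub>G\<^esub> k) \<partial>\<mu>) \<in> {v. \<bar>v - (\<integral>x. f x * ev l x \<partial>\<rho>)\<bar> \<le> e / 2}})"
      by (intro closedin_INT) auto
    moreover have "(\<Inter>f\<in>?F. {k \<in> topspace T. (\<integral>\<gamma>. f (\<gamma> \<otimes>\<^bsub>G\<^esub> k) \<partial>\<mu>) \<in> {v. \<bar>v - (\<integral>x. f x * ev l x \<partial>\<rho>)\<bar> \<le> e / 2}}) = K l"
      using \<open>?F \<noteq> {}\<close> unfolding K_def by auto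
    ultimately show ?thesis by simp
  qed
  have cover: "\<exists>l. k \<in> K l" if k: "k \<in> topspace T" for k
  proof -
    have kG: "k \<in> carrier G" using k car by simp
    obtain d where d: "d \<in> borel_measurable \<rho>" "density \<rho> d = m k"
      using \<rho>.Radon_Nikodym[OF ac[OF kG]] sm s\<rho> by auto
    have tot: "(\<integral>\<^sup>+ x. d x \<partial>\<rho>) = 1"
    proof -
      have "(\<integral>\<^sup>+ x. d x \<partial>\<rho>) = (\<integral>\<^sup>+ x. d x * indicator (space \<rho>) x \<partial>\<rho>)" by (rule nn_integral_cong) simp
      also have "\<dots> = emeasure (density \<rho> d) (space \<rho>)" by (rule emeasure_density[symmetric]) (use d in auto)
      also have "\<dots> = 1" unfolding d(2) sp\<rho> using prob_space.emeasure_space_1[OF pm[OF kG]] by (simp add: sm)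
      finally show ?thesis .
    qed
    define g where "g x = enn2real (d x)" for x
    have gm: "g \<in> borel_measurable \<rho>" unfolding g_def using d(1) by measurable
    have "AE x in \<rho>. d x \<noteq> \<infinity>" by (rule nn_integral_PInf_AE[OF d(1)]) (simp add: tot)
    then have AEg: "AE x in \<rho>. d x = ennreal (g x)" by (rule AE_mp) (auto simp: g_def less_top)
    have mk: "m k = density \<rho> (\<lambda>x. ennreal (g x))"
      unfolding d(2)[symmetric] by (rule density_cong) (use d(1) gm AEg in auto)
    have gi: "integrable \<rho> g"
    proof (rule integrableI_nonneg[OF gm])
      show "AE x in \<rho>. 0 \<le> g x" by (simp add: g_def)
      have "(\<integral>\<^sup>+ x. ennreal (g x) \<partial>\<rho>) = (\<integral>\<^sup>+ x. d x \<partial>\<rho>)" by (rule nn_integral_cong_AE) (use AEg in auto)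
      then show "(\<integral>\<^sup>+ x. ennreal (g x) \<partial>\<rho>) < \<infinity>" by (simp add: tot)
    qed
    have "e / 2 > 0" using e by simp
    then obtain l where l: "(\<integral>x. \<bar>g x - ev l x\<bar> \<partial>\<rho>) < e / 2"
      using rational_combinations_dense_L1[OF fin\<rho>, of C g "e / 2"] C gi unfolding ev_def s\<rho> sp\<rho> by blast
    have "\<bar>(\<integral>\<gamma>. f (\<gamma> \<otimes>\<^bsub>G\<^esub> k) \<partial>\<mu>) - (\<integral>x. f x * ev l x \<partial>\<rho>)\<bar> \<le> e / 2" if f: "f \<in> ?F" for f
    proof -
      have ig: "integrable \<rho> (\<lambda>x. f x * u x)" if "integrable \<rho> u" for u
        by (rule Bochner_Integration.integrable_bound[OF that]) (use Fm[OF f] that in \<open>auto simp: abs_mult intro!: AE_I2 mult_left_le_one_le\<close>)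
      have "(\<integral>\<gamma>. f (\<gamma> \<otimes>\<^bsub>G\<^esub> k) \<partial>\<mu>) = (\<integral>x. f x * g x \<partial>\<rho>)"
        unfolding intm[OF kG Fm(1)[OF f]] mk
        by (subst integral_density) (use Fm[OF f] gm in \<open>auto simp: g_def mult.commute\<close>)
      then have "(\<integral>\<gamma>. f (\<gamma> \<otimes>\<^bsub>G\<^esub> k) \<partial>\<mu>) - (\<integral>x. f x * ev l x \<partial>\<rho>) = (\<integral>x. f x * (g x - ev l x) \<partial>\<rho>)"
        using ig[OF gi] ig[OF ev\<rho>] by (simp add: right_diff_distrib)
      also have "\<bar>\<dots>\<bar> \<le> (\<integral>x. \<bar>f x * (g x - ev l x)\<bar> \<partial>\<rho>)" by (rule integral_abs_bound)
      also have "\<dots> \<le> (\<integral>x. \<bar>g x - ev l x\<bar> \<partial>\<rho>)"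
      proof (rule integral_mono)
        show "integrable \<rho> (\<lambda>x. \<bar>f x * (g x - ev l x)\<bar>)"
          using ig[of "\<lambda>x. g x - ev l x"] gi ev\<rho> by (intro integrable_abs) auto
      qed (use gi ev\<rho> Fm(3)[OF f] in \<open>auto simp: abs_mult intro!: mult_left_le_one_le\<close>)
      finally show ?thesis using l by simp
    qed
    then show ?thesis using k unfolding K_def by blast
  qed
  have "\<exists>l. T interior_of (K l) \<noteq> {}"
  proof (rule ccontr)
    assume "\<not> ?thesis"
    then have "T interior_of \<Union> (range K) = {}"
      using L reg closed by (intro Baire_category_alt) auto
    moreover have "\<Union> (range K) = topspace T" using cover unfolding K_def by blast
    ultimately show False using car one_closed interior_of_topspace[of T] by auto
  qed
  then obtain l k0 where k0: "k0 \<in> T interior_of (K l)" by blast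
  let ?U = "T interior_of (K l)"
  have UK: "?U \<subseteq> K l" by (rule interior_of_subset)
  have k0G: "k0 \<in> carrier G" using k0 UK car unfolding K_def by blast
  let ?V = "{k \<in> topspace T. k \<otimes>\<^bsub>G\<^esub> k0 \<in> ?U}"
  have "openin T ?V" by (rule openin_continuous_map_preimage[OF rm[OF k0G]]) simp
  moreover have "\<one>\<^bsub>G\<^esub> \<in> ?V" using k0 k0G car by simp
  moreover have "\<bar>(\<integral>\<gamma>. f (\<gamma> \<otimes>\<^bsub>G\<^esub> k) \<partial>\<mu>) - (\<integral>\<gamma>. f \<gamma> \<partial>\<mu>)\<bar> \<le> e" if k: "k \<in> ?V" and f: "f \<in> ?F" for k f
  proof -
    have kG: "k \<in> carrier G" using k car by simp
    define f' where "f' x = (if x \<in> carrier G then f (x \<otimes>\<^bsub>G\<^esub> inv\<^bsub>G\<^esub> k0) else 0)" for x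
    have "(\<lambda>x. f (x \<otimes>\<^bsub>G\<^esub> inv\<^bsub>G\<^esub> k0)) \<in> borel_measurable ?B"
      by (rule measurable_compose[OF continuous_map_measurable[OF rm] Fm(1)[OF f]]) (use k0G in simp)
    then have "f' \<in> borel_measurable ?B"
      by (rule measurable_cong[THEN iffD1, rotated]) (simp add: f'_def car)
    then have f': "f' \<in> ?F" using Fm(3)[OF f] by (simp add: unit_ball_functions_def f'_def)
    have e1: "(\<integral>\<gamma>. f' (\<gamma> \<otimes>\<^bsub>G\<^esub> (k \<otimes>\<^bsub>G\<^esub> k0)) \<partial>\<mu>) = (\<integral>\<gamma>. f (\<gamma> \<otimes>\<^bsub>G\<^esub> k) \<partial>\<mu>)"
      by (rule Bochner_Integration.integral_cong[OF refl]) (use kG k0G sp\<mu> in \<open>simp add: f'_def m_assoc\<close>)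
    have e2: "(\<integral>\<gamma>. f' (\<gamma> \<otimes>\<^bsub>G\<^esub> k0) \<partial>\<mu>) = (\<integral>\<gamma>. f \<gamma> \<partial>\<mu>)"
      by (rule Bochner_Integration.integral_cong[OF refl]) (use k0G sp\<mu> in \<open>simp add: f'_def m_assoc\<close>)
    have "k \<otimes>\<^bsub>G\<^esub> k0 \<in> K l" "k0 \<in> K l" using k k0 UK by auto
    then have "\<bar>(\<integral>\<gamma>. f (\<gamma> \<otimes>\<^bsub>G\<^esub> k) \<partial>\<mu>) - (\<integral>x. f' x * ev l x \<partial>\<rho>)\<bar> \<le> e / 2"
      "\<bar>(\<integral>\<gamma>. f \<gamma> \<partial>\<mu>) - (\<integral>x. f' x * ev l x \<partial>\<rho>)\<bar> \<le> e / 2"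
      using f' e1 e2 unfolding K_def by auto
    then show ?thesis by linarith
  qed
  ultimately show ?thesis by blast
qed

lemma measure_has_support_point:
  assumes SC: "second_countable T" and M: "sets M = sets (borel_of T)" "emeasure M (space M) \<noteq> 0"
  obtains p where "p \<in> topspace T" "\<And>U. openin T U \<Longrightarrow> p \<in> U \<Longrightarrow> emeasure M U \<noteq> 0"
proof -
  have sp: "space M = topspace T" using sets_eq_imp_space_eq[OF M(1)] by simp
  obtain B where B: "enumerated_base T B" using second_countable_enumeration[OF SC] .
  let ?N = "\<Union>i\<in>{i. emeasure M (B i) = 0}. B i"
  have "?N \<in> null_sets M"
    using enumerated_baseD(1)[OF B] M(1) by (intro null_sets_UN') (auto simp: null_sets_def borel_of_open)
  then have "?N \<noteq> space M" using M(2) by (metis null_setsD1)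
  moreover have "?N \<subseteq> topspace T" using openin_subset[OF enumerated_baseD(1)[OF B]] by blast
  ultimately obtain p where p: "p \<in> topspace T" "p \<notin> ?N" using sp by blast
  show ?thesis
  proof (rule that[OF p(1)])
    fix U assume U: "openin T U" "p \<in> U"
    obtain i where i: "p \<in> B i" "B i \<subseteq> U" using enumerated_baseD(2)[OF B U] by blast
    have "emeasure M (B i) \<noteq> 0" using i(1) p(2) by blast
    moreover have "emeasure M (B i) \<le> emeasure M U" using i(2) U M(1) by (intro emeasure_mono) (auto simp: borel_of_open)
    ultimately show "emeasure M U \<noteq> 0" by auto
  qed
qed

section \<open>Equivariant diffusions and the limit of the group component\<close>

locale equivariant_diffusion = G: group G
  for MX :: "'x manifold" and G :: "('g, 'b) monoid_scheme" (structure) and MG :: "'g manifold"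
    and L :: "('x \<times> 'g \<Rightarrow> real) \<Rightarrow> 'x \<times> 'g \<Rightarrow> real"
    and P :: "'x \<times> 'g \<Rightarrow> (real \<Rightarrow> 'x \<times> 'g) measure" +
  assumes MX: "smooth_manifold MX" and lie: "lie_group G MG"
    and diff: "diffusion_with_generator (mprod MX MG) L P"
    and convergence: "convergence_condition MX MG P"
    and equivariance: "equivariance_condition MX G MG L"
    and regularity: "regularity_condition MX MG P"
begin

abbreviation TX where "TX \<equiv> mtop MX"
abbreviation TG where "TG \<equiv> mtop MG"
abbreviation S where "S \<equiv> prod_topology TX TG"

lemma MG: "smooth_manifold MG" and car: "topspace TG = carrier G"
  using lie by (auto simp: lie_group_def)

sublocale markov_family S P
  using diff by unfold_locales (simp add: diffusion_with_generator_def mprod_simps)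

lemmas TX_top = smooth_manifold_topology[OF MX] and TG_top = smooth_manifold_topology[OF MG]

lemma mult_cont: "continuous_map (prod_topology TG TG) TG (\<lambda>(g, h). g \<otimes> h)"
  by (rule lie_group_mult_continuous[OF lie])

lemma inv_cont: "continuous_map TG TG (\<lambda>g. inv g)"
  using lie by (simp add: lie_group_def smooth_map_def)

lemma right_mult_cont: "a \<in> carrier G \<Longrightarrow> continuous_map TG TG (\<lambda>g. g \<otimes> a)"
proof -
  assume a: "a \<in> carrier G"
  have "continuous_map TG (prod_topology TG TG) (\<lambda>g. (g, a))" using a car by (simp add: continuous_map_pairwise o_def)
  from continuous_map_compose[OF this mult_cont] show ?thesis by (simp add: o_def)
qed

lemma left_mult_cont: "a \<in> carrier G \<Longrightarrow> continuous_map TG TG (\<lambda>g. a \<otimes> g)"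
  by (rule lie_group_left_mult_continuous[OF lie])

lemma harmonic_continuous: "harmonic S P H \<Longrightarrow> continuous_map S euclideanreal H"
  using regularity by (simp add: regularity_condition_def mprod_simps)

definition left_path :: "'g \<Rightarrow> (real \<Rightarrow> 'x \<times> 'g) \<Rightarrow> real \<Rightarrow> 'x \<times> 'g" where
  "left_path a = map_path (left_mult_state G a)"

lemma left_mult_state_cont: "a \<in> carrier G \<Longrightarrow> continuous_map S S (left_mult_state G a)"
  by (rule left_mult_state_continuous[OF lie])

lemma left_path_measurable: "a \<in> carrier G \<Longrightarrow> left_path a \<in> path_borel S \<rightarrow>\<^sub>M path_borel S"
  unfolding left_path_def by (intro map_path_measurable left_mult_state_cont)

lemma left_path_P: "a \<in> carrier G \<Longrightarrow> z \<in> topspace S \<Longrightarrow> left_path a \<in> P z \<rightarrow>\<^sub>M path_borel S"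
  using left_path_measurable measurable_cong_sets[OF sets_P refl] by blast

lemma left_path_paths: "a \<in> carrier G \<Longrightarrow> \<omega> \<in> paths S \<Longrightarrow> left_path a \<omega> \<in> paths S"
  unfolding left_path_def by (rule map_path_paths[OF left_mult_state_cont])

lemma left_path_at: "t \<ge> 0 \<Longrightarrow> left_path a \<omega> t = (fst (\<omega> t), a \<otimes> snd (\<omega> t))"
  by (simp add: left_path_def map_path_simps left_mult_state_def case_prod_unfold)

lemma left_law:
  assumes "a \<in> carrier G" "x \<in> topspace TX" "g \<in> carrier G"
  shows "P (x, a \<otimes> g) = distr (P (x, g)) (path_borel S) (left_path a)"
  using left_equivariant_law[OF MX lie assms(1) diff equivariance, of "(x, g)"] assms car
  by (simp add: mprod_simps left_mult_state_simps left_path_def)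

definition ginf :: "(real \<Rightarrow> 'x \<times> 'g) \<Rightarrow> 'g" where
  "ginf \<omega> = end_limit TG (\<lambda>t. snd (\<omega> t))"

lemma ginf_measurable: "ginf \<in> inv_sigma S (borel_of S) (\<lambda>t \<omega>. \<omega> t) \<rightarrow>\<^sub>M borel_of TG"
proof -
  have "ginf \<in> inv_sigma S (borel_of TG) (\<lambda>t \<omega>. snd (\<omega> t)) \<rightarrow>\<^sub>M borel_of TG"
    unfolding ginf_def
    by (rule end_limit_measurable[OF TG_top(1,3,2) _ continuous_map_snd]) (use car in auto)
  then show ?thesis
    by (rule measurable_from_subalg[rotated])
      (use Inv_factor_mono[OF continuous_map_snd, of TX TG] in \<open>auto simp: subalgebra_def\<close>)
qed

lemma ginf_carrier: "\<omega> \<in> paths S \<Longrightarrow> ginf \<omega> \<in> carrier G"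
  using measurable_space[OF ginf_measurable] car by simp

lemma ginf_path_borel: "ginf \<in> path_borel S \<rightarrow>\<^sub>M borel_of TG"
proof (cases "topspace S = {}")
  case True
  have "paths S = {}" using pathsD(1)[of _ S 0] True by force
  then show ?thesis by (simp add: measurable_def)
next
  case False
  show ?thesis by (rule measurable_from_subalg[OF subalgebra_inv_sigma[OF refl False] ginf_measurable])
qed

lemma AE_converges:
  assumes "z \<in> topspace S"
  shows "AE \<omega> in P z. limitin TG (\<lambda>t. snd (\<omega> t)) (ginf \<omega>) at_top"
proof -
  obtain l where "AE \<omega> in P z. limitin TG (\<lambda>t. snd (\<omega> t)) (l \<omega>) at_top"
    using convergence assms unfolding convergence_condition_def AE_limit_def by (cases z) auto
  then show ?thesis
    by (rule AE_mp) (auto simp: ginf_def end_limit_eq[OF TG_top(1)])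
qed

lemma ginf_left_path:
  assumes a: "a \<in> carrier G" and l: "limitin TG (\<lambda>t. snd (\<omega> t)) (ginf \<omega>) at_top"
  shows "ginf (left_path a \<omega>) = a \<otimes> ginf \<omega>"
proof -
  have "limitin TG ((\<lambda>g. a \<otimes> g) \<circ> (\<lambda>t. snd (\<omega> t))) (a \<otimes> ginf \<omega>) at_top"
    by (rule continuous_map_limit[OF left_mult_cont[OF a] l])
  then have "limitin TG (\<lambda>t. snd (left_path a \<omega> t)) (a \<otimes> ginf \<omega>) at_top"
    by (rule limitin_transform_eventually[rotated])
      (auto intro: eventually_mono[OF eventually_ge_at_top[of 0]] simp: left_path_at)
  then show ?thesis unfolding ginf_def by (rule end_limit_eq[OF TG_top(1)])
qed

text \<open>
  Let \<open>\<mu>0\<close> be the law of \<open>inv (ginf \<omega>)\<close> for paths started at \<open>(x, \<one>)\<close>. Starting from \<open>(x, inv k)\<close> instead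
  multiplies \<open>ginf\<close> by \<open>inv k\<close> on the left, hence its inverse by \<open>k\<close> on the right; so the integral of \<open>f\<close>
  against the right translate of \<open>\<mu>0\<close> by \<open>k\<close> is the value at \<open>(x, inv k)\<close> of a harmonic function, which is
  continuous by the regularity condition. Finally \<open>\<mu>0\<close> is translated on the left, which commutes
  with all this, so as to bring a point \<open>p\<close> of its support to the unit.
\<close>

lemma smoothing_measure:
  assumes x: "x \<in> topspace TX"
  obtains \<mu> where "prob_space \<mu>" "sets \<mu> = sets (borel_of TG)"
    "\<And>U. openin TG U \<Longrightarrow> \<one> \<in> U \<Longrightarrow> emeasure \<mu> U \<noteq> 0"
    "\<And>e. e > 0 \<Longrightarrow> \<exists>V. openin TG V \<and> \<one> \<in> V \<and>
       (\<forall>k\<in>V. \<forall>f\<in>unit_ball_functions TG. \<bar>(\<integral>\<gamma>. f (\<gamma> \<otimes> k) \<partial>\<mu>) - (\<integral>\<gamma>. f \<gamma> \<partial>\<mu>)\<bar> \<le> e)"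
proof -
  let ?B = "borel_of TG"
  have z1: "(x, g) \<in> topspace S" if "g \<in> carrier G" for g using x that car by simp
  interpret P1: prob_space "P (x, \<one>)" by (rule prob_space_P[OF z1]) simp
  have spP: "space (P (x, \<one>)) = paths S" by (rule space_P[OF z1]) simp
  have gm: "ginf \<in> P z \<rightarrow>\<^sub>M ?B" if "z \<in> topspace S" for z
    using ginf_path_borel measurable_cong_sets[OF sets_P[OF that] refl] by blast
  have ginv: "(\<lambda>\<omega>. inv (ginf \<omega>)) \<in> P (x, \<one>) \<rightarrow>\<^sub>M ?B"
    by (rule measurable_compose[OF gm continuous_map_measurable[OF inv_cont]]) (rule z1, simp)
  define \<mu>0 where "\<mu>0 = distr (P (x, \<one>)) ?B (\<lambda>\<omega>. inv (ginf \<omega>))"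
  interpret \<mu>0: prob_space \<mu>0 unfolding \<mu>0_def by (rule P1.prob_space_distr[OF ginv])
  have s0: "sets \<mu>0 = sets ?B" "space \<mu>0 = carrier G" unfolding \<mu>0_def by (auto simp: car)
  obtain p where p: "p \<in> topspace TG" "\<And>U. openin TG U \<Longrightarrow> p \<in> U \<Longrightarrow> emeasure \<mu>0 U \<noteq> 0"
    using measure_has_support_point[OF TG_top(2) s0(1)] \<mu>0.emeasure_space_1 by auto
  have pG: "p \<in> carrier G" "inv p \<in> carrier G" using p(1) car by auto
  have lm: "(\<lambda>\<gamma>. inv p \<otimes> \<gamma>) \<in> \<mu>0 \<rightarrow>\<^sub>M ?B"
    using continuous_map_measurable[OF left_mult_cont[OF pG(2)]] measurable_cong_sets[OF s0(1) refl] by blast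
  define \<mu> where "\<mu> = distr \<mu>0 ?B (\<lambda>\<gamma>. inv p \<otimes> \<gamma>)"
  have \<mu>: "prob_space \<mu>" unfolding \<mu>_def by (rule \<mu>0.prob_space_distr[OF lm])
  have s\<mu>: "sets \<mu> = sets ?B" unfolding \<mu>_def by simp
  have int: "(\<integral>\<gamma>. f (\<gamma> \<otimes> k) \<partial>\<mu>) = (\<integral>\<omega>. f (inv p \<otimes> inv (ginf \<omega>) \<otimes> k) \<partial>P (x, \<one>))"
    if f: "f \<in> borel_measurable ?B" and k: "k \<in> carrier G" for f :: "'g \<Rightarrow> real" and k
  proof -
    have fk: "(\<lambda>\<gamma>. f (\<gamma> \<otimes> k)) \<in> borel_measurable ?B"
      by (rule measurable_compose[OF continuous_map_measurable[OF right_mult_cont[OF k]] f])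
    have fk': "(\<lambda>\<gamma>. f (inv p \<otimes> \<gamma> \<otimes> k)) \<in> borel_measurable ?B"
      by (rule measurable_compose[OF continuous_map_measurable[OF left_mult_cont[OF pG(2)]] fk])
    show ?thesis unfolding \<mu>_def integral_distr[OF lm fk] unfolding \<mu>0_def by (rule integral_distr[OF ginv fk'])
  qed
  have cont: "continuous_map TG euclideanreal (\<lambda>k. \<integral>\<gamma>. f (\<gamma> \<otimes> k) \<partial>\<mu>)" if f: "f \<in> unit_ball_functions TG" for f
  proof -
    have fm: "f \<in> borel_measurable ?B" and fb: "\<And>y. \<bar>f y\<bar> \<le> 1" using f by (auto simp: unit_ball_functions_def)
    let ?f = "\<lambda>g. f (inv p \<otimes> inv g)"
    let ?H = "\<lambda>z. \<integral>\<omega>. ?f (ginf \<omega>) \<partial>P z"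
    have fm': "?f \<in> borel_measurable ?B"
      by (rule measurable_compose[OF continuous_map_measurable[OF inv_cont]
            measurable_compose[OF continuous_map_measurable[OF left_mult_cont[OF pG(2)]] fm]])
    have "harmonic S P ?H"
      by (rule harmonic_invariant_expectation[OF measurable_compose[OF ginf_measurable fm']]) (rule fb)
    then have cH: "continuous_map S euclideanreal ?H" by (rule harmonic_continuous)
    have "continuous_map TG S (\<lambda>k. (x, inv k))"
      using x inv_cont by (simp add: continuous_map_pairwise o_def)
    from continuous_map_compose[OF this cH]
    have c: "continuous_map TG euclideanreal (\<lambda>k. ?H (x, inv k))" by (simp add: o_def)
    have "?H (x, inv k) = (\<integral>\<gamma>. f (\<gamma> \<otimes> k) \<partial>\<mu>)" if k: "k \<in> carrier G" for k
    proof -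
      have eqP: "P (x, inv k) = distr (P (x, \<one>)) (path_borel S) (left_path (inv k))"
        using left_law[of "inv k" x \<one>] k x by simp
      have lp: "left_path (inv k) \<in> P (x, \<one>) \<rightarrow>\<^sub>M path_borel S" by (rule left_path_P) (use k z1 in auto)
      have "?H (x, inv k) = (\<integral>\<omega>. ?f (ginf (left_path (inv k) \<omega>)) \<partial>P (x, \<one>))"
        unfolding eqP by (rule integral_distr[OF lp measurable_compose[OF ginf_path_borel fm']])
      also have "\<dots> = (\<integral>\<omega>. f (inv p \<otimes> inv (ginf \<omega>) \<otimes> k) \<partial>P (x, \<one>))"
      proof (rule integral_cong_AE)
        show "(\<lambda>\<omega>. ?f (ginf (left_path (inv k) \<omega>))) \<in> borel_measurable (P (x, \<one>))"
          by (rule measurable_compose[OF lp measurable_compose[OF ginf_path_borel fm']])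
        show "(\<lambda>\<omega>. f (inv p \<otimes> inv (ginf \<omega>) \<otimes> k)) \<in> borel_measurable (P (x, \<one>))"
          by (rule measurable_compose[OF measurable_compose[OF measurable_compose[OF ginv
              continuous_map_measurable[OF left_mult_cont[OF pG(2)]]] continuous_map_measurable[OF right_mult_cont[OF k]]] fm])
        have "AE \<omega> in P (x, \<one>). limitin TG (\<lambda>t. snd (\<omega> t)) (ginf \<omega>) at_top"
          by (rule AE_converges[OF z1]) simp
        then show "AE \<omega> in P (x, \<one>). ?f (ginf (left_path (inv k) \<omega>)) = f (inv p \<otimes> inv (ginf \<omega>) \<otimes> k)"
        proof (rule AE_mp, intro AE_I2 impI)
          fix \<omega> assume \<omega>: "\<omega> \<in> space (P (x, \<one>))" and l: "limitin TG (\<lambda>t. snd (\<omega> t)) (ginf \<omega>) at_top"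
          have g: "ginf \<omega> \<in> carrier G" using \<omega> spP ginf_carrier by simp
          have "ginf (left_path (inv k) \<omega>) = inv k \<otimes> ginf \<omega>" by (rule ginf_left_path[OF _ l]) (use k in simp)
          then have "inv (ginf (left_path (inv k) \<omega>)) = inv (ginf \<omega>) \<otimes> k"
            using k g by (simp add: G.inv_mult_group)
          then show "?f (ginf (left_path (inv k) \<omega>)) = f (inv p \<otimes> inv (ginf \<omega>) \<otimes> k)"
            using k g pG by (simp add: G.m_assoc)
        qed
      qed
      also have "\<dots> = (\<integral>\<gamma>. f (\<gamma> \<otimes> k) \<partial>\<mu>)" by (rule int[OF fm k, symmetric])
      finally show ?thesis .
    qed
    then show ?thesis by (intro continuous_map_eq[OF c]) (simp add: car)
  qed
  show ?thesis
  proof (rule that[OF \<mu> s\<mu>])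
    fix U assume U: "openin TG U" "\<one> \<in> U"
    have "emeasure \<mu> U = emeasure \<mu>0 {g \<in> topspace TG. inv p \<otimes> g \<in> U}"
      unfolding \<mu>_def using U(1) s0 car by (subst emeasure_distr[OF lm]) (auto simp: borel_of_open intro!: arg_cong[where f = "emeasure \<mu>0"])
    moreover have "emeasure \<mu>0 {g \<in> topspace TG. inv p \<otimes> g \<in> U} \<noteq> 0"
      using openin_continuous_map_preimage[OF left_mult_cont[OF pG(2)] U(1)] pG U(2) car by (intro p(2)) auto
    ultimately show "emeasure \<mu> U \<noteq> 0" by simp
  next
    fix e :: real assume "e > 0"
    then show "\<exists>V. openin TG V \<and> \<one> \<in> V \<and>
       (\<forall>k\<in>V. \<forall>f\<in>unit_ball_functions TG. \<bar>(\<integral>\<gamma>. f (\<gamma> \<otimes> k) \<partial>\<mu>) - (\<integral>\<gamma>. f \<gamma> \<partial>\<mu>)\<bar> \<le> e)"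
      using cont TG_top
      by (intro translation_continuity_in_variation[OF G.group_axioms car right_mult_cont _ _ _ \<mu> s\<mu>]) auto
  qed
qed

end

section \<open>Translates of an invariant event\<close>

lemma continuous_map_real_if_sequentially:
  assumes SC: "second_countable T"
    and seq: "\<And>s p. (\<And>n. s n \<in> topspace T) \<Longrightarrow> limitin T s p sequentially \<Longrightarrow> (\<lambda>n. f (s n)) \<longlonglongrightarrow> f p"
  shows "continuous_map T euclideanreal f"
  unfolding continuous_map_def
proof (intro conjI allI impI)
  fix U :: "real set" assume "openin euclideanreal U"
  then have U: "open U" by simp
  obtain B where B: "enumerated_base T B" using second_countable_enumeration[OF SC] .
  show "openin T {x \<in> topspace T. f x \<in> U}"
  proof (subst openin_subopen, intro ballI)
    fix p assume p: "p \<in> {x \<in> topspace T. f x \<in> U}"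
    define W where "W n = topspace T \<inter> (\<Inter>i\<in>{i. i \<le> n \<and> p \<in> B i}. B i)" for n :: nat
    have Wop: "openin T (W n)" for n
    proof (cases "{i. i \<le> n \<and> p \<in> B i} = {}")
      case False
      then have "openin T (\<Inter>i\<in>{i. i \<le> n \<and> p \<in> B i}. B i)"
        using enumerated_baseD(1)[OF B] by (intro openin_INT2) auto
      then show ?thesis unfolding W_def by auto
    next
      case True
      then show ?thesis unfolding W_def True by simp
    qed
    have pW: "p \<in> W n" for n using p by (auto simp: W_def)
    have "\<exists>n. W n \<subseteq> {x \<in> topspace T. f x \<in> U}"
    proof (rule ccontr)
      assume "\<not> ?thesis"
      then have ns: "\<not> W n \<subseteq> {x \<in> topspace T. f x \<in> U}" for n by simp
      have "\<exists>s. s \<in> W n \<and> f s \<notin> U" for n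
      proof (rule ccontr)
        assume none: "\<nexists>s. s \<in> W n \<and> f s \<notin> U"
        have "W n \<subseteq> {x \<in> topspace T. f x \<in> U}"
        proof
          fix s assume s: "s \<in> W n"
          then have "s \<in> topspace T" by (simp add: W_def)
          moreover have "f s \<in> U" using none s by simp
          ultimately show "s \<in> {x \<in> topspace T. f x \<in> U}" by simp
        qed
        then show False using ns[of n] by simp
      qed
      then obtain s where s: "\<And>n. s n \<in> W n" "\<And>n. f (s n) \<notin> U" by metis
      have "limitin T s p sequentially"
        unfolding limitin_def
      proof (intro conjI allI impI)
        show "p \<in> topspace T" using p by simp
        fix V assume V: "openin T V \<and> p \<in> V"
        then obtain i where i: "p \<in> B i" "B i \<subseteq> V" using enumerated_baseD(2)[OF B] by blast
        have "s n \<in> V" if "n \<ge> i" for n using s(1)[of n] that i unfolding W_def by blast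
        then show "\<forall>\<^sub>F n in sequentially. s n \<in> V" by (auto simp: eventually_sequentially)
      qed
      then have "(\<lambda>n. f (s n)) \<longlonglongrightarrow> f p" by (intro seq) (use s(1) W_def in auto)
      then have "\<forall>\<^sub>F n in sequentially. f (s n) \<in> U" using U p by (intro topological_tendstoD) auto
      then show False using s(2) by (auto simp: eventually_sequentially)
    qed
    then show "\<exists>V. openin T V \<and> p \<in> V \<and> V \<subseteq> {x \<in> topspace T. f x \<in> U}" using Wop pW by blast
  qed
qed simp

lemma continuous_map_real_limit:
  assumes "continuous_map T euclideanreal f" "limitin T s p F"
  shows "((\<lambda>n. f (s n)) \<longlongrightarrow> f p) F"
  using continuous_map_limit[OF assms] by (simp add: o_def)

text \<open>
  The sigma field obtained from \<open>\<C>\<close> by adjoining the null sets of \<open>M\<close>.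
\<close>

definition mod_null :: "'w measure \<Rightarrow> 'w set set \<Rightarrow> 'w set set" where
  "mod_null M \<C> = {B \<in> sets M. \<exists>D\<in>\<C>. sym_diff B D \<in> null_sets M}"

lemma mod_null_sigma_algebra:
  assumes C: "sigma_algebra (space M) \<C>" "\<C> \<subseteq> sets M"
  shows "sigma_algebra (space M) (mod_null M \<C>)"
  unfolding sigma_algebra_iff2
proof (intro conjI ballI allI impI)
  interpret C: sigma_algebra "space M" \<C> by (rule C(1))
  show "mod_null M \<C> \<subseteq> Pow (space M)" unfolding mod_null_def using sets.sets_into_space by blast
  show "{} \<in> mod_null M \<C>" unfolding mod_null_def by (auto intro!: bexI[of _ "{}"])
  show "space M - B \<in> mod_null M \<C>" if "B \<in> mod_null M \<C>" for B
  proof -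
    have B: "B \<in> sets M" and ex: "\<exists>D\<in>\<C>. sym_diff B D \<in> null_sets M"
      using that by (simp_all add: mod_null_def)
    from ex obtain D where D: "D \<in> \<C>" "sym_diff B D \<in> null_sets M" by (elim bexE)
    have "sym_diff (space M - B) (space M - D) = sym_diff B D"
      using sets.sets_into_space[OF B] C.sets_into_space[OF D(1)] by auto
    then have "sym_diff (space M - B) (space M - D) \<in> null_sets M" using D(2) by simp
    moreover have "space M - D \<in> \<C>" using D(1) by (rule C.compl_sets)
    ultimately show ?thesis using B unfolding mod_null_def by blast
  qed
  fix B :: "nat \<Rightarrow> 'a set" assume "range B \<subseteq> mod_null M \<C>"
  then have "\<forall>i. B i \<in> sets M \<and> (\<exists>D\<in>\<C>. sym_diff (B i) D \<in> null_sets M)" unfolding mod_null_def by blast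
  then obtain D where D: "\<And>i. D i \<in> \<C>" "\<And>i. sym_diff (B i) (D i) \<in> null_sets M" and B: "\<And>i. B i \<in> sets M" by metis
  have DM: "D i \<in> sets M" for i using D(1) C(2) by blast
  have "(\<Union>i. sym_diff (B i) (D i)) \<in> null_sets M" using D(2) by (rule null_sets_UN)
  then have "sym_diff (\<Union>i. B i) (\<Union>i. D i) \<in> null_sets M"
    by (rule null_sets_subset) (use B DM in auto)
  moreover have "(\<Union>i. D i) \<in> \<C>" using D(1) by auto
  ultimately show "(\<Union>i. B i) \<in> mod_null M \<C>" using B unfolding mod_null_def by auto
qed

definition mod_null_measure :: "'w measure \<Rightarrow> 'w set set \<Rightarrow> 'w measure" where
  "mod_null_measure M \<C> = sigma (space M) (mod_null M \<C>)"

lemma mod_null_measure_simps: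
  assumes C: "sigma_algebra (space M) \<C>" "\<C> \<subseteq> sets M"
  shows "space (mod_null_measure M \<C>) = space M" "sets (mod_null_measure M \<C>) = mod_null M \<C>"
    "subalgebra M (mod_null_measure M \<C>)"
proof -
  have "mod_null M \<C> \<subseteq> Pow (space M)" unfolding mod_null_def using sets.sets_into_space by blast
  then show 1: "space (mod_null_measure M \<C>) = space M" and 2: "sets (mod_null_measure M \<C>) = mod_null M \<C>"
    unfolding mod_null_measure_def
    using sigma_algebra.sigma_sets_eq[OF mod_null_sigma_algebra[OF C]] by (simp_all add: sets_measure_of space_measure_of)
  show "subalgebra M (mod_null_measure M \<C>)" unfolding subalgebra_def 1 2 by (auto simp: mod_null_def)
qed

lemma mod_null_generator:
  assumes "\<C> \<subseteq> sets M" "D \<in> \<C>" shows "D \<in> mod_null M \<C>"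
  using assms unfolding mod_null_def by (auto intro!: bexI[of _ D])

lemma mod_null_AE:
  assumes "B \<in> sets M" "D \<in> \<C>" "D \<in> sets M" "AE x in M. x \<in> B \<longleftrightarrow> x \<in> D"
  shows "B \<in> mod_null M \<C>"
proof -
  have s: "sym_diff B D \<in> sets M" using assms by auto
  have "AE x in M. x \<notin> sym_diff B D" using assms(4) by (rule AE_mp) auto
  then have "sym_diff B D \<in> null_sets M" using s by (simp add: AE_iff_null_sets)
  then show ?thesis using assms unfolding mod_null_def by blast
qed

locale invariant_event = equivariant_diffusion +
  fixes A
  assumes A: "A \<in> Inv S (borel_of S) (\<lambda>t \<omega>. \<omega> t)"
begin

definition H where "H z = measure (P z) A"

lemma H_continuous: "continuous_map S euclideanreal H"
  unfolding H_def[abs_def] by (rule harmonic_continuous[OF harmonic_invariant_event[OF A]])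

lemma H_bounds: "0 \<le> H z" "z \<in> topspace S \<Longrightarrow> H z \<le> 1"
  using prob_space.prob_le_1[OF prob_space_P] by (auto simp: H_def)

lemma H_slices:
  assumes "h \<in> carrier G"
  shows "y \<in> topspace TX \<Longrightarrow> continuous_map TG euclideanreal (\<lambda>\<gamma>. H (y, \<gamma> \<otimes> h))"
    "\<gamma> \<in> carrier G \<Longrightarrow> continuous_map TX euclideanreal (\<lambda>y. H (y, \<gamma> \<otimes> h))"
proof -
  assume "y \<in> topspace TX"
  then have "continuous_map TG S (\<lambda>\<gamma>. (y, \<gamma> \<otimes> h))"
    using right_mult_cont[OF assms] by (simp add: continuous_map_pairwise o_def)
  from continuous_map_compose[OF this H_continuous] show "continuous_map TG euclideanreal (\<lambda>\<gamma>. H (y, \<gamma> \<otimes> h))"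
    by (simp add: o_def)
next
  assume "\<gamma> \<in> carrier G"
  then have "continuous_map TX S (\<lambda>y. (y, \<gamma> \<otimes> h))"
    using assms car by (simp add: continuous_map_pairwise o_def)
  from continuous_map_compose[OF this H_continuous] show "continuous_map TX euclideanreal (\<lambda>y. H (y, \<gamma> \<otimes> h))"
    by (simp add: o_def)
qed

lemma left_path_shift:
  "s \<ge> 0 \<Longrightarrow> left_path \<gamma> (path_shift s \<omega>) = path_shift s (left_path \<gamma> \<omega>)"
  by (auto simp: left_path_def map_path_def path_shift_def fun_eq_iff)

definition translate where "translate \<gamma> = left_path \<gamma> -` A \<inter> paths S"

lemma translate_Inv:
  assumes \<gamma>: "\<gamma> \<in> carrier G"
  shows "translate \<gamma> \<in> Inv S (borel_of S) (\<lambda>t \<omega>. \<omega> t)"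
proof (rule InvI)
  fix t :: real assume t: "t \<ge> 0"
  have "left_path \<gamma> \<in> coord_sigma S {t..} \<rightarrow>\<^sub>M coord_sigma S {t..}"
  proof (rule measurable_process_sigmaI)
    show "left_path \<gamma> w \<in> paths S" if "w \<in> space (coord_sigma S {t..})" for w using left_path_paths[OF \<gamma>] that by simp
    fix s assume s: "s \<in> {t..}"
    have "(\<lambda>\<omega>. left_mult_state G \<gamma> (\<omega> s)) \<in> coord_sigma S {t..} \<rightarrow>\<^sub>M borel_of S"
      by (rule measurable_compose[OF coord_sigma_coordinate continuous_map_measurable[OF left_mult_state_cont[OF \<gamma>]]]) (use s t in auto)
    then show "(\<lambda>w. left_path \<gamma> w s) \<in> coord_sigma S {t..} \<rightarrow>\<^sub>M borel_of S"
      using s t by (simp add: left_path_def map_path_simps)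
  qed
  from measurable_sets[OF this InvD(2)[OF A t]]
  show "translate \<gamma> \<in> sets (coord_sigma S {t..})" by (simp add: translate_def)
next
  fix s :: real and \<omega> assume s: "s > 0" and \<omega>: "\<omega> \<in> paths S"
  show "path_shift s \<omega> \<in> translate \<gamma> \<longleftrightarrow> \<omega> \<in> translate \<gamma>"
    using InvD(3)[OF A, of s "left_path \<gamma> \<omega>"] left_path_paths[OF \<gamma> \<omega>] path_shift_paths[OF _ \<omega>, of s] \<omega> s
    by (simp add: translate_def left_path_shift)
qed

lemma A_path_borel: "z \<in> topspace S \<Longrightarrow> A \<in> sets (path_borel S)"
  using Inv_sets_P[OF A] sets_P by metis

lemma H_translate:
  assumes "\<gamma> \<in> carrier G" "y \<in> topspace TX" "h \<in> carrier G"
  shows "measure (P (y, h)) (translate \<gamma>) = H (y, \<gamma> \<otimes> h)"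
proof -
  have z: "(y, h) \<in> topspace S" using assms car by simp
  show ?thesis
    unfolding H_def left_law[OF assms] translate_def
    using measure_distr[OF left_path_P[OF assms(1) z] A_path_borel[OF z]] space_P[OF z] by simp
qed

lemma levy_translate:
  assumes "\<gamma> \<in> carrier G" "y \<in> topspace TX" "h \<in> carrier G"
  shows "AE \<omega> in P (y, h). ((\<lambda>t. H (left_path \<gamma> \<omega> t)) \<longlongrightarrow> indicator A (left_path \<gamma> \<omega>)) at_top"
proof -
  have z: "(y, h) \<in> topspace S" "(y, \<gamma> \<otimes> h) \<in> topspace S" using assms car by simp_all
  have "AE \<omega> in P (y, \<gamma> \<otimes> h). ((\<lambda>t. H (\<omega> t)) \<longlongrightarrow> indicator A \<omega>) at_top"
    using levy_zero_one[OF z(2) A] H_continuous unfolding H_def[abs_def] by simp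
  then show ?thesis
    unfolding left_law[OF assms] by (rule AE_distrD[OF left_path_P[OF assms(1) z(1)]])
qed

lemma left_path_pair_measurable:
  assumes M: "sets M = sets (borel_of TG)" and z: "z \<in> topspace S"
  shows "(\<lambda>(\<gamma>, \<omega>). left_path \<gamma> \<omega>) \<in> M \<Otimes>\<^sub>M P z \<rightarrow>\<^sub>M coord_sigma S {0..}"
proof (rule measurable_process_sigmaI)
  have sp: "space M = carrier G" using sets_eq_imp_space_eq[OF M] car by simp
  show "(case w of (\<gamma>, \<omega>) \<Rightarrow> left_path \<gamma> \<omega>) \<in> paths S" if "w \<in> space (M \<Otimes>\<^sub>M P z)" for w
    using that left_path_paths space_P[OF z] sp by (auto simp: space_pair_measure)
  fix t :: real assume t: "t \<in> {0..}"
  have M': "sets (M \<Otimes>\<^sub>M P z) = sets (borel_of TG \<Otimes>\<^sub>M P z)" by (rule sets_pair_measure_cong[OF M refl])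
  have "(\<lambda>p. (fst p, snd p t)) \<in> borel_of TG \<Otimes>\<^sub>M P z \<rightarrow>\<^sub>M borel_of TG \<Otimes>\<^sub>M borel_of S"
    using measurable_compose[OF measurable_snd coordinate_P[OF z, of t]] t by (intro measurable_Pair) auto
  then have 1: "(\<lambda>p. (fst p, snd p t)) \<in> M \<Otimes>\<^sub>M P z \<rightarrow>\<^sub>M borel_of (prod_topology TG S)"
    using measurable_cong_sets[OF M' sets_borel_of_prod[OF TG_top(2) second_countable_prod[OF TX_top(2) TG_top(2)]]] by blast
  have "continuous_map (prod_topology TG S) (prod_topology TG TG) (\<lambda>q. (fst q, snd (snd q)))"
    using continuous_map_compose[OF continuous_map_snd continuous_map_snd, of TG TX TG]
    by (simp add: continuous_map_pairwise o_def continuous_map_fst)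
  from continuous_map_compose[OF this mult_cont]
  have "continuous_map (prod_topology TG S) TG (\<lambda>q. fst q \<otimes> snd (snd q))" by (simp add: o_def)
  moreover have "continuous_map (prod_topology TG S) TX (\<lambda>q. fst (snd q))"
    using continuous_map_compose[OF continuous_map_snd continuous_map_fst, of TG TX TG] by (simp add: o_def)
  ultimately have "continuous_map (prod_topology TG S) S (\<lambda>q. (fst (snd q), fst q \<otimes> snd (snd q)))"
    by (simp add: continuous_map_pairwise o_def)
  from measurable_compose[OF 1 continuous_map_measurable[OF this]]
  show "(\<lambda>w. (case w of (\<gamma>, \<omega>) \<Rightarrow> left_path \<gamma> \<omega>) t) \<in> M \<Otimes>\<^sub>M P z \<rightarrow>\<^sub>M borel_of S"
    using t by (simp add: case_prod_unfold left_path_at)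
qed

lemma indicator_pair_measurable:
  assumes M: "sets M = sets (borel_of TG)" and z: "z \<in> topspace S"
  shows "(\<lambda>(\<gamma>, \<omega>). indicator A (left_path \<gamma> \<omega>) :: real) \<in> borel_measurable (M \<Otimes>\<^sub>M P z)"
proof -
  have "A \<in> sets (coord_sigma S {0..})" using InvD(2)[OF A] by simp
  from measurable_compose[OF left_path_pair_measurable[OF M z] borel_measurable_indicator[OF this]]
  show ?thesis by (simp add: case_prod_unfold)
qed

text \<open>
  By the Markov property at time \<open>n\<close>, translating the event amounts to translating the argument of the
  continuous function \<open>H\<close>.
\<close>

lemma translate_continuous_weak:
  assumes z: "z \<in> topspace S" and D: "D \<in> sets (coord_sigma S {0..real n})"
    and s: "\<And>n. s n \<in> carrier G" and l: "limitin TG s \<gamma> sequentially"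
  shows "(\<lambda>k. measure (P z) (D \<inter> translate (s k))) \<longlonglongrightarrow> measure (P z) (D \<inter> translate \<gamma>)"
proof -
  interpret prob_space "P z" by (rule prob_space_P[OF z])
  have \<gamma>: "\<gamma> \<in> carrier G" using limitin_topspace[OF l] car by simp
  have DP: "D \<in> sets (P z)" by (rule coord_sets_P[OF D _ z]) auto
  have eq: "measure (P z) (D \<inter> translate a) = (\<integral>\<omega>. indicator D \<omega> * measure (P (\<omega> (real n))) (translate a) \<partial>P z)"
    if "a \<in> carrier G" for a
    by (rule markov_property_measure[OF z _ D translate_Inv[OF that]]) simp
  have m: "(\<lambda>\<omega>. indicator D \<omega> * measure (P (\<omega> (real n))) (translate a)) \<in> borel_measurable (P z)" if "a \<in> carrier G" for a
    using DP measurable_compose[OF coordinate_P[OF z, of "real n"] measurable_prob_Inv[OF translate_Inv[OF that]]]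
    by (intro borel_measurable_times borel_measurable_indicator) auto
  show ?thesis
    unfolding eq[OF s] eq[OF \<gamma>]
  proof (rule integral_dominated_convergence[where w = "\<lambda>_. 1"])
    show "AE \<omega> in P z. (\<lambda>k. indicator D \<omega> * measure (P (\<omega> (real n))) (translate (s k))) \<longlonglongrightarrow>
        indicator D \<omega> * measure (P (\<omega> (real n))) (translate \<gamma>)"
    proof (rule AE_I2)
      fix \<omega> assume "\<omega> \<in> space (P z)"
      then have "\<omega> (real n) \<in> topspace S" using pathsD(1)[of \<omega> S "real n"] space_P[OF z] by simp
      then obtain y h where yh: "\<omega> (real n) = (y, h)" "y \<in> topspace TX" "h \<in> carrier G" using car by (cases "\<omega> (real n)") auto
      have "(\<lambda>k. H (y, s k \<otimes> h)) \<longlonglongrightarrow> H (y, \<gamma> \<otimes> h)"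
        by (rule continuous_map_real_limit[OF H_slices(1)[OF yh(3,2)] l])
      then show "(\<lambda>k. indicator D \<omega> * measure (P (\<omega> (real n))) (translate (s k))) \<longlonglongrightarrow>
        indicator D \<omega> * measure (P (\<omega> (real n))) (translate \<gamma>)"
        unfolding yh(1) H_translate[OF s yh(2,3)] H_translate[OF \<gamma> yh(2,3)] by (intro tendsto_intros)
    qed
    show "AE \<omega> in P z. norm (indicator D \<omega> * measure (P (\<omega> (real n))) (translate (s k))) \<le> 1" for k
    proof (rule AE_I2)
      fix \<omega> assume "\<omega> \<in> space (P z)"
      then have "\<omega> (real n) \<in> topspace S" using pathsD(1)[of \<omega> S "real n"] space_P[OF z] by simp
      then interpret Q: prob_space "P (\<omega> (real n))" by (rule prob_space_P)
      show "norm (indicator D \<omega> * measure (P (\<omega> (real n))) (translate (s k))) \<le> 1" by (simp add: indicator_def)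
    qed
  qed (use m s \<gamma> in auto)
qed

lemma indicator_translate_measurable:
  assumes z: "z \<in> topspace S" and a: "a \<in> carrier G"
  shows "(\<lambda>\<omega>. indicator A (left_path a \<omega>) :: real) \<in> borel_measurable (P z)"
  using measurable_compose[OF left_path_P[OF a z] borel_measurable_indicator[OF A_path_borel[OF z]]] .

text \<open>
  The translates of \<open>A\<close> depend continuously on the group element in the weak sense of integrals against
  a fixed integrable \<open>f\<close>: in mean, \<open>f\<close> is a limit of combinations of events of the past of finite times,
  to which the preceding lemma applies, and translating \<open>A\<close> never enlarges the error.
\<close>

lemma translate_continuous:
  fixes f :: "_ \<Rightarrow> real"
  assumes z: "z \<in> topspace S" and f: "integrable (P z) f"
    and fm: "f \<in> borel_measurable (mod_null_measure (P z) (sets (coord_sigma S {0..})))"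
    and s: "\<And>n. s n \<in> carrier G" and l: "limitin TG s \<gamma> sequentially"
  shows "(\<lambda>k. \<integral>\<omega>. indicator A (left_path (s k) \<omega>) * f \<omega> \<partial>P z) \<longlonglongrightarrow> (\<integral>\<omega>. indicator A (left_path \<gamma> \<omega>) * f \<omega> \<partial>P z)"
proof -
  interpret prob_space "P z" by (rule prob_space_P[OF z])
  have \<gamma>: "\<gamma> \<in> carrier G" using limitin_topspace[OF l] car by simp
  let ?C = "sets (coord_sigma S {0..})"
  let ?M = "mod_null_measure (P z) ?C"
  have CP: "?C \<subseteq> sets (P z)" using coord_sets_P[OF _ _ z] by blast
  have sa: "sigma_algebra (space (P z)) ?C"
    using sets.sigma_algebra_axioms[of "coord_sigma S {0..}"] by (simp add: space_P[OF z])
  note ms = mod_null_measure_simps[OF sa CP]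
  let ?I = "\<lambda>a f. \<integral>\<omega>. indicator A (left_path a \<omega>) * f \<omega> \<partial>P z"
  define good where "good f \<longleftrightarrow> (\<lambda>k. ?I (s k) f) \<longlonglongrightarrow> ?I \<gamma> f" for f :: "_ \<Rightarrow> real"
  have int: "integrable (P z) (\<lambda>\<omega>. indicator A (left_path a \<omega>) * f \<omega>)" if "integrable (P z) f" "a \<in> carrier G" for a and f :: "_ \<Rightarrow> real"
    using that indicator_translate_measurable[OF z that(2)]
    by (intro Bochner_Integration.integrable_bound[OF that(1)]) (auto simp: indicator_def)
  have diff: "\<bar>?I a f - ?I a g\<bar> \<le> (\<integral>\<omega>. \<bar>f \<omega> - g \<omega>\<bar> \<partial>P z)"
    if fg: "integrable (P z) f" "integrable (P z) g" and a: "a \<in> carrier G" for a and f g :: "_ \<Rightarrow> real"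
  proof -
    have "?I a f - ?I a g = (\<integral>\<omega>. indicator A (left_path a \<omega>) * (f \<omega> - g \<omega>) \<partial>P z)"
      using int[OF fg(1) a] int[OF fg(2) a] by (simp add: right_diff_distrib)
    also have "\<bar>\<dots>\<bar> \<le> (\<integral>\<omega>. \<bar>indicator A (left_path a \<omega>) * (f \<omega> - g \<omega>)\<bar> \<partial>P z)" by (rule integral_abs_bound)
    also have "\<dots> \<le> (\<integral>\<omega>. \<bar>f \<omega> - g \<omega>\<bar> \<partial>P z)"
    proof (rule integral_mono)
      show "integrable (P z) (\<lambda>\<omega>. \<bar>indicator A (left_path a \<omega>) * (f \<omega> - g \<omega>)\<bar>)"
        using int[of "\<lambda>\<omega>. f \<omega> - g \<omega>" a] fg a by (intro integrable_abs) auto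
    qed (use fg in \<open>auto simp: indicator_def\<close>)
    finally show ?thesis .
  qed
  have good_lim: "good f" if f: "integrable (P z) f"
    and ap: "\<And>e. e > 0 \<Longrightarrow> \<exists>g. integrable (P z) g \<and> good g \<and> (\<integral>\<omega>. \<bar>f \<omega> - g \<omega>\<bar> \<partial>P z) < e" for f
    unfolding good_def
  proof (rule LIMSEQ_I)
    fix r :: real assume "r > 0"
    then obtain g where g: "integrable (P z) g" "good g" "(\<integral>\<omega>. \<bar>f \<omega> - g \<omega>\<bar> \<partial>P z) < r / 3" using ap[of "r / 3"] by auto
    obtain n0 where n0: "\<And>n. n \<ge> n0 \<Longrightarrow> norm (?I (s n) g - ?I \<gamma> g) < r / 3"
      using LIMSEQ_D[OF g(2)[unfolded good_def], of "r / 3"] \<open>r > 0\<close> by auto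
    have "norm (?I (s n) f - ?I \<gamma> f) < r" if "n \<ge> n0" for n
      using n0[OF that] g(3) diff[OF f g(1) s[of n]] diff[OF f g(1) \<gamma>] unfolding real_norm_def by linarith
    then show "\<exists>no. \<forall>n\<ge>no. norm (?I (s n) f - ?I \<gamma> f) < r" by blast
  qed
  have ind_int: "integrable (P z) (\<lambda>\<omega>. c * indicator B \<omega>)" if "B \<in> sets (P z)" for B and c :: real
    using that by (intro integrable_mult_right integrable_real_indicator) (auto simp: less_top[symmetric])
  have good_ind: "good (\<lambda>\<omega>. c * indicator B \<omega>)" if B: "B \<in> mod_null (P z) ?C" for B and c :: real
  proof (rule good_lim)
    have BP: "B \<in> sets (P z)" using B by (simp add: mod_null_def)
    show "integrable (P z) (\<lambda>\<omega>. c * indicator B \<omega>)" by (rule ind_int[OF BP])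
    fix e :: real assume "e > 0"
    obtain B' where B': "B' \<in> ?C" "sym_diff B B' \<in> null_sets (P z)" using B by (auto simp: mod_null_def)
    have e': "e / (\<bar>c\<bar> + 1) > 0" using \<open>e > 0\<close> by (simp add: add_nonneg_pos)
    then obtain n D where D: "D \<in> sets (coord_sigma S {0..real n})" "measure (P z) (sym_diff B' D) < e / (\<bar>c\<bar> + 1)"
      using coord_sigma_approximation[OF z B'(1)] by blast
    have DP: "D \<in> sets (P z)" by (rule coord_sets_P[OF D(1) _ z]) auto
    have B'P: "B' \<in> sets (P z)" using B'(1) CP by blast
    have "measure (P z) (sym_diff B D) \<le> measure (P z) (sym_diff B B' \<union> sym_diff B' D)"
      using BP DP B'P by (intro finite_measure_mono) auto
    also have "\<dots> = measure (P z) (sym_diff B' D)"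
      using B'(2) B'P DP by (subst Un_commute, intro measure_Un_null_set) auto
    finally have sd: "measure (P z) (sym_diff B D) < e / (\<bar>c\<bar> + 1)" using D(2) by simp
    have "(\<integral>\<omega>. \<bar>c * indicator B \<omega> - c * indicator D \<omega>\<bar> \<partial>P z) = (\<integral>\<omega>. \<bar>c\<bar> * indicator (sym_diff B D) \<omega> \<partial>P z)"
      by (rule Bochner_Integration.integral_cong) (auto simp: indicator_def)
    also have "\<dots> = \<bar>c\<bar> * measure (P z) (sym_diff B D)" using BP DP by simp
    also have "\<dots> \<le> (\<bar>c\<bar> + 1) * measure (P z) (sym_diff B D)" by (intro mult_right_mono) auto
    also have "\<dots> < e" using sd by (simp add: pos_less_divide_eq add_nonneg_pos mult.commute)
    finally have small: "(\<integral>\<omega>. \<bar>c * indicator B \<omega> - c * indicator D \<omega>\<bar> \<partial>P z) < e" .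
    have "?I a (\<lambda>\<omega>. c * indicator D \<omega>) = c * measure (P z) (D \<inter> translate a)" if "a \<in> carrier G" for a
    proof -
      have "?I a (\<lambda>\<omega>. c * indicator D \<omega>) = (\<integral>\<omega>. c * indicator (D \<inter> translate a) \<omega> \<partial>P z)"
        by (rule Bochner_Integration.integral_cong) (auto simp: indicator_def translate_def space_P[OF z])
      also have "\<dots> = c * measure (P z) (D \<inter> translate a)"
        using DP Inv_sets_P[OF translate_Inv[OF that] z] by simp
      finally show ?thesis .
    qed
    then have "good (\<lambda>\<omega>. c * indicator D \<omega>)"
      unfolding good_def using translate_continuous_weak[OF z D(1) s l] s \<gamma> by (simp add: tendsto_mult_left)
    then show "\<exists>g. integrable (P z) g \<and> good g \<and> (\<integral>\<omega>. \<bar>c * indicator B \<omega> - g \<omega>\<bar> \<partial>P z) < e"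
      using small ind_int[OF DP] by blast
  qed
  have "integrable (restr_to_subalg (P z) ?M) f" by (rule integrable_in_subalg[OF ms(3) fm f])
  then have "good f"
  proof (induction rule: integrable_L1_induct)
    case (indicator B c)
    then have "B \<in> mod_null (P z) ?C" using sets_restr_to_subalg[OF ms(3)] ms(2) by simp
    then show ?case by (rule good_ind)
  next
    case (add f g)
    note i = integrable_from_subalg[OF ms(3) add(1)] integrable_from_subalg[OF ms(3) add(2)]
    have "?I a (\<lambda>\<omega>. f \<omega> + g \<omega>) = ?I a f + ?I a g" if "a \<in> carrier G" for a
      using int[OF i(1) that] int[OF i(2) that] by (simp add: distrib_left)
    then show ?case using add(3,4) s \<gamma> unfolding good_def by (simp add: tendsto_add)
  next
    case (limit f)
    show ?case
    proof (rule good_lim[OF integrable_from_subalg[OF ms(3) limit.hyps(1)]])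
      fix e :: real assume "e > 0"
      then obtain g where g: "integrable (restr_to_subalg (P z) ?M) g" "good g"
        "(\<integral>\<omega>. \<bar>f \<omega> - g \<omega>\<bar> \<partial>restr_to_subalg (P z) ?M) < e" using limit.IH by blast
      have m: "(\<lambda>\<omega>. \<bar>f \<omega> - g \<omega>\<bar>) \<in> borel_measurable ?M"
        using limit.hyps(1) g(1) by (intro measurable_in_subalg'[OF ms(3)]) auto
      have "(\<integral>\<omega>. \<bar>f \<omega> - g \<omega>\<bar> \<partial>P z) < e" using g(3) by (simp only: integral_subalgebra2[OF ms(3) m])
      then show "\<exists>g. integrable (P z) g \<and> good g \<and> (\<integral>\<omega>. \<bar>f \<omega> - g \<omega>\<bar> \<partial>P z) < e"
        using g(2) integrable_from_subalg[OF ms(3) g(1)] by blast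
    qed
  qed
  then show ?thesis by (simp add: good_def)
qed

end

section \<open>Averages over translates\<close>

locale smoothed_event = invariant_event +
  fixes \<mu> :: "'b measure" and c :: "'b \<Rightarrow> real"
  assumes \<mu>: "prob_space \<mu>" and sets_\<mu>: "sets \<mu> = sets (borel_of TG)"
    and variation: "\<And>e. e > 0 \<Longrightarrow> \<exists>V. openin TG V \<and> \<one> \<in> V \<and>
       (\<forall>k\<in>V. \<forall>f\<in>unit_ball_functions TG. \<bar>(\<integral>\<gamma>. f (\<gamma> \<otimes> k) \<partial>\<mu>) - (\<integral>\<gamma>. f \<gamma> \<partial>\<mu>)\<bar> \<le> e)"
    and c_cont: "continuous_map TG euclideanreal c" and c_bound: "\<And>\<gamma>. \<bar>c \<gamma>\<bar> \<le> 1"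
begin

sublocale \<mu>: prob_space \<mu> by (rule \<mu>)

lemma space_\<mu>: "space \<mu> = carrier G"
  using sets_eq_imp_space_eq[OF sets_\<mu>] car by simp

lemma measurable_\<mu>: "f \<in> borel_measurable (borel_of TG) \<Longrightarrow> f \<in> borel_measurable \<mu>"
  using measurable_cong_sets[OF sets_\<mu> refl] by blast

lemma continuous_\<mu>: "continuous_map TG euclideanreal f \<Longrightarrow> f \<in> borel_measurable \<mu>"
  by (rule measurable_\<mu>[OF continuous_map_borel_measurable])

definition smooth_H where "smooth_H y h = (\<integral>\<gamma>. c \<gamma> * H (y, \<gamma> \<otimes> h) \<partial>\<mu>)"

definition smooth_indicator where "smooth_indicator \<omega> = (\<integral>\<gamma>. c \<gamma> * indicator A (left_path \<gamma> \<omega>) \<partial>\<mu>)"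

lemma cH_measurable:
  "y \<in> topspace TX \<Longrightarrow> h \<in> carrier G \<Longrightarrow> (\<lambda>\<gamma>. c \<gamma> * H (y, \<gamma> \<otimes> h)) \<in> borel_measurable \<mu>"
  by (intro borel_measurable_times continuous_\<mu> c_cont H_slices)

lemma cH_bound:
  "y \<in> topspace TX \<Longrightarrow> h \<in> carrier G \<Longrightarrow> \<gamma> \<in> carrier G \<Longrightarrow> \<bar>c \<gamma> * H (y, \<gamma> \<otimes> h)\<bar> \<le> 1"
  using H_bounds[of "(y, \<gamma> \<otimes> h)"] c_bound[of \<gamma>] car by (auto simp: abs_mult intro!: mult_le_one)

lemma smooth_H_continuous:
  assumes h: "h \<in> carrier G"
  shows "continuous_map TX euclideanreal (\<lambda>y. smooth_H y h)"
proof (rule continuous_map_real_if_sequentially[OF TX_top(2)])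
  fix s p assume s: "\<And>n. s n \<in> topspace TX" and l: "limitin TX s p sequentially"
  have p: "p \<in> topspace TX" by (rule limitin_topspace[OF l])
  show "(\<lambda>n. smooth_H (s n) h) \<longlonglongrightarrow> smooth_H p h"
    unfolding smooth_H_def
  proof (rule integral_dominated_convergence[where w = "\<lambda>_. 1"])
    show "AE \<gamma> in \<mu>. (\<lambda>n. c \<gamma> * H (s n, \<gamma> \<otimes> h)) \<longlonglongrightarrow> c \<gamma> * H (p, \<gamma> \<otimes> h)"
      by (intro AE_I2 tendsto_mult tendsto_const continuous_map_real_limit[OF H_slices(2)[OF h] l]) (simp add: space_\<mu>)
    show "AE \<gamma> in \<mu>. norm (c \<gamma> * H (s n, \<gamma> \<otimes> h)) \<le> 1" for n
      using cH_bound[OF s h] by (intro AE_I2) (simp add: space_\<mu>)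
  qed (use cH_measurable s h p in auto)
qed

lemma translation_of_weight_continuous:
  "continuous_map TG euclideanreal (\<lambda>k. \<integral>\<gamma>. \<bar>c \<gamma> - c (\<gamma> \<otimes> k)\<bar> \<partial>\<mu>)"
proof (rule continuous_map_real_if_sequentially[OF TG_top(2)])
  fix s p assume s: "\<And>n. s n \<in> topspace TG" and l: "limitin TG s p sequentially"
  have p: "p \<in> carrier G" using limitin_topspace[OF l] car by simp
  have m: "(\<lambda>\<gamma>. \<bar>c \<gamma> - c (\<gamma> \<otimes> k)\<bar>) \<in> borel_measurable \<mu>" if "k \<in> carrier G" for k
  proof -
    have "(\<lambda>\<gamma>. c (\<gamma> \<otimes> k)) \<in> borel_measurable \<mu>"
      using continuous_\<mu>[OF continuous_map_compose[OF right_mult_cont[OF that] c_cont]] by (simp add: o_def)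
    then show ?thesis using continuous_\<mu>[OF c_cont] by simp
  qed
  show "(\<lambda>n. \<integral>\<gamma>. \<bar>c \<gamma> - c (\<gamma> \<otimes> s n)\<bar> \<partial>\<mu>) \<longlonglongrightarrow> (\<integral>\<gamma>. \<bar>c \<gamma> - c (\<gamma> \<otimes> p)\<bar> \<partial>\<mu>)"
  proof (rule integral_dominated_convergence[where w = "\<lambda>_. 2"])
    show "AE \<gamma> in \<mu>. (\<lambda>n. \<bar>c \<gamma> - c (\<gamma> \<otimes> s n)\<bar>) \<longlonglongrightarrow> \<bar>c \<gamma> - c (\<gamma> \<otimes> p)\<bar>"
    proof (rule AE_I2)
      fix \<gamma> assume "\<gamma> \<in> space \<mu>"
      then have "continuous_map TG euclideanreal (\<lambda>k. c (\<gamma> \<otimes> k))"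
        using continuous_map_compose[OF left_mult_cont c_cont] by (simp add: o_def space_\<mu>)
      from continuous_map_real_limit[OF this l]
      show "(\<lambda>n. \<bar>c \<gamma> - c (\<gamma> \<otimes> s n)\<bar>) \<longlonglongrightarrow> \<bar>c \<gamma> - c (\<gamma> \<otimes> p)\<bar>" by (intro tendsto_intros)
    qed
    show "AE \<gamma> in \<mu>. norm \<bar>c \<gamma> - c (\<gamma> \<otimes> s n)\<bar> \<le> 2" for n
    proof (rule AE_I2)
      fix \<gamma>
      show "norm \<bar>c \<gamma> - c (\<gamma> \<otimes> s n)\<bar> \<le> 2" using c_bound[of \<gamma>] c_bound[of "\<gamma> \<otimes> s n"] by simp
    qed
  qed (use m s p car in auto)
qed

text \<open>
  Passing from \<open>h0\<close> to \<open>k \<otimes> h0\<close> can be absorbed by translating the measure with density \<open>c\<close> on the right by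
  \<open>k\<close>. For \<open>k\<close> near the unit this is a small change in total variation, so the same neighbourhood serves
  for all \<open>y\<close>, although \<open>X\<close> need not be compact.
\<close>

lemma smooth_H_equicontinuous:
  assumes e: "e > 0" and h0: "h0 \<in> carrier G"
  shows "\<exists>U. openin TG U \<and> h0 \<in> U \<and> (\<forall>h\<in>U. \<forall>y\<in>topspace TX. \<bar>smooth_H y h - smooth_H y h0\<bar> \<le> e)"
proof -
  obtain V where V: "openin TG V" "\<one> \<in> V"
    "\<And>k f. k \<in> V \<Longrightarrow> f \<in> unit_ball_functions TG \<Longrightarrow> \<bar>(\<integral>\<gamma>. f (\<gamma> \<otimes> k) \<partial>\<mu>) - (\<integral>\<gamma>. f \<gamma> \<partial>\<mu>)\<bar> \<le> e / 2"
    using variation[of "e / 2"] e by auto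
  let ?V' = "{k \<in> topspace TG. (\<integral>\<gamma>. \<bar>c \<gamma> - c (\<gamma> \<otimes> k)\<bar> \<partial>\<mu>) \<in> {..<e / 2}}"
  have V': "openin TG ?V'"
    by (rule openin_continuous_map_preimage[OF translation_of_weight_continuous]) simp
  have "(\<integral>\<gamma>. \<bar>c \<gamma> - c (\<gamma> \<otimes> \<one>)\<bar> \<partial>\<mu>) = (\<integral>\<gamma>. 0 \<partial>\<mu>)"
    by (rule Bochner_Integration.integral_cong) (auto simp: space_\<mu>)
  then have "\<one> \<in> ?V'" using e car by simp
  let ?U = "{h \<in> topspace TG. h \<otimes> inv h0 \<in> V \<inter> ?V'}"
  have "openin TG ?U"
    by (rule openin_continuous_map_preimage[OF right_mult_cont]) (use h0 V V' in auto)
  moreover have "h0 \<in> ?U" using h0 V(2) \<open>\<one> \<in> ?V'\<close> car by simp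
  moreover have "\<bar>smooth_H y h - smooth_H y h0\<bar> \<le> e" if hU: "h \<in> ?U" and y: "y \<in> topspace TX" for h y
  proof -
    have h: "h \<in> carrier G" using hU car by simp
    define k where "k = h \<otimes> inv h0"
    have k: "k \<in> carrier G" "k \<in> V" "k \<in> ?V'" using hU h h0 by (auto simp: k_def)
    have kh: "\<gamma> \<otimes> k \<otimes> h0 = \<gamma> \<otimes> h" if "\<gamma> \<in> carrier G" for \<gamma>
      using that h h0 by (simp add: k_def G.m_assoc)
    define f where "f \<gamma> = (if \<gamma> \<in> carrier G then H (y, \<gamma> \<otimes> h0) else 0)" for \<gamma>
    have fb: "\<bar>f \<gamma>\<bar> \<le> 1" for \<gamma> using H_bounds[of "(y, \<gamma> \<otimes> h0)"] y h0 car by (simp add: f_def)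
    have fc: "continuous_map TG euclideanreal f"
      by (rule continuous_map_eq[OF H_slices(1)[OF h0 y]]) (simp add: f_def car)
    have cf: "continuous_map TG euclideanreal (\<lambda>\<gamma>. c \<gamma> * f \<gamma>)"
      using continuous_map_real_mult[OF c_cont fc] .
    have ball: "(\<lambda>\<gamma>. c \<gamma> * f \<gamma>) \<in> unit_ball_functions TG"
      using continuous_map_borel_measurable[OF cf] c_bound fb by (auto simp: unit_ball_functions_def abs_mult intro!: mult_le_one)
    have trans: "continuous_map TG euclideanreal (\<lambda>\<gamma>. u (\<gamma> \<otimes> k))" if "continuous_map TG euclideanreal u" for u
      using continuous_map_compose[OF right_mult_cont[OF k(1)] that] by (simp add: o_def)
    have i1: "integrable \<mu> (\<lambda>\<gamma>. c \<gamma> * f (\<gamma> \<otimes> k))"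
      by (rule \<mu>.integrable_const_bound[where B = 1])
        (use continuous_\<mu>[OF continuous_map_real_mult[OF c_cont trans[OF fc]]] c_bound fb in \<open>auto simp: abs_mult intro!: mult_le_one\<close>)
    have i2: "integrable \<mu> (\<lambda>\<gamma>. c (\<gamma> \<otimes> k) * f (\<gamma> \<otimes> k))"
      by (rule \<mu>.integrable_const_bound[where B = 1])
        (use continuous_\<mu>[OF trans[OF cf]] c_bound fb in \<open>auto simp: abs_mult intro!: mult_le_one\<close>)
    have i3: "integrable \<mu> (\<lambda>\<gamma>. \<bar>c \<gamma> - c (\<gamma> \<otimes> k)\<bar>)"
    proof (rule \<mu>.integrable_const_bound[where B = 2])
      show "AE \<gamma> in \<mu>. norm \<bar>c \<gamma> - c (\<gamma> \<otimes> k)\<bar> \<le> 2"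
      proof (rule AE_I2)
        fix \<gamma> show "norm \<bar>c \<gamma> - c (\<gamma> \<otimes> k)\<bar> \<le> 2" using c_bound[of \<gamma>] c_bound[of "\<gamma> \<otimes> k"] by simp
      qed
    qed (use continuous_\<mu>[OF c_cont] continuous_\<mu>[OF trans[OF c_cont]] in simp)
    have e1: "smooth_H y h = (\<integral>\<gamma>. c \<gamma> * f (\<gamma> \<otimes> k) \<partial>\<mu>)"
      unfolding smooth_H_def by (rule Bochner_Integration.integral_cong) (use k kh in \<open>auto simp: space_\<mu> f_def\<close>)
    have e2: "smooth_H y h0 = (\<integral>\<gamma>. c \<gamma> * f \<gamma> \<partial>\<mu>)"
      unfolding smooth_H_def by (rule Bochner_Integration.integral_cong) (auto simp: space_\<mu> f_def)
    have "smooth_H y h - (\<integral>\<gamma>. c (\<gamma> \<otimes> k) * f (\<gamma> \<otimes> k) \<partial>\<mu>) = (\<integral>\<gamma>. (c \<gamma> - c (\<gamma> \<otimes> k)) * f (\<gamma> \<otimes> k) \<partial>\<mu>)"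
      unfolding e1 using i1 i2 by (simp add: left_diff_distrib)
    also have "\<bar>\<dots>\<bar> \<le> (\<integral>\<gamma>. \<bar>(c \<gamma> - c (\<gamma> \<otimes> k)) * f (\<gamma> \<otimes> k)\<bar> \<partial>\<mu>)" by (rule integral_abs_bound)
    also have "\<dots> \<le> (\<integral>\<gamma>. \<bar>c \<gamma> - c (\<gamma> \<otimes> k)\<bar> \<partial>\<mu>)"
    proof (rule integral_mono[OF _ i3])
      show "integrable \<mu> (\<lambda>\<gamma>. \<bar>(c \<gamma> - c (\<gamma> \<otimes> k)) * f (\<gamma> \<otimes> k)\<bar>)"
        using i1 i2 by (intro integrable_abs) (simp add: left_diff_distrib)
      show "\<bar>(c \<gamma> - c (\<gamma> \<otimes> k)) * f (\<gamma> \<otimes> k)\<bar> \<le> \<bar>c \<gamma> - c (\<gamma> \<otimes> k)\<bar>" for \<gamma>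
        using fb[of "\<gamma> \<otimes> k"] by (simp add: abs_mult mult_left_le)
    qed
    also have "\<dots> \<le> e / 2" using k(3) by simp
    finally have "\<bar>smooth_H y h - (\<integral>\<gamma>. c (\<gamma> \<otimes> k) * f (\<gamma> \<otimes> k) \<partial>\<mu>)\<bar> \<le> e / 2" .
    moreover have "\<bar>(\<integral>\<gamma>. c (\<gamma> \<otimes> k) * f (\<gamma> \<otimes> k) \<partial>\<mu>) - smooth_H y h0\<bar> \<le> e / 2"
      unfolding e2 using V(3)[OF k(2) ball] by simp
    ultimately show ?thesis by linarith
  qed
  ultimately show ?thesis by blast
qed

text \<open>
  For each fixed \<open>\<gamma>\<close> this is the zero-one law for the translate of \<open>A\<close> by \<open>\<gamma>\<close>. Fubini's theorem exchanges
  the exceptional sets, and dominated convergence integrates over \<open>\<gamma>\<close>.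
\<close>

lemma smooth_H_converges:
  assumes z: "z \<in> topspace S"
  shows "AE \<omega> in P z. ((\<lambda>t. smooth_H (fst (\<omega> t)) (snd (\<omega> t))) \<longlongrightarrow> smooth_indicator \<omega>) at_top"
proof -
  interpret Pz: prob_space "P z" by (rule prob_space_P[OF z])
  interpret pair: pair_prob_space \<mu> "P z" ..
  let ?conv = "\<lambda>\<gamma> \<omega>. ((\<lambda>t. H (left_path \<gamma> \<omega> t)) \<longlongrightarrow> indicator A (left_path \<gamma> \<omega>)) at_top"
  (* convergence in terms of rational times: a jointly measurable condition, as Fubini requires *)
  let ?R = "\<lambda>\<gamma> \<omega>. \<forall>k. \<exists>n::nat. \<forall>q\<in>\<rat> \<inter> {real n..}. \<bar>H (left_path \<gamma> \<omega> q) - indicator A (left_path \<gamma> \<omega>)\<bar> \<le> 1 / real (Suc k)"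
  have R: "?R \<gamma> \<omega> \<longleftrightarrow> ?conv \<gamma> \<omega>" if \<gamma>: "\<gamma> \<in> carrier G" and \<omega>: "\<omega> \<in> paths S" for \<gamma> \<omega>
  proof
    assume R: "?R \<gamma> \<omega>"
    show "?conv \<gamma> \<omega>"
    proof (rule tendstoI)
      fix e :: real assume "e > 0"
      then obtain k where k: "1 / real (Suc k) < e" using nat_approx_posE by blast
      let ?a = "indicator A (left_path \<gamma> \<omega>)" and ?d = "1 / real (Suc k)"
      obtain n :: nat where "\<forall>q\<in>\<rat> \<inter> {real n..}. \<bar>H (left_path \<gamma> \<omega> q) - ?a\<bar> \<le> ?d" using R by blast
      then have n: "\<bar>H (left_path \<gamma> \<omega> q) - ?a\<bar> \<le> ?d" if "q \<in> \<rat>" "q \<ge> real n" for q using that by simp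
      have near: "H (left_path \<gamma> \<omega> t) \<in> {?a - ?d..?a + ?d}" if t: "t \<ge> real n" for t
      proof (rule continuous_path_closed_rational[where S = euclideanreal and n = "real n" and z = "\<lambda>t. H (left_path \<gamma> \<omega> t)"])
        show "continuous_map (top_of_set {0..}) euclideanreal (\<lambda>t. H (left_path \<gamma> \<omega> t))"
          by (rule path_image_continuous[OF H_continuous left_path_paths[OF \<gamma> \<omega>]])
        show "H (left_path \<gamma> \<omega> q) \<in> {?a - ?d..?a + ?d}" if "q \<in> \<rat>" "q \<ge> real n" for q
          using n[OF that] unfolding atLeastAtMost_iff abs_le_iff by linarith
      qed (use t in auto)
      have "dist (H (left_path \<gamma> \<omega> t)) ?a < e" if "t \<ge> real n" for t
      proof -
        have "\<bar>H (left_path \<gamma> \<omega> t) - ?a\<bar> \<le> ?d" using near[OF that] unfolding atLeastAtMost_iff by linarith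
        then show ?thesis using k unfolding dist_real_def by linarith
      qed
      then show "\<forall>\<^sub>F t in at_top. dist (H (left_path \<gamma> \<omega> t)) ?a < e" unfolding eventually_at_top_linorder by blast
    qed
  next
    assume c: "?conv \<gamma> \<omega>"
    show "?R \<gamma> \<omega>"
    proof
      fix k
      have "\<forall>\<^sub>F t in at_top. dist (H (left_path \<gamma> \<omega> t)) (indicator A (left_path \<gamma> \<omega>)) < 1 / real (Suc k)"
        by (rule tendstoD[OF c]) simp
      then obtain a where a: "\<And>t. t \<ge> a \<Longrightarrow> dist (H (left_path \<gamma> \<omega> t)) (indicator A (left_path \<gamma> \<omega>)) < 1 / real (Suc k)"
        by (auto simp: eventually_at_top_linorder)
      obtain n :: nat where "a \<le> real n" using real_arch_simple by blast
      then show "\<exists>n::nat. \<forall>q\<in>\<rat> \<inter> {real n..}. \<bar>H (left_path \<gamma> \<omega> q) - indicator A (left_path \<gamma> \<omega>)\<bar> \<le> 1 / real (Suc k)"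
        using a by (intro exI[of _ n]) (auto simp: dist_real_def intro!: less_imp_le)
    qed
  qed
  have I: "(\<lambda>p. indicator A (left_path (fst p) (snd p)) :: real) \<in> borel_measurable (\<mu> \<Otimes>\<^sub>M P z)"
    using indicator_pair_measurable[OF sets_\<mu> z] by (simp add: case_prod_unfold)
  have Hq: "(\<lambda>p. H (left_path (fst p) (snd p) q)) \<in> borel_measurable (\<mu> \<Otimes>\<^sub>M P z)" if "q \<ge> 0" for q
  proof -
    have "(\<lambda>p. left_path (fst p) (snd p) q) \<in> \<mu> \<Otimes>\<^sub>M P z \<rightarrow>\<^sub>M borel_of S"
      using measurable_compose[OF left_path_pair_measurable[OF sets_\<mu> z] coord_sigma_coordinate[of q "{0..}" S]] that
      by (simp add: case_prod_unfold)
    from measurable_compose[OF this continuous_map_borel_measurable[OF H_continuous]] show ?thesis .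
  qed
  have meas: "{p \<in> space (\<mu> \<Otimes>\<^sub>M P z). ?R (fst p) (snd p)} \<in> sets (\<mu> \<Otimes>\<^sub>M P z)"
  proof -
    have 1: "{p \<in> space (\<mu> \<Otimes>\<^sub>M P z). \<bar>H (left_path (fst p) (snd p) q) - indicator A (left_path (fst p) (snd p))\<bar> \<le> d} \<in> sets (\<mu> \<Otimes>\<^sub>M P z)"
      if "q \<ge> 0" for q d
      using Hq[OF that] I by measurable
    have 2: "{p \<in> space (\<mu> \<Otimes>\<^sub>M P z). \<forall>q\<in>\<rat> \<inter> {real n..}. \<bar>H (left_path (fst p) (snd p) q) - indicator A (left_path (fst p) (snd p))\<bar> \<le> d} \<in> sets (\<mu> \<Otimes>\<^sub>M P z)" for n d
      by (rule sets.sets_Collect_countable_All') (use 1[of _ d] countable_rat in auto)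
    show ?thesis using 2 by (intro sets.sets_Collect_countable_All sets.sets_Collect_countable_Ex)
  qed
  have zeq: "z = (fst z, snd z)" "fst z \<in> topspace TX" "snd z \<in> carrier G" using z car by (auto simp: mem_Times_iff)
  have "AE \<gamma> in \<mu>. AE \<omega> in P z. ?R \<gamma> \<omega>"
  proof (rule AE_I2)
    fix \<gamma> assume "\<gamma> \<in> space \<mu>"
    then have \<gamma>: "\<gamma> \<in> carrier G" by (simp add: space_\<mu>)
    have "AE \<omega> in P z. ?conv \<gamma> \<omega>" using levy_translate[OF \<gamma> zeq(2,3)] by (simp only: prod.collapse)
    then show "AE \<omega> in P z. ?R \<gamma> \<omega>"
      by (rule AE_mp) (intro AE_I2 impI, rule R[OF \<gamma>, THEN iffD2], simp_all add: space_P[OF z])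
  qed
  then have "AE \<omega> in P z. AE \<gamma> in \<mu>. ?R \<gamma> \<omega>" using pair.AE_commute[OF meas] by simp
  then show ?thesis
  proof (rule AE_mp, intro AE_I2 impI)
    fix \<omega> assume "\<omega> \<in> space (P z)" and ae: "AE \<gamma> in \<mu>. ?R \<gamma> \<omega>"
    then have \<omega>: "\<omega> \<in> paths S" by (simp add: space_P[OF z])
    have pt: "fst (\<omega> t) \<in> topspace TX" "snd (\<omega> t) \<in> carrier G" if "t \<ge> 0" for t
      using pathsD(1)[OF \<omega> that] car by (auto simp: mem_Times_iff)
    have pt': "fst (\<omega> (max 0 t)) \<in> topspace TX" "snd (\<omega> (max 0 t)) \<in> carrier G" for t using pt[of "max 0 t"] by auto
    (* max 0 t keeps the path in its state space for all real t *)
    have lim: "((\<lambda>t. \<integral>\<gamma>. c \<gamma> * H (fst (\<omega> (max 0 t)), \<gamma> \<otimes> snd (\<omega> (max 0 t))) \<partial>\<mu>) \<longlongrightarrow> smooth_indicator \<omega>) at_top"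
      unfolding smooth_indicator_def
    proof (rule integral_dominated_convergence_at_top[where w = "\<lambda>_. 1"])
      show "AE \<gamma> in \<mu>. ((\<lambda>t. c \<gamma> * H (fst (\<omega> (max 0 t)), \<gamma> \<otimes> snd (\<omega> (max 0 t)))) \<longlongrightarrow> c \<gamma> * indicator A (left_path \<gamma> \<omega>)) at_top"
        using ae
      proof (rule AE_mp, intro AE_I2 impI)
        fix \<gamma> assume "\<gamma> \<in> space \<mu>" "?R \<gamma> \<omega>"
        then have "?conv \<gamma> \<omega>" using R \<omega> by (simp add: space_\<mu>)
        then have "((\<lambda>t. H (fst (\<omega> (max 0 t)), \<gamma> \<otimes> snd (\<omega> (max 0 t)))) \<longlongrightarrow> indicator A (left_path \<gamma> \<omega>)) at_top"
          by (rule tendsto_cong[THEN iffD1, rotated])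
            (auto intro!: eventually_mono[OF eventually_ge_at_top[of 0]] simp: left_path_at)
        then show "((\<lambda>t. c \<gamma> * H (fst (\<omega> (max 0 t)), \<gamma> \<otimes> snd (\<omega> (max 0 t)))) \<longlongrightarrow> c \<gamma> * indicator A (left_path \<gamma> \<omega>)) at_top"
          by (intro tendsto_intros)
      qed
      show "\<forall>\<^sub>F t in at_top. AE \<gamma> in \<mu>. norm (c \<gamma> * H (fst (\<omega> (max 0 t)), \<gamma> \<otimes> snd (\<omega> (max 0 t)))) \<le> 1"
        using cH_bound[OF pt'] by (intro always_eventually allI AE_I2) (simp add: space_\<mu>)
      show "(\<lambda>\<gamma>. c \<gamma> * indicator A (left_path \<gamma> \<omega>)) \<in> borel_measurable \<mu>"
        using measurable_compose[OF measurable_Pair2' I, of \<omega>] continuous_\<mu>[OF c_cont] \<omega>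
        by (intro borel_measurable_times) (simp_all add: space_P[OF z])
      show "(\<lambda>\<gamma>. c \<gamma> * H (fst (\<omega> (max 0 t)), \<gamma> \<otimes> snd (\<omega> (max 0 t)))) \<in> borel_measurable \<mu>" for t
        by (rule cH_measurable[OF pt'])
    qed simp
    show "((\<lambda>t. smooth_H (fst (\<omega> t)) (snd (\<omega> t))) \<longlongrightarrow> smooth_indicator \<omega>) at_top"
      unfolding smooth_H_def
      by (rule tendsto_cong[THEN iffD1, OF _ lim])
        (auto intro!: eventually_mono[OF eventually_ge_at_top[of 0]])
  qed
qed

text \<open>
  By equicontinuity the moving second coordinate can be replaced by its limit \<open>ginf \<omega>\<close>, and this limit by
  any point that projects into a small basic neighbourhood \<open>B i\<close> of \<open>\<pi> (ginf \<omega>)\<close>. The comparison of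
  \<open>smooth_H\<close> with \<open>b\<close> on all of \<open>B i\<close> is a closed condition on the first coordinate alone, so a level set
  splits into countably many intersections of an event of the limit with an event of the \<open>X\<close>-component.
\<close>

lemma smooth_indicator_event:
  assumes z: "z \<in> topspace S" and SC: "second_countable TY" and B: "enumerated_base TY B"
    and open_map: "\<And>U. openin TG U \<Longrightarrow> openin TY (\<pi> ` U)"
    and \<pi>Y: "\<And>g. g \<in> carrier G \<Longrightarrow> \<pi> g \<in> topspace TY"
    and fibre: "\<And>y h h'. y \<in> topspace TX \<Longrightarrow> h \<in> carrier G \<Longrightarrow> h' \<in> carrier G \<Longrightarrow> \<pi> h = \<pi> h' \<Longrightarrow>
      smooth_H y h = smooth_H y h'"
  defines "C \<equiv> \<lambda>b i. {y \<in> topspace TX. \<forall>h\<in>carrier G. \<pi> h \<in> B i \<longrightarrow> smooth_H y h \<le> b}"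
  shows "closedin TX (C b i)"
    and "AE \<omega> in P z. smooth_indicator \<omega> < a \<longleftrightarrow>
      (\<exists>b\<in>\<rat> \<inter> {..<a}. \<exists>i. \<pi> (ginf \<omega>) \<in> B i \<and> (\<forall>\<^sub>F t in at_top. fst (\<omega> t) \<in> C b i))"
proof -
  (* the unit only makes the index set nonempty *)
  let ?I = "insert \<one> {h \<in> carrier G. \<pi> h \<in> B i}"
  define K where "K h = (if \<pi> h \<in> B i then {y \<in> topspace TX. smooth_H y h \<in> {..b}} else topspace TX)" for h
  have K: "closedin TX (K h)" if "h \<in> carrier G" for h
    using closedin_continuous_map_preimage[OF smooth_H_continuous[OF that], of "{..b}"] by (simp add: K_def)
  have "closedin TX (\<Inter>h\<in>?I. K h)" by (rule closedin_INT) (auto intro: K)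
  moreover have "(\<Inter>h\<in>?I. K h) = C b i"
  proof (intro equalityI subsetI)
    fix y assume "y \<in> (\<Inter>h\<in>?I. K h)"
    then have y: "\<And>h. h \<in> ?I \<Longrightarrow> y \<in> K h" by blast
    have "y \<in> topspace TX" using y[of \<one>] closedin_subset[OF K[of \<one>]] by blast
    moreover have "smooth_H y h \<le> b" if "h \<in> carrier G" "\<pi> h \<in> B i" for h
      using y[of h] that by (simp add: K_def)
    ultimately show "y \<in> C b i" by (simp add: C_def)
  qed (auto simp: C_def K_def)
  ultimately show "closedin TX (C b i)" by simp
  have "AE \<omega> in P z. limitin TG (\<lambda>t. snd (\<omega> t)) (ginf \<omega>) at_top" by (rule AE_converges[OF z])
  then show "AE \<omega> in P z. smooth_indicator \<omega> < a \<longleftrightarrow>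
      (\<exists>b\<in>\<rat> \<inter> {..<a}. \<exists>i. \<pi> (ginf \<omega>) \<in> B i \<and> (\<forall>\<^sub>F t in at_top. fst (\<omega> t) \<in> C b i))"
    using smooth_H_converges[OF z]
  proof (rule AE_mp[OF AE_conjI], intro AE_I2 impI)
    fix \<omega> assume "\<omega> \<in> space (P z)" and *: "limitin TG (\<lambda>t. snd (\<omega> t)) (ginf \<omega>) at_top \<and>
      ((\<lambda>t. smooth_H (fst (\<omega> t)) (snd (\<omega> t))) \<longlongrightarrow> smooth_indicator \<omega>) at_top"
    then have \<omega>: "\<omega> \<in> paths S" by (simp add: space_P[OF z])
    let ?g = "ginf \<omega>" and ?Z = "smooth_indicator \<omega>"
    have g: "?g \<in> carrier G" by (rule ginf_carrier[OF \<omega>])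
    have xt: "\<forall>\<^sub>F t in at_top. fst (\<omega> t) \<in> topspace TX"
      by (rule eventually_mono[OF eventually_ge_at_top[of 0]]) (use pathsD(1)[OF \<omega>] in \<open>auto simp: mem_Times_iff\<close>)
    have lim: "((\<lambda>t. smooth_H (fst (\<omega> t)) ?g) \<longlongrightarrow> ?Z) at_top"
    proof (rule Lim_transform)
      show "((\<lambda>t. smooth_H (fst (\<omega> t)) (snd (\<omega> t))) \<longlongrightarrow> ?Z) at_top" using * by simp
      show "((\<lambda>t. smooth_H (fst (\<omega> t)) ?g - smooth_H (fst (\<omega> t)) (snd (\<omega> t))) \<longlongrightarrow> 0) at_top"
      proof (rule tendstoI)
        fix e :: real assume "e > 0"
        then obtain U where U: "openin TG U" "?g \<in> U" "\<And>h y. h \<in> U \<Longrightarrow> y \<in> topspace TX \<Longrightarrow> \<bar>smooth_H y h - smooth_H y ?g\<bar> \<le> e / 2"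
          using smooth_H_equicontinuous[OF _ g, of "e / 2"] by auto
        have "\<forall>\<^sub>F t in at_top. snd (\<omega> t) \<in> U" using * U(1,2) by (simp add: limitin_def)
        then show "\<forall>\<^sub>F t in at_top. dist (smooth_H (fst (\<omega> t)) ?g - smooth_H (fst (\<omega> t)) (snd (\<omega> t))) 0 < e"
          using xt
        proof eventually_elim
          case (elim t)
          have "\<bar>smooth_H (fst (\<omega> t)) (snd (\<omega> t)) - smooth_H (fst (\<omega> t)) ?g\<bar> \<le> e / 2" by (rule U(3)[OF elim])
          then show ?case using \<open>e > 0\<close> unfolding dist_real_def by linarith
        qed
      qed
    qed
    show "?Z < a \<longleftrightarrow> (\<exists>b\<in>\<rat> \<inter> {..<a}. \<exists>i. \<pi> ?g \<in> B i \<and> (\<forall>\<^sub>F t in at_top. fst (\<omega> t) \<in> C b i))"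
    proof
      assume "?Z < a"
      then obtain b where b: "b \<in> \<rat>" "?Z < b" "b < a" using Rats_dense_in_real by blast
      define e where "e = (b - ?Z) / 2"
      have e: "e > 0" using b by (simp add: e_def)
      obtain U where U: "openin TG U" "?g \<in> U" "\<And>h y. h \<in> U \<Longrightarrow> y \<in> topspace TX \<Longrightarrow> \<bar>smooth_H y h - smooth_H y ?g\<bar> \<le> e"
        using smooth_H_equicontinuous[OF e g] by auto
      have UG: "U \<subseteq> carrier G" using openin_subset[OF U(1)] car by simp
      obtain i where i: "\<pi> ?g \<in> B i" "B i \<subseteq> \<pi> ` U"
        using enumerated_baseD(2)[OF B open_map[OF U(1)], of "\<pi> ?g"] U(2) by blast
      have "\<forall>\<^sub>F t in at_top. dist (smooth_H (fst (\<omega> t)) ?g) ?Z < e" by (rule tendstoD[OF lim e])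
      then have "\<forall>\<^sub>F t in at_top. fst (\<omega> t) \<in> C b i"
        using xt
      proof eventually_elim
        case (elim t)
        have "smooth_H (fst (\<omega> t)) h \<le> b" if h: "h \<in> carrier G" "\<pi> h \<in> B i" for h
        proof -
          obtain u where u: "u \<in> U" "\<pi> h = \<pi> u" using i(2) h(2) by blast
          have "smooth_H (fst (\<omega> t)) h = smooth_H (fst (\<omega> t)) u" by (rule fibre) (use elim(2) h u UG in auto)
          moreover have "\<bar>smooth_H (fst (\<omega> t)) u - smooth_H (fst (\<omega> t)) ?g\<bar> \<le> e" by (rule U(3)[OF u(1) elim(2)])
          ultimately show ?thesis using elim(1) unfolding e_def dist_real_def by argo
        qed
        then show ?case using elim(2) by (simp add: C_def)
      qed
      then show "\<exists>b\<in>\<rat> \<inter> {..<a}. \<exists>i. \<pi> ?g \<in> B i \<and> (\<forall>\<^sub>F t in at_top. fst (\<omega> t) \<in> C b i)"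
        using b i(1) by blast
    next
      assume "\<exists>b\<in>\<rat> \<inter> {..<a}. \<exists>i. \<pi> ?g \<in> B i \<and> (\<forall>\<^sub>F t in at_top. fst (\<omega> t) \<in> C b i)"
      then obtain b i where b: "b < a" "\<pi> ?g \<in> B i" "\<forall>\<^sub>F t in at_top. fst (\<omega> t) \<in> C b i" by blast
      have "\<forall>\<^sub>F t in at_top. smooth_H (fst (\<omega> t)) ?g \<le> b"
        using b(3) by (rule eventually_mono) (use b(2) g in \<open>auto simp: C_def\<close>)
      then have "?Z \<le> b" using lim by (intro tendsto_upperbound) auto
      then show "?Z < a" using b(1) by simp
    qed
  qed
qed

end

section \<open>Invariant events are determined by the limits\<close>

context equivariant_diffusion
begin

lemma left_path_one: "\<omega> \<in> paths S \<Longrightarrow> left_path \<one> \<omega> = \<omega>"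
proof
  fix t assume \<omega>: "\<omega> \<in> paths S"
  show "left_path \<one> \<omega> t = \<omega> t"
  proof (cases "t \<ge> 0")
    case True
    then have "snd (\<omega> t) \<in> carrier G" using pathsD(1)[OF \<omega>] car by (auto simp: mem_Times_iff)
    then show ?thesis using True by (simp add: left_path_at)
  next
    case False
    then show ?thesis using pathsD(3)[OF \<omega>] by (simp add: left_path_def map_path_def extensional_def)
  qed
qed

text \<open>
  Let \<open>M\<close> be the completion of \<open>N\<close> and \<open>W\<close> the difference between the indicator of \<open>A\<close> and its conditional
  expectation given \<open>M\<close>. The averaging over translates is undone by the weight
  \<open>c \<gamma> = E[1\<^sub>A(\<gamma> \<omega>) W(\<omega>)]\<close>, which is continuous in \<open>\<gamma>\<close>: the average \<open>Z\<close> of the translated indicators with this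
  weight is measurable for \<open>M\<close> by \<open>smooth_indicator_event\<close>, hence orthogonal to \<open>W\<close>, while Fubini's theorem
  gives \<open>E[Z W] = \<integral> c\<^sup>2 d\<mu>\<close>. So \<open>c\<close> vanishes almost everywhere, and at the unit because \<open>\<mu>\<close> charges every
  neighbourhood of it. But \<open>c \<one> = E[1\<^sub>A W] = E[W\<^sup>2]\<close>, so \<open>A\<close> belongs to \<open>M\<close>.
\<close>

theorem invariant_event_determined_by_limits:
  assumes A: "A \<in> Inv S (borel_of S) (\<lambda>t \<omega>. \<omega> t)"
    and z: "z \<in> topspace S" and SC: "second_countable TY"
    and open_map: "\<And>U. openin TG U \<Longrightarrow> openin TY (\<pi> ` U)"
    and \<pi>Y: "\<And>g. g \<in> carrier G \<Longrightarrow> \<pi> g \<in> topspace TY"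
    and \<pi>_equi: "\<And>\<gamma> h h'. \<gamma> \<in> carrier G \<Longrightarrow> h \<in> carrier G \<Longrightarrow> h' \<in> carrier G \<Longrightarrow> \<pi> h = \<pi> h' \<Longrightarrow> \<pi> (\<gamma> \<otimes> h) = \<pi> (\<gamma> \<otimes> h')"
    and fibre: "\<And>y h h'. y \<in> topspace TX \<Longrightarrow> h \<in> carrier G \<Longrightarrow> h' \<in> carrier G \<Longrightarrow> \<pi> h = \<pi> h' \<Longrightarrow>
      measure (P (y, h)) A = measure (P (y, h')) A"
    and N: "space N = paths S" "sets N \<subseteq> sets (coord_sigma S {0..})"
    and N_closed: "\<And>C. closedin TX C \<Longrightarrow> {\<omega> \<in> paths S. \<forall>\<^sub>F t in at_top. fst (\<omega> t) \<in> C} \<in> sets N"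
    and N_limit: "\<And>V. openin TY V \<Longrightarrow> {\<omega> \<in> paths S. \<pi> (ginf \<omega>) \<in> V} \<in> sets N"
  shows "A \<in> mod_null (P z) (sets N)"
proof -
  interpret invariant_event MX G MG L P A by unfold_locales (rule A)
  interpret Pz: prob_space "P z" by (rule prob_space_P[OF z])
  note spz = space_P[OF z]
  have CP: "sets (coord_sigma S {0..}) \<subseteq> sets (P z)" using coord_sets_P[OF _ _ z] by blast
  have sN: "sigma_algebra (space (P z)) (sets N)" using sets.sigma_algebra_axioms[of N] N(1) spz by simp
  have sC: "sigma_algebra (space (P z)) (sets (coord_sigma S {0..}))"
    using sets.sigma_algebra_axioms[of "coord_sigma S {0..}"] spz by simp
  have NP: "sets N \<subseteq> sets (P z)" using N(2) CP by blast
  define M where "M = mod_null_measure (P z) (sets N)"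
  define M1 where "M1 = mod_null_measure (P z) (sets (coord_sigma S {0..}))"
  note Ms = mod_null_measure_simps[OF sN NP, folded M_def] and M1s = mod_null_measure_simps[OF sC CP, folded M1_def]
  have M_M1: "subalgebra M1 M"
    unfolding subalgebra_def Ms M1s using N(2) by (auto simp: mod_null_def)
  interpret F: finite_measure_subalgebra "P z" M by standard (rule Ms(3))
  have AP: "A \<in> sets (P z)" by (rule Inv_sets_P[OF A z])
  have iA: "integrable (P z) (indicat_real A)" using AP by (intro integrable_real_indicator) (auto simp: less_top[symmetric])
  define E where "E = real_cond_exp (P z) M (indicat_real A)"
  (* a version of the conditional expectation that is bounded everywhere *)
  define E' where "E' \<omega> = max 0 (min 1 (E \<omega>))" for \<omega>
  define W where "W \<omega> = indicat_real A \<omega> - E' \<omega>" for \<omega>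
  have EM: "E \<in> borel_measurable M" unfolding E_def by (rule borel_measurable_cond_exp)
  then have E'M: "E' \<in> borel_measurable M" unfolding E'_def[abs_def] by measurable
  have E'P: "E' \<in> borel_measurable (P z)" by (rule measurable_from_subalg[OF Ms(3) E'M])
  have EP: "E \<in> borel_measurable (P z)" by (rule measurable_from_subalg[OF Ms(3) EM])
  have "AE \<omega> in P z. E \<omega> \<ge> 0" unfolding E_def by (rule F.real_cond_exp_ge_c[OF iA]) simp
  moreover have "AE \<omega> in P z. E \<omega> \<le> 1" unfolding E_def by (rule F.real_cond_exp_le_c[OF iA]) (simp add: indicator_def)
  ultimately have EE': "AE \<omega> in P z. E' \<omega> = E \<omega>" by eventually_elim (simp add: E'_def)
  have E'b: "0 \<le> E' \<omega>" "E' \<omega> \<le> 1" for \<omega> by (auto simp: E'_def)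
  have Wb: "\<bar>W \<omega>\<bar> \<le> 1" for \<omega> using E'b[of \<omega>] by (auto simp: W_def indicator_def)
  have WP: "W \<in> borel_measurable (P z)" unfolding W_def[abs_def] using E'P AP by measurable
  have iW: "integrable (P z) W" by (rule Pz.integrable_const_bound[where B = 1]) (use Wb WP in auto)
  have WM1: "W \<in> borel_measurable M1"
  proof -
    have "A \<in> sets M1" unfolding M1s using InvD(2)[OF A, of 0] CP by (intro mod_null_generator) auto
    then show ?thesis unfolding W_def[abs_def]
      using measurable_from_subalg[OF M_M1 E'M] by measurable
  qed
  have orth: "(\<integral>\<omega>. f \<omega> * W \<omega> \<partial>P z) = 0" if fM: "f \<in> borel_measurable M" and fb: "\<And>\<omega>. \<bar>f \<omega>\<bar> \<le> 1" for f
  proof -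
    have fP: "f \<in> borel_measurable (P z)" by (rule measurable_from_subalg[OF Ms(3) fM])
    have i: "integrable (P z) (\<lambda>\<omega>. f \<omega> * u \<omega>)" if "u \<in> borel_measurable (P z)" "\<And>\<omega>. \<bar>u \<omega>\<bar> \<le> 1" for u :: "_ \<Rightarrow> real"
      by (rule Pz.integrable_const_bound[where B = 1]) (use fP fb that in \<open>auto simp: abs_mult intro!: mult_le_one\<close>)
    have iE: "integrable (P z) (\<lambda>\<omega>. f \<omega> * E' \<omega>)" by (rule i[OF E'P]) (use E'b in \<open>simp add: abs_le_iff order_trans[of _ 0]\<close>)
    have iI: "integrable (P z) (\<lambda>\<omega>. f \<omega> * indicat_real A \<omega>)" by (rule i) (use AP in \<open>auto simp: indicator_def\<close>)
    have "(\<integral>\<omega>. f \<omega> * E' \<omega> \<partial>P z) = (\<integral>\<omega>. f \<omega> * E \<omega> \<partial>P z)"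
      by (rule integral_cong_AE) (use fP E'P EP EE' in auto)
    also have "\<dots> = (\<integral>\<omega>. f \<omega> * indicat_real A \<omega> \<partial>P z)"
      unfolding E_def by (rule F.real_cond_exp_intg(2)[OF iI fM]) (use AP in simp)
    finally show ?thesis using iE iI by (simp add: W_def right_diff_distrib)
  qed
  define c where "c \<gamma> = (if \<gamma> \<in> carrier G then \<integral>\<omega>. indicator A (left_path \<gamma> \<omega>) * W \<omega> \<partial>P z else 0)" for \<gamma>
  have cb: "\<bar>c \<gamma>\<bar> \<le> 1" for \<gamma>
  proof (cases "\<gamma> \<in> carrier G")
    case True
    have i: "integrable (P z) (\<lambda>\<omega>. indicator A (left_path \<gamma> \<omega>) * W \<omega>)"
      by (rule Pz.integrable_const_bound[where B = 1])
        (use indicator_translate_measurable[OF z True] WP Wb in \<open>auto simp: indicator_def\<close>)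
    have "\<bar>\<integral>\<omega>. indicator A (left_path \<gamma> \<omega>) * W \<omega> \<partial>P z\<bar> \<le> (\<integral>\<omega>. 1 \<partial>P z)"
      by (intro order_trans[OF integral_abs_bound integral_mono]) (use i Wb in \<open>auto simp: indicator_def\<close>)
    then show ?thesis using True by (simp add: c_def Pz.prob_space)
  qed (simp add: c_def)
  have cc: "continuous_map TG euclideanreal c"
  proof (rule continuous_map_real_if_sequentially[OF TG_top(2)])
    fix s p assume s: "\<And>n. s n \<in> topspace TG" and l: "limitin TG s p sequentially"
    have "p \<in> carrier G" "\<And>n. s n \<in> carrier G" using s limitin_topspace[OF l] car by auto
    then show "(\<lambda>n. c (s n)) \<longlonglongrightarrow> c p"
      using translate_continuous[OF z iW WM1[unfolded M1_def] _ l] by (simp add: c_def)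
  qed
  have xz: "fst z \<in> topspace TX" using z by (simp add: mem_Times_iff)
  let ?variation = "\<lambda>\<mu> e. \<exists>V. openin TG V \<and> \<one> \<in> V \<and>
       (\<forall>k\<in>V. \<forall>f\<in>unit_ball_functions TG. \<bar>(\<integral>\<gamma>. f (\<gamma> \<otimes> k) \<partial>\<mu>) - (\<integral>\<gamma>. f \<gamma> \<partial>\<mu>)\<bar> \<le> e)"
  have "\<exists>\<mu>. prob_space \<mu> \<and> sets \<mu> = sets (borel_of TG) \<and>
    (\<forall>U. openin TG U \<longrightarrow> \<one> \<in> U \<longrightarrow> emeasure \<mu> U \<noteq> 0) \<and> (\<forall>e>0. ?variation \<mu> e)"
    by (rule smoothing_measure[OF xz]) blast
  then obtain \<mu> where \<mu>: "prob_space \<mu>" "sets \<mu> = sets (borel_of TG)"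
    and \<mu>_nbhd: "\<And>U. openin TG U \<Longrightarrow> \<one> \<in> U \<Longrightarrow> emeasure \<mu> U \<noteq> 0"
    and \<mu>_var: "\<And>e. e > 0 \<Longrightarrow> ?variation \<mu> e" by blast
  interpret smoothed_event MX G MG L P A \<mu> c
    by (intro smoothed_event.intro smoothed_event_axioms.intro invariant_event_axioms \<mu> \<mu>_var cc cb)
  interpret pair: pair_prob_space \<mu> "P z" ..
  have J: "(\<lambda>p. c (fst p) * indicator A (left_path (fst p) (snd p))) \<in> borel_measurable (\<mu> \<Otimes>\<^sub>M P z)"
    using indicator_pair_measurable[OF sets_\<mu> z] measurable_compose[OF measurable_fst continuous_\<mu>[OF cc]]
    by (intro borel_measurable_times) (simp_all add: case_prod_unfold)
  have Zb: "\<bar>smooth_indicator \<omega>\<bar> \<le> 1" for \<omega>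
  proof (cases "integrable \<mu> (\<lambda>\<gamma>. c \<gamma> * indicator A (left_path \<gamma> \<omega>))")
    case True
    have "\<bar>smooth_indicator \<omega>\<bar> \<le> (\<integral>\<gamma>. 1 \<partial>\<mu>)"
      unfolding smooth_indicator_def
      by (intro order_trans[OF integral_abs_bound integral_mono]) (use True cb in \<open>auto simp: indicator_def\<close>)
    then show ?thesis by (simp add: \<mu>.prob_space)
  qed (simp add: smooth_indicator_def not_integrable_integral_eq)
  have ZP: "smooth_indicator \<in> borel_measurable (P z)"
    unfolding smooth_indicator_def[abs_def]
    using measurable_compose[OF measurable_pair_swap' J]
    by (intro \<mu>.borel_measurable_lebesgue_integral) (simp add: case_prod_unfold)
  obtain B where B: "enumerated_base TY B" using second_countable_enumeration[OF SC] .
  have fibre': "smooth_H y h = smooth_H y h'"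
    if "y \<in> topspace TX" "h \<in> carrier G" "h' \<in> carrier G" "\<pi> h = \<pi> h'" for y h h'
    unfolding smooth_H_def
  proof (rule Bochner_Integration.integral_cong[OF refl])
    fix \<gamma> assume "\<gamma> \<in> space \<mu>"
    then have "H (y, \<gamma> \<otimes> h) = H (y, \<gamma> \<otimes> h')"
      unfolding H_def using that by (intro fibre \<pi>_equi) (auto simp: space_\<mu>)
    then show "c \<gamma> * H (y, \<gamma> \<otimes> h) = c \<gamma> * H (y, \<gamma> \<otimes> h')" by simp
  qed
  let ?C = "\<lambda>b i. {y \<in> topspace TX. \<forall>h\<in>carrier G. \<pi> h \<in> B i \<longrightarrow> smooth_H y h \<le> b}"
  have C_closed: "closedin TX (?C b i)" for b i
    by (rule smooth_indicator_event(1)[OF z SC B]) (blast intro: open_map \<pi>Y fibre')+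
  have level: "AE \<omega> in P z. smooth_indicator \<omega> < a \<longleftrightarrow>
      (\<exists>b\<in>\<rat> \<inter> {..<a}. \<exists>i. \<pi> (ginf \<omega>) \<in> B i \<and> (\<forall>\<^sub>F t in at_top. fst (\<omega> t) \<in> ?C b i))" for a
    by (rule smooth_indicator_event(2)[OF z SC B]) (blast intro: open_map \<pi>Y fibre')+
  have ZM: "smooth_indicator \<in> borel_measurable M"
    unfolding borel_measurable_iff_less
  proof
    fix a
    let ?D = "\<Union>b\<in>\<rat> \<inter> {..<a}. \<Union>i. {\<omega> \<in> paths S. \<pi> (ginf \<omega>) \<in> B i} \<inter> {\<omega> \<in> paths S. \<forall>\<^sub>F t in at_top. fst (\<omega> t) \<in> ?C b i}"
    have D: "?D \<in> sets N"
    proof (rule sets.countable_UN''; (rule sets.countable_UN, rule image_subsetI)?)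
      show "countable (\<rat> \<inter> {..<a})" using countable_rat by blast
      show "{\<omega> \<in> paths S. \<pi> (ginf \<omega>) \<in> B i} \<inter> {\<omega> \<in> paths S. \<forall>\<^sub>F t in at_top. fst (\<omega> t) \<in> ?C b i} \<in> sets N" for b i
        by (intro sets.Int N_limit N_closed enumerated_baseD(1)[OF B] C_closed)
    qed
    have "{w \<in> space (P z). smooth_indicator w < a} \<in> mod_null (P z) (sets N)"
    proof (rule mod_null_AE[OF _ D])
      show "{w \<in> space (P z). smooth_indicator w < a} \<in> sets (P z)" using ZP by measurable
      show "?D \<in> sets (P z)" using D NP by blast
      show "AE x in P z. x \<in> {w \<in> space (P z). smooth_indicator w < a} \<longleftrightarrow> x \<in> ?D"
        using level[of a] by (rule AE_mp) (intro AE_I2 impI, auto simp: spz)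
    qed
    then show "{w \<in> space M. smooth_indicator w < a} \<in> sets M" by (simp add: Ms)
  qed
  have "(\<integral>\<gamma>. c \<gamma> * c \<gamma> \<partial>\<mu>) = (\<integral>\<gamma>. (\<integral>\<omega>. c \<gamma> * indicator A (left_path \<gamma> \<omega>) * W \<omega> \<partial>P z) \<partial>\<mu>)"
    by (rule Bochner_Integration.integral_cong[OF refl]) (simp add: c_def[of _] space_\<mu> mult.assoc)
  also have "\<dots> = (\<integral>\<omega>. (\<integral>\<gamma>. c \<gamma> * indicator A (left_path \<gamma> \<omega>) * W \<omega> \<partial>\<mu>) \<partial>P z)"
  proof (rule pair.Fubini_integral[symmetric])
    show "integrable (\<mu> \<Otimes>\<^sub>M P z) (\<lambda>(\<gamma>, \<omega>). c \<gamma> * indicator A (left_path \<gamma> \<omega>) * W \<omega>)"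
      unfolding case_prod_unfold
    proof (rule pair.P.integrable_const_bound[where B = 1])
      show "AE p in \<mu> \<Otimes>\<^sub>M P z. norm (c (fst p) * indicator A (left_path (fst p) (snd p)) * W (snd p)) \<le> 1"
        using cb Wb by (intro AE_I2) (auto simp: abs_mult indicator_def intro!: mult_le_one)
      show "(\<lambda>p. c (fst p) * indicator A (left_path (fst p) (snd p)) * W (snd p)) \<in> borel_measurable (\<mu> \<Otimes>\<^sub>M P z)"
        by (rule borel_measurable_times[OF J measurable_compose[OF measurable_snd WP]])
    qed
  qed
  also have "\<dots> = (\<integral>\<omega>. smooth_indicator \<omega> * W \<omega> \<partial>P z)"
    by (rule Bochner_Integration.integral_cong[OF refl]) (simp add: smooth_indicator_def)
  also have "\<dots> = 0" by (rule orth[OF ZM Zb])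
  finally have c0: "(\<integral>\<gamma>. c \<gamma> * c \<gamma> \<partial>\<mu>) = 0" .
  have ic: "integrable \<mu> (\<lambda>\<gamma>. c \<gamma> * c \<gamma>)"
  proof (rule \<mu>.integrable_const_bound[where B = 1])
    have "\<bar>c \<gamma> * c \<gamma>\<bar> \<le> 1" for \<gamma> unfolding abs_mult using cb[of \<gamma>] by (intro mult_le_one) auto
    then show "AE \<gamma> in \<mu>. norm (c \<gamma> * c \<gamma>) \<le> 1" by simp
  qed (use continuous_\<mu>[OF cc] in simp)
  have AEc: "AE \<gamma> in \<mu>. c \<gamma> = 0"
    using integral_nonneg_eq_0_iff_AE[OF ic] c0 by simp
  have c1: "c \<one> = 0"
  proof (rule ccontr)
    assume "c \<one> \<noteq> 0"
    let ?U = "{\<gamma> \<in> topspace TG. c \<gamma> \<in> - {0}}"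
    have U: "openin TG ?U" by (rule openin_continuous_map_preimage[OF cc]) (simp add: open_Compl)
    have "emeasure \<mu> ?U \<noteq> 0" by (rule \<mu>_nbhd[OF U]) (use \<open>c \<one> \<noteq> 0\<close> car in simp)
    moreover have "?U \<in> null_sets \<mu>"
    proof (subst AE_iff_null_sets)
      show "?U \<in> sets \<mu>" unfolding sets_\<mu> by (rule borel_of_open[OF U])
      show "AE \<gamma> in \<mu>. \<gamma> \<notin> ?U" using AEc by (rule AE_mp) auto
    qed
    ultimately show False by auto
  qed
  have "(\<integral>\<omega>. indicator A \<omega> * W \<omega> \<partial>P z) = c \<one>"
    unfolding c_def by (simp, rule Bochner_Integration.integral_cong[OF refl]) (simp add: left_path_one spz)
  then have 1: "(\<integral>\<omega>. indicator A \<omega> * W \<omega> \<partial>P z) = 0" using c1 by simp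
  have 2: "(\<integral>\<omega>. E' \<omega> * W \<omega> \<partial>P z) = 0"
    by (rule orth[OF E'M]) (use E'b in \<open>simp add: abs_le_iff order_trans[of _ 0]\<close>)
  have i1: "integrable (P z) (\<lambda>\<omega>. indicat_real A \<omega> * W \<omega>)"
    by (rule Pz.integrable_const_bound[where B = 1]) (use WP Wb AP in \<open>auto simp: indicator_def\<close>)
  have i2: "integrable (P z) (\<lambda>\<omega>. E' \<omega> * W \<omega>)"
    by (rule Pz.integrable_const_bound[where B = 1]) (use WP Wb E'P E'b in \<open>auto simp: abs_mult intro!: mult_le_one\<close>)
  have WW: "W \<omega> * W \<omega> = indicat_real A \<omega> * W \<omega> - E' \<omega> * W \<omega>" for \<omega>
    by (simp add: W_def left_diff_distrib)
  have "(\<integral>\<omega>. W \<omega> * W \<omega> \<partial>P z) = 0" unfolding WW using i1 i2 1 2 by simp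
  moreover have "integrable (P z) (\<lambda>\<omega>. W \<omega> * W \<omega>)" unfolding WW using i1 i2 by simp
  ultimately have W0: "AE \<omega> in P z. W \<omega> = 0"
    using integral_nonneg_eq_0_iff_AE[of "P z" "\<lambda>\<omega>. W \<omega> * W \<omega>"] by simp
  let ?B = "{\<omega> \<in> space M. E' \<omega> > 1 / 2}"
  have "?B \<in> sets M" using E'M by measurable
  then have BN: "?B \<in> mod_null (P z) (sets N)" by (simp add: Ms)
  then obtain D where BP: "?B \<in> sets (P z)" and D: "D \<in> sets N" "sym_diff ?B D \<in> null_sets (P z)"
    unfolding mod_null_def by auto
  show ?thesis
  proof (rule mod_null_AE[OF AP D(1)])
    show "D \<in> sets (P z)" using D(1) NP by blast
    have "AE x in P z. x \<notin> sym_diff ?B D" using D(2) by (rule AE_not_in)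
    then show "AE x in P z. x \<in> A \<longleftrightarrow> x \<in> D" using W0
    proof (rule AE_mp[OF AE_conjI], intro AE_I2 impI)
      fix x assume "x \<in> space (P z)" "x \<notin> sym_diff ?B D \<and> W x = 0"
      moreover from this have "x \<in> A \<longleftrightarrow> x \<in> ?B" by (cases "x \<in> A") (auto simp: W_def Ms)
      ultimately show "x \<in> A \<longleftrightarrow> x \<in> D" by blast
    qed
  qed
qed

end

section \<open>Passage to the homogeneous space\<close>

lemma Inv_pullback:
  assumes h: "continuous_map T T' h" and p: "\<And>z. z \<in> topspace T' \<Longrightarrow> p z \<in> space N"
    and A: "A \<in> Inv T' N (\<lambda>t \<omega>. p (\<omega> t))"
  shows "map_path h -` A \<inter> paths T \<in> Inv T N (\<lambda>t \<omega>. p (h (\<omega> t)))"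
proof (rule InvI)
  fix t :: real assume t: "t \<ge> 0"
  let ?N = "process_sigma (paths T) N (\<lambda>t \<omega>. p (h (\<omega> t))) {t..}"
  have "map_path h \<in> ?N \<rightarrow>\<^sub>M process_sigma (paths T') N (\<lambda>t \<omega>. p (\<omega> t)) {t..}"
  proof (rule measurable_process_sigmaI)
    show "map_path h w \<in> paths T'" if "w \<in> space ?N" for w using map_path_paths[OF h] that by simp
    fix s assume s: "s \<in> {t..}"
    have "h (\<omega> s) \<in> topspace T'" if "\<omega> \<in> paths T" for \<omega>
      using pathsD(1)[OF that, of s] h s t by (auto simp: continuous_map_def)
    then have "(\<lambda>\<omega>. p (h (\<omega> s))) \<in> ?N \<rightarrow>\<^sub>M N"
      using process_sigma_coordinate[of s "{t..}" "paths T" "\<lambda>t \<omega>. p (h (\<omega> t))" N] s p by simp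
    then show "(\<lambda>w. p (map_path h w s)) \<in> ?N \<rightarrow>\<^sub>M N" using s t by (simp add: map_path_simps)
  qed
  from measurable_sets[OF this InvD(2)[OF A t]] show "map_path h -` A \<inter> paths T \<in> sets ?N" by simp
next
  fix s :: real and \<omega> assume s: "s > 0" and \<omega>: "\<omega> \<in> paths T"
  have "map_path h (path_shift s \<omega>) = path_shift s (map_path h \<omega>)"
    using s by (auto simp: map_path_def path_shift_def fun_eq_iff)
  then show "path_shift s \<omega> \<in> map_path h -` A \<inter> paths T \<longleftrightarrow> \<omega> \<in> map_path h -` A \<inter> paths T"
    using InvD(3)[OF A, of s "map_path h \<omega>"] map_path_paths[OF h \<omega>] path_shift_paths[OF _ \<omega>, of s] s \<omega> by simp
qed

lemma sigma_sets_subset_mod_null: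
  assumes C: "sigma_algebra (space M) \<C>" "\<C> \<subseteq> sets M" and gen: "\<G> \<subseteq> mod_null M \<C>"
  shows "sigma_sets (space M) \<G> \<subseteq> mod_null M \<C>"
  by (rule sigma_algebra.sigma_sets_subset[OF mod_null_sigma_algebra[OF C] gen])

lemma mod_null_trans:
  assumes B: "B \<in> mod_null M \<C>" and sub: "\<C> \<subseteq> mod_null M \<C>'" and C': "\<C>' \<subseteq> sets M"
  shows "B \<in> mod_null M \<C>'"
proof -
  obtain D where BM: "B \<in> sets M" and D: "D \<in> \<C>" "sym_diff B D \<in> null_sets M" using B by (auto simp: mod_null_def)
  obtain D' where DM: "D \<in> sets M" and D': "D' \<in> \<C>'" "sym_diff D D' \<in> null_sets M"
    using sub D(1) by (auto simp: mod_null_def)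
  have "sym_diff B D' \<in> null_sets M"
    by (rule null_sets_subset[OF null_sets.Un[OF D(2) D'(2)]]) (use BM DM D'(1) C' in auto)
  then show ?thesis using BM D'(1) by (auto simp: mod_null_def)
qed

locale lifted_diffusion = equivariant_diffusion +
  fixes K :: "'b set" and MY :: "'b set manifold" and Q :: "'a \<times> 'b set \<Rightarrow> (real \<Rightarrow> 'a \<times> 'b set) measure"
  assumes K: "subgroup K G" and homogeneous: "homogeneous_space G MG K MY"
    and lift: "\<And>x g. x \<in> topspace TX \<Longrightarrow> g \<in> carrier G \<Longrightarrow>
      Q (x, coset_proj G K g) = distr (P (x, g)) (path_borel (prod_topology TX (mtop MY)))
        (map_path (\<lambda>(x, h). (x, coset_proj G K h)))"
begin

abbreviation TY where "TY \<equiv> mtop MY"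
abbreviation SY where "SY \<equiv> prod_topology TX TY"
abbreviation \<pi> where "\<pi> \<equiv> coset_proj G K"
abbreviation state_proj where "state_proj \<equiv> \<lambda>(x, h). (x, \<pi> h)"

lemma K_sub: "K \<subseteq> carrier G" by (rule subgroup.subset[OF K])

lemma TY_top: "Hausdorff_space TY" "second_countable TY" "locally_compact_space TY" "regular_space TY"
  using smooth_manifold_topology[of MY] homogeneous by (auto simp: homogeneous_space_def)

lemma topspace_TY: "topspace TY = \<pi> ` carrier G"
  using homogeneous by (simp add: homogeneous_space_def)

lemma \<pi>_quotient: "quotient_map TG TY \<pi>"
  using homogeneous by (simp add: homogeneous_space_def)

lemma \<pi>_continuous: "continuous_map TG TY \<pi>"
  by (rule quotient_imp_continuous_map[OF \<pi>_quotient])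

lemma \<pi>_left: "\<gamma> \<in> carrier G \<Longrightarrow> h \<in> carrier G \<Longrightarrow> \<pi> (\<gamma> \<otimes> h) = \<gamma> <# \<pi> h"
  unfolding coset_proj_def by (rule G.lcos_m_assoc[symmetric]) (use K_sub in auto)

lemma \<pi>_right: "h \<in> carrier G \<Longrightarrow> k \<in> K \<Longrightarrow> \<pi> (h \<otimes> k) = \<pi> h"
  using \<pi>_left[of h k] K_sub G.coset_join3[of k K] K by (auto simp: coset_proj_def)

lemma \<pi>_fibre:
  assumes "g \<in> carrier G" "h \<in> carrier G" "\<pi> g = \<pi> h"
  obtains k where "k \<in> K" "h = g \<otimes> k"
proof -
  have "h \<in> \<pi> h" unfolding coset_proj_def l_coset_def
    using subgroup.one_closed[OF K] assms(2) by (intro UN_I[of "\<one>"]) auto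
  then have "h \<in> \<pi> g" using assms(3) by simp
  then show ?thesis using that by (auto simp: coset_proj_def l_coset_def)
qed

text \<open>
  The saturation of \<open>U\<close> is the union of the right translates of \<open>U\<close> by elements of \<open>K\<close>.
\<close>

lemma \<pi>_open:
  assumes U: "openin TG U"
  shows "openin TY (\<pi> ` U)"
proof -
  have UG: "U \<subseteq> carrier G" using openin_subset[OF U] car by simp
  have "{g \<in> topspace TG. \<pi> g \<in> \<pi> ` U} = (\<Union>k\<in>K. {g \<in> topspace TG. g \<otimes> k \<in> U})"
  proof (intro equalityI subsetI)
    fix g assume "g \<in> {g \<in> topspace TG. \<pi> g \<in> \<pi> ` U}"
    then obtain u where g: "g \<in> carrier G" and u: "u \<in> U" "\<pi> g = \<pi> u" using car by auto
    obtain k where "k \<in> K" "u = g \<otimes> k" using \<pi>_fibre[OF g _ u(2)] u(1) UG by blast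
    then show "g \<in> (\<Union>k\<in>K. {g \<in> topspace TG. g \<otimes> k \<in> U})" using u(1) g car by auto
  next
    fix g assume "g \<in> (\<Union>k\<in>K. {g \<in> topspace TG. g \<otimes> k \<in> U})"
    then obtain k where k: "k \<in> K" "g \<in> carrier G" "g \<otimes> k \<in> U" using car by auto
    then have "\<pi> g \<in> \<pi> ` U" using \<pi>_right[OF k(2,1)] by (metis imageI)
    then show "g \<in> {g \<in> topspace TG. \<pi> g \<in> \<pi> ` U}" using k(2) car by simp
  qed
  moreover have "openin TG (\<Union>k\<in>K. {g \<in> topspace TG. g \<otimes> k \<in> U})"
    using openin_continuous_map_preimage[OF right_mult_cont U] K_sub by (intro openin_Union) auto
  ultimately have "openin TG {g \<in> topspace TG. \<pi> g \<in> \<pi> ` U}" by simp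
  moreover have "\<pi> ` U \<subseteq> topspace TY" unfolding topspace_TY using UG by (rule image_mono)
  ultimately show ?thesis using \<pi>_quotient unfolding quotient_map_def by blast
qed

lemma state_proj_continuous: "continuous_map S SY state_proj"
proof -
  have "continuous_map S TY (\<lambda>z. \<pi> (snd z))"
    using continuous_map_compose[OF continuous_map_snd \<pi>_continuous] by (simp add: o_def)
  then have "continuous_map S SY (\<lambda>z. (fst z, \<pi> (snd z)))"
    by (simp add: continuous_map_pairwise o_def continuous_map_fst)
  then show ?thesis by (simp add: case_prod_unfold)
qed

definition path_proj where "path_proj = map_path state_proj"

lemma path_proj_at: "t \<ge> 0 \<Longrightarrow> path_proj \<omega> t = (fst (\<omega> t), \<pi> (snd (\<omega> t)))"
  by (simp add: path_proj_def map_path_simps case_prod_unfold)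

lemma path_proj_paths: "\<omega> \<in> paths S \<Longrightarrow> path_proj \<omega> \<in> paths SY"
  unfolding path_proj_def by (rule map_path_paths[OF state_proj_continuous])

lemma path_proj_P: "z \<in> topspace S \<Longrightarrow> path_proj \<in> P z \<rightarrow>\<^sub>M path_borel SY"
  unfolding path_proj_def using map_path_measurable[OF state_proj_continuous] measurable_cong_sets[OF sets_P refl] by blast

lemma Q_distr: "x \<in> topspace TX \<Longrightarrow> g \<in> carrier G \<Longrightarrow> Q (x, \<pi> g) = distr (P (x, g)) (path_borel SY) path_proj"
  unfolding path_proj_def by (rule lift)

lemma Inv_path_proj:
  assumes A: "A \<in> Inv SY (borel_of SY) (\<lambda>t \<omega>. \<omega> t)"
  shows "path_proj -` A \<inter> paths S \<in> Inv S (borel_of S) (\<lambda>t \<omega>. \<omega> t)"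
  using Inv_pullback[OF state_proj_continuous, of "\<lambda>z. z" "borel_of SY" A] A
    Inv_factor_mono[OF state_proj_continuous] unfolding path_proj_def by auto

lemma Inv_SY_path_borel:
  assumes "A \<in> Inv SY (borel_of SY) (\<lambda>t \<omega>. \<omega> t)"
  shows "A \<in> sets (path_borel SY)"
  using InvD(2)[OF assms, of 0] coord_sigma_path_borel[of "{0..}" SY] by auto

lemma Inv_fst_subset: "Inv SY (borel_of TX) (\<lambda>t \<omega>. fst (\<omega> t)) \<subseteq> Inv SY (borel_of SY) (\<lambda>t \<omega>. \<omega> t)"
  by (rule Inv_factor_mono[OF continuous_map_fst])

lemma path_proj_limit:
  assumes "limitin TG (\<lambda>t. snd (\<omega> t)) (ginf \<omega>) at_top"
  shows "limitin TY (\<lambda>t. snd (path_proj \<omega> t)) (\<pi> (ginf \<omega>)) at_top"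
proof -
  have "limitin TY (\<pi> \<circ> (\<lambda>t. snd (\<omega> t))) (\<pi> (ginf \<omega>)) at_top"
    by (rule continuous_map_limit[OF \<pi>_continuous assms])
  then show ?thesis
    by (rule limitin_transform_eventually[rotated])
      (auto intro: eventually_mono[OF eventually_ge_at_top[of 0]] simp: path_proj_at)
qed

definition ylim :: "(real \<Rightarrow> 'a \<times> 'b set) \<Rightarrow> 'b set" where
  "ylim \<omega> = end_limit TY (\<lambda>t. snd (\<omega> t))"

lemma ylim_measurable: "ylim \<in> inv_sigma SY (borel_of SY) (\<lambda>t \<omega>. \<omega> t) \<rightarrow>\<^sub>M borel_of TY"
proof -
  have "topspace TY \<noteq> {}" using topspace_TY by auto
  then have "ylim \<in> inv_sigma SY (borel_of TY) (\<lambda>t \<omega>. snd (\<omega> t)) \<rightarrow>\<^sub>M borel_of TY"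
    unfolding ylim_def[abs_def] by (rule end_limit_measurable[OF TY_top(1,3,2) _ continuous_map_snd])
  then show ?thesis
    by (rule measurable_from_subalg[rotated])
      (use Inv_factor_mono[OF continuous_map_snd, of TX TY] in \<open>auto simp: subalgebra_def\<close>)
qed

lemma ylim_AE_limit:
  assumes x: "x \<in> topspace TX" and g: "g \<in> carrier G"
  shows "AE_limit (Q (x, \<pi> g)) TY (\<lambda>t \<omega>. snd (\<omega> t)) ylim"
  unfolding AE_limit_def
proof
  have z: "(x, g) \<in> topspace S" using x g car by simp
  note Qd = Q_distr[OF x g]
  show "ylim \<in> Q (x, \<pi> g) \<rightarrow>\<^sub>M borel_of TY"
    by (rule measurable_from_subalg[OF _ ylim_measurable])
      (use Inv_SY_path_borel in \<open>auto simp: subalgebra_def Qd\<close>)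
  let ?L = "{\<omega> \<in> paths SY. limitin TY (\<lambda>t. snd (\<omega> t)) (ylim \<omega>) at_top}"
  have "?L = {\<omega> \<in> paths SY. \<exists>l. limitin TY (\<lambda>t. snd (\<omega> t)) l at_top}"
    using end_limit_eq[OF TY_top(1)] by (auto simp: ylim_def)
  also have "\<dots> \<in> sets (path_borel SY)"
    using limit_exists_Inv[OF TY_top(1,3,2) continuous_map_snd] Inv_factor_mono[OF continuous_map_snd, of TX TY]
    by (intro Inv_SY_path_borel) auto
  finally have L: "{\<omega> \<in> space (path_borel SY). limitin TY (\<lambda>t. snd (\<omega> t)) (ylim \<omega>) at_top} \<in> sets (path_borel SY)" by simp
  have "AE \<omega> in P (x, g). limitin TG (\<lambda>t. snd (\<omega> t)) (ginf \<omega>) at_top" by (rule AE_converges[OF z])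
  then have "AE \<omega> in P (x, g). limitin TY (\<lambda>t. snd (path_proj \<omega> t)) (ylim (path_proj \<omega>)) at_top"
  proof (rule AE_mp, intro AE_I2 impI)
    fix \<omega> assume "limitin TG (\<lambda>t. snd (\<omega> t)) (ginf \<omega>) at_top"
    then have l: "limitin TY (\<lambda>t. snd (path_proj \<omega> t)) (\<pi> (ginf \<omega>)) at_top" by (rule path_proj_limit)
    then have "ylim (path_proj \<omega>) = \<pi> (ginf \<omega>)" unfolding ylim_def by (rule end_limit_eq[OF TY_top(1)])
    then show "limitin TY (\<lambda>t. snd (path_proj \<omega> t)) (ylim (path_proj \<omega>)) at_top" using l by simp
  qed
  then show "AE \<omega> in Q (x, \<pi> g). limitin TY (\<lambda>t. snd (\<omega> t)) (ylim \<omega>) at_top"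
    unfolding Qd using AE_distr_iff[OF path_proj_P[OF z] L] by simp
qed

lemma generated_by_eq: "generated_by \<Omega> N V = {{\<omega> \<in> \<Omega>. V \<omega> \<in> B} | B. B \<in> sets N}"
proof -
  have "V -` B \<inter> \<Omega> = {\<omega> \<in> \<Omega>. V \<omega> \<in> B}" for B by auto
  then show ?thesis by (simp add: generated_by_def)
qed

text \<open>
  An invariant event pulls back to an invariant event of the lifted process whose probability depends on
  the starting point only through its projection. The lifted event is then determined by the two kinds
  of events in \<open>\<K>\<close>, and each of them is, up to null sets, the preimage of an event generated by the
  \<open>X\<close>-component and \<open>yinf\<close>. Conversely \<open>yinf\<close> agrees almost surely with \<open>ylim\<close>, which is measurable with
  respect to the invariant sigma field.
\<close>

lemma invariant_generated_by_limits:
  assumes x: "x \<in> topspace TX" and g: "g \<in> carrier G"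
    and yinf: "AE_limit (Q (x, \<pi> g)) TY (\<lambda>t \<omega>. snd (\<omega> t)) yinf"
  shows "coincide_mod_null (Q (x, \<pi> g)) (Inv SY (borel_of SY) (\<lambda>t \<omega>. \<omega> t))
    (sigma_sets (paths SY) (Inv SY (borel_of TX) (\<lambda>t \<omega>. fst (\<omega> t)) \<union> generated_by (paths SY) (borel_of TY) yinf))"
    (is "coincide_mod_null ?Q ?I (sigma_sets _ ?gen)")
proof -
  have z: "(x, g) \<in> topspace S" using x g car by simp
  note Qd = Q_distr[OF x g] and pp = path_proj_P[OF z]
  have sQ: "sets ?Q = sets (path_borel SY)" "space ?Q = paths SY" unfolding Qd by simp_all
  have ym: "yinf \<in> path_borel SY \<rightarrow>\<^sub>M borel_of TY" and yl: "AE \<omega> in ?Q. limitin TY (\<lambda>t. snd (\<omega> t)) (yinf \<omega>) at_top"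
    using yinf measurable_cong_sets[OF sQ(1) refl] unfolding AE_limit_def by auto
  let ?G = "sigma_sets (paths SY) ?gen"
  have IP: "?I \<subseteq> sets ?Q" using Inv_SY_path_borel sQ by auto
  have Ev: "{\<omega> \<in> paths SY. yinf \<omega> \<in> B} \<in> sets (path_borel SY)" if "B \<in> sets (borel_of TY)" for B
  proof -
    have "yinf -` B \<inter> space (path_borel SY) = {\<omega> \<in> paths SY. yinf \<omega> \<in> B}" by auto
    then show ?thesis using measurable_sets[OF ym that] by simp
  qed
  have genP: "?gen \<subseteq> sets (path_borel SY)"
    using Inv_fst_subset Inv_SY_path_borel Ev unfolding generated_by_eq by auto
  have GP: "?G \<subseteq> sets (path_borel SY)" using sets.sigma_sets_subset[OF genP] by simp
  have "?G \<subseteq> mod_null ?Q ?I"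
  proof -
    have sa: "sigma_algebra (space ?Q) ?I" unfolding sQ by (rule Inv_sigma_algebra)
    have "?gen \<subseteq> mod_null ?Q ?I"
    proof
      fix E assume "E \<in> ?gen"
      then consider "E \<in> ?I" | B where "B \<in> sets (borel_of TY)" "E = {\<omega> \<in> paths SY. yinf \<omega> \<in> B}"
        using Inv_fst_subset unfolding generated_by_eq by blast
      then show "E \<in> mod_null ?Q ?I"
      proof cases
        case 1
        then show ?thesis using mod_null_generator[OF IP] by simp
      next
        case 2
        let ?D = "{\<omega> \<in> paths SY. ylim \<omega> \<in> B}"
        have "ylim -` B \<inter> paths SY \<in> ?I" using measurable_sets[OF ylim_measurable 2(1)] by simp
        moreover have "ylim -` B \<inter> paths SY = ?D" by auto
        ultimately have D: "?D \<in> ?I" by simp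
        show ?thesis
        proof (rule mod_null_AE[OF _ D])
          show "E \<in> sets ?Q" "?D \<in> sets ?Q" using Ev[OF 2(1)] 2(2) IP D sQ by auto
          show "AE \<omega> in ?Q. \<omega> \<in> E \<longleftrightarrow> \<omega> \<in> ?D"
            using yl by (rule AE_mp) (auto simp: 2(2) ylim_def end_limit_eq[OF TY_top(1)])
        qed
      qed
    qed
    from sigma_sets_subset_mod_null[OF sa IP this] show ?thesis by (simp add: sQ)
  qed
  then have second: "\<forall>E\<in>?G. \<exists>A\<in>?I. (A - E) \<union> (E - A) \<in> null_sets ?Q"
    unfolding mod_null_def by (auto simp: Un_commute)
  have first: "\<exists>E\<in>?G. (A - E) \<union> (E - A) \<in> null_sets ?Q" if A: "A \<in> ?I" for A
  proof -
    define A' where "A' = path_proj -` A \<inter> paths S"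
    have A': "A' \<in> Inv S (borel_of S) (\<lambda>t \<omega>. \<omega> t)" unfolding A'_def by (rule Inv_path_proj[OF A])
    define \<K> where "\<K> = {{\<omega> \<in> paths S. \<forall>\<^sub>F t in at_top. fst (\<omega> t) \<in> C} | C. closedin TX C} \<union>
      {{\<omega> \<in> paths S. \<pi> (ginf \<omega>) \<in> V} | V. openin TY V}"
    define N where "N = sigma (paths S) \<K>"
    have limit_Inv: "{\<omega> \<in> paths S. \<pi> (ginf \<omega>) \<in> V} \<in> Inv S (borel_of S) (\<lambda>t \<omega>. \<omega> t)" if "openin TY V" for V
    proof -
      have "(\<lambda>\<omega>. \<pi> (ginf \<omega>)) \<in> inv_sigma S (borel_of S) (\<lambda>t \<omega>. \<omega> t) \<rightarrow>\<^sub>M borel_of TY"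
        by (rule measurable_compose[OF ginf_measurable continuous_map_measurable[OF \<pi>_continuous]])
      from measurable_sets[OF this borel_of_open[OF that]] show ?thesis by (simp add: vimage_def Int_def conj_commute)
    qed
    have closed_Inv: "{\<omega> \<in> paths S. \<forall>\<^sub>F t in at_top. fst (\<omega> t) \<in> C} \<in> Inv S (borel_of S) (\<lambda>t \<omega>. \<omega> t)" if "closedin TX C" for C
      using eventually_closed_Inv[OF continuous_map_fst that] Inv_factor_mono[OF continuous_map_fst, of TX TG] by blast
    have KI: "\<K> \<subseteq> Inv S (borel_of S) (\<lambda>t \<omega>. \<omega> t)" using limit_Inv closed_Inv by (auto simp: \<K>_def)
    have KP: "\<K> \<subseteq> Pow (paths S)" using KI InvD(1) by fast
    have N: "space N = paths S" "sets N = sigma_sets (paths S) \<K>" unfolding N_def using KP by (simp_all add: space_measure_of_conv)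
    have NI: "sets N \<subseteq> Inv S (borel_of S) (\<lambda>t \<omega>. \<omega> t)"
      unfolding N by (rule sigma_algebra.sigma_sets_subset[OF Inv_sigma_algebra KI])
    have "A' \<in> mod_null (P (x, g)) (sets N)"
    proof (rule invariant_event_determined_by_limits[OF A' z TY_top(2), where \<pi> = \<pi>])
      show "openin TY (\<pi> ` U)" if "openin TG U" for U by (rule \<pi>_open[OF that])
      show "\<pi> g \<in> topspace TY" if "g \<in> carrier G" for g using that topspace_TY by simp
      show "\<pi> (\<gamma> \<otimes> h) = \<pi> (\<gamma> \<otimes> h')" if "\<gamma> \<in> carrier G" "h \<in> carrier G" "h' \<in> carrier G" "\<pi> h = \<pi> h'" for \<gamma> h h'
        using that by (simp add: \<pi>_left)
      have QA: "measure (P (y, h)) A' = measure (Q (y, \<pi> h)) A" if "y \<in> topspace TX" "h \<in> carrier G" for y h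
      proof -
        have zy: "(y, h) \<in> topspace S" using that car by simp
        show ?thesis unfolding Q_distr[OF that] A'_def
          using measure_distr[OF path_proj_P[OF zy] Inv_SY_path_borel[OF A]] space_P[OF zy] by simp
      qed
      show "measure (P (y, h)) A' = measure (P (y, h')) A'"
        if "y \<in> topspace TX" "h \<in> carrier G" "h' \<in> carrier G" "\<pi> h = \<pi> h'" for y h h'
        using that by (simp add: QA)
      show "space N = paths S" by (rule N)
      show "sets N \<subseteq> sets (coord_sigma S {0..})" using NI InvD(2)[of _ S "borel_of S" "\<lambda>t \<omega>. \<omega> t" 0] by auto
      show "{\<omega> \<in> paths S. \<forall>\<^sub>F t in at_top. fst (\<omega> t) \<in> C} \<in> sets N" if "closedin TX C" for C
        unfolding N using that by (intro sigma_sets.Basic) (auto simp: \<K>_def)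
      show "{\<omega> \<in> paths S. \<pi> (ginf \<omega>) \<in> V} \<in> sets N" if "openin TY V" for V
        unfolding N using that by (intro sigma_sets.Basic) (auto simp: \<K>_def)
    qed
    define \<V> where "\<V> = {path_proj -` E \<inter> paths S | E. E \<in> ?G}"
    have spz: "space (P (x, g)) = paths S" by (rule space_P[OF z])
    have VP: "\<V> \<subseteq> sets (P (x, g))"
      using measurable_sets[OF pp] GP spz unfolding \<V>_def by auto
    have saV: "sigma_algebra (space (P (x, g))) \<V>"
    proof -
      let ?M = "sigma (paths SY) ?gen"
      have M: "space ?M = paths SY" "sets ?M = ?G"
        using genP sets.sets_into_space[of _ "path_borel SY"] by (auto simp: space_measure_of_conv intro!: sets_measure_of)
      have "path_proj \<in> paths S \<rightarrow> space ?M" using path_proj_paths M by auto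
      then have "sets (vimage_algebra (paths S) path_proj ?M) = \<V>"
        unfolding \<V>_def by (simp add: sets_vimage_algebra2 M)
      then show ?thesis using sets.sigma_algebra_axioms[of "vimage_algebra (paths S) path_proj ?M"] by (simp add: spz)
    qed
    have "\<K> \<subseteq> mod_null (P (x, g)) \<V>"
    proof
      fix E assume "E \<in> \<K>"
      then consider C where "closedin TX C" "E = {\<omega> \<in> paths S. \<forall>\<^sub>F t in at_top. fst (\<omega> t) \<in> C}"
        | V where "openin TY V" "E = {\<omega> \<in> paths S. \<pi> (ginf \<omega>) \<in> V}" unfolding \<K>_def by blast
      then show "E \<in> mod_null (P (x, g)) \<V>"
      proof cases
        case 1
        let ?E = "{\<omega> \<in> paths SY. \<forall>\<^sub>F t in at_top. fst (\<omega> t) \<in> C}"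
        have "?E \<in> ?G" using eventually_closed_Inv[OF continuous_map_fst 1(1)] by (intro sigma_sets.Basic) blast
        moreover have "(\<forall>\<^sub>F t in at_top. fst (path_proj \<omega> t) \<in> C) \<longleftrightarrow> (\<forall>\<^sub>F t in at_top. fst (\<omega> t) \<in> C)" for \<omega>
          by (rule eventually_cong) (auto intro: eventually_mono[OF eventually_ge_at_top[of 0]] simp: path_proj_at)
        then have "E = path_proj -` ?E \<inter> paths S" using path_proj_paths by (auto simp: 1(2))
        ultimately have "E \<in> \<V>" unfolding \<V>_def by blast
        then show ?thesis by (rule mod_null_generator[OF VP])
      next
        case 2
        let ?E = "{\<omega> \<in> paths SY. yinf \<omega> \<in> V}"
        have "?E \<in> ?G" using borel_of_open[OF 2(1)] unfolding generated_by_eq by (intro sigma_sets.Basic) blast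
        then have D: "path_proj -` ?E \<inter> paths S \<in> \<V>" unfolding \<V>_def by blast
        show ?thesis
        proof (rule mod_null_AE[OF _ D])
          have "E \<in> Inv S (borel_of S) (\<lambda>t \<omega>. \<omega> t)" using limit_Inv 2 by simp
          then show "E \<in> sets (P (x, g))" by (rule Inv_sets_P[OF _ z])
          show "path_proj -` ?E \<inter> paths S \<in> sets (P (x, g))" using D VP by blast
          have "AE \<omega> in P (x, g). limitin TY (\<lambda>t. snd (path_proj \<omega> t)) (yinf (path_proj \<omega>)) at_top"
            using AE_distrD[OF pp yl[unfolded Qd]] .
          then show "AE \<omega> in P (x, g). \<omega> \<in> E \<longleftrightarrow> \<omega> \<in> path_proj -` ?E \<inter> paths S"
            using AE_converges[OF z]
          proof (rule AE_mp[OF AE_conjI], intro AE_I2 impI)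
            fix \<omega> assume "\<omega> \<in> space (P (x, g))" and l: "limitin TY (\<lambda>t. snd (path_proj \<omega> t)) (yinf (path_proj \<omega>)) at_top \<and>
              limitin TG (\<lambda>t. snd (\<omega> t)) (ginf \<omega>) at_top"
            have "yinf (path_proj \<omega>) = \<pi> (ginf \<omega>)"
              by (rule limitin_Hausdorff_unique[OF conjunct1[OF l] path_proj_limit[OF conjunct2[OF l]] _ TY_top(1)]) simp
            then show "\<omega> \<in> E \<longleftrightarrow> \<omega> \<in> path_proj -` ?E \<inter> paths S" using path_proj_paths[of \<omega>] by (auto simp: 2(2))
          qed
        qed
      qed
    qed
    from sigma_sets_subset_mod_null[OF saV VP this]
    have "sets N \<subseteq> mod_null (P (x, g)) \<V>" unfolding N spz .
    with \<open>A' \<in> mod_null (P (x, g)) (sets N)\<close> have "A' \<in> mod_null (P (x, g)) \<V>"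
      by (rule mod_null_trans) (rule VP)
    then obtain E where E: "E \<in> ?G" "sym_diff A' (path_proj -` E \<inter> paths S) \<in> null_sets (P (x, g))"
      unfolding mod_null_def \<V>_def by auto
    have "sym_diff A' (path_proj -` E \<inter> paths S) = path_proj -` sym_diff A E \<inter> space (P (x, g))"
      unfolding A'_def spz by auto
    moreover have "sym_diff A E \<in> sets (path_borel SY)" using Inv_SY_path_borel[OF A] E(1) GP by auto
    ultimately have "sym_diff A E \<in> null_sets ?Q"
      unfolding Qd using E(2) null_sets_distr_iff[OF pp] by simp
    then show ?thesis using E(1) by blast
  qed
  show ?thesis unfolding coincide_mod_null_def using first second by blast
qed

end

theorem theoremB:
  fixes MX :: "'x manifold"
    and G :: "('g, 'b) monoid_scheme" and MG :: "'g manifold"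
    and K :: "'g set" and MY :: "'g set manifold"
    and Q :: "'x \<times> 'g set \<Rightarrow> (real \<Rightarrow> 'x \<times> 'g set) measure"
    and P :: "'x \<times> 'g \<Rightarrow> (real \<Rightarrow> 'x \<times> 'g) measure"
    and L :: "('x \<times> 'g \<Rightarrow> real) \<Rightarrow> 'x \<times> 'g \<Rightarrow> real"
    and \<Lambda> :: "'s measure" and linf :: "(real \<Rightarrow> 'x) \<Rightarrow> 's"
  assumes X: "smooth_manifold MX"
    and G: "lie_group G MG" "connected_space (mtop MG)"
    and K: "subgroup K G" "compactin (mtop MG) K"
    and Y: "homogeneous_space G MG K MY"
    and Q: "diffusion (mprod MX MY) Q"
    and P: "diffusion_with_generator (mprod MX MG) L P"
    and K_equivariant: "right_equivariant MX G MG K P"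
    and devissage: "devissage_condition MX MG P \<Lambda> linf"
    and convergence: "convergence_condition MX MG P"
    and equivariance: "equivariance_condition MX G MG L"
    and regularity: "regularity_condition MX MG P"
    and lift: "\<forall>x\<in>points MX. \<forall>y\<in>points MY. \<forall>g\<in>carrier G. coset_proj G K g = y \<longrightarrow>
      Q (x, y) = distr (P (x, g)) (path_borel (mtop (mprod MX MY)))
                   (map_path (\<lambda>(x, h). (x, coset_proj G K h)))"
  shows "\<forall>x\<in>points MX. \<forall>y\<in>points MY.
    (\<exists>yinf. AE_limit (Q (x, y)) (mtop MY) (\<lambda>t \<omega>. snd (\<omega> t)) yinf) \<and>
    (\<forall>yinf. AE_limit (Q (x, y)) (mtop MY) (\<lambda>t \<omega>. snd (\<omega> t)) yinf \<longrightarrow>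
      coincide_mod_null (Q (x, y))
        (Inv (mtop (mprod MX MY)) (borel_of (mtop (mprod MX MY))) (\<lambda>t \<omega>. \<omega> t))
        (sigma_sets (paths (mtop (mprod MX MY)))
          (Inv (mtop (mprod MX MY)) (borel_of (mtop MX)) (\<lambda>t \<omega>. fst (\<omega> t)) \<union>
           generated_by (paths (mtop (mprod MX MY))) (borel_of (mtop MY)) yinf)))"
proof (intro ballI)
  fix x y assume x: "x \<in> points MX" and y: "y \<in> points MY"
  have grp: "group G" and car: "points MG = carrier G" using G(1) by (auto simp: lie_group_def)
  have proj: "coset_proj G K g \<in> points MY" if "g \<in> carrier G" for g
    using Y that by (auto simp: homogeneous_space_def)
  interpret equivariant_diffusion MX G MG L P
    by (intro equivariant_diffusion.intro equivariant_diffusion_axioms.intro grp X G(1) P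
        convergence equivariance regularity)
  interpret lifted_diffusion MX G MG L P K MY Q
    by (intro lifted_diffusion.intro lifted_diffusion_axioms.intro equivariant_diffusion_axioms K(1) Y)
      (use lift proj in \<open>simp add: mprod_simps\<close>)
  obtain g where g: "g \<in> carrier G" "y = coset_proj G K g"
    using Y y by (auto simp: homogeneous_space_def)
  show "(\<exists>yinf. AE_limit (Q (x, y)) (mtop MY) (\<lambda>t \<omega>. snd (\<omega> t)) yinf) \<and>
    (\<forall>yinf. AE_limit (Q (x, y)) (mtop MY) (\<lambda>t \<omega>. snd (\<omega> t)) yinf \<longrightarrow>
      coincide_mod_null (Q (x, y))
        (Inv (mtop (mprod MX MY)) (borel_of (mtop (mprod MX MY))) (\<lambda>t \<omega>. \<omega> t))
        (sigma_sets (paths (mtop (mprod MX MY)))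
          (Inv (mtop (mprod MX MY)) (borel_of (mtop MX)) (\<lambda>t \<omega>. fst (\<omega> t)) \<union>
           generated_by (paths (mtop (mprod MX MY))) (borel_of (mtop MY)) yinf)))"
    unfolding mprod_simps g(2)
    using ylim_AE_limit[OF x g(1)] invariant_generated_by_limits[OF x g(1)] by blast
qed

end
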